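(* (1) For every $m\in\mathbb{Z}$, $\eta_1'(\tau)\neq0$ for all $\tau\in F_0+m$; consequently $\eta_1'(\tau)\neq0$ whenever $\operatorname{Im}\tau\ge\frac12$. (2) Let $\begin{pmatrix}a&b\\c&d\end{pmatrix}\in\Gamma_0(2)$ with $c\neq0$. Then $\frac{a\tau(-d/c)+b}{c\tau(-d/c)+d}$ is the unique zero of $\eta_1'$ in $\gamma(F_0)$. In particular the set $\Theta=\{\frac{a\tau(-d/c)+b}{c\tau(-d/c)+d}:\begin{pmatrix}a&b\\c&d\end{pmatrix}\in\Gamma_0(2),\ c\neq0\}$ is exactly the set of zeros of $\eta_1'$ in $\mathbb{H}$.
   Context: For $\tau\in\mathbb{H}$, $\eta_1(\tau)=2\zeta(\frac12|\tau)$, $\eta_2(\tau)=2\zeta(\frac\tau2|\tau)=\tau\eta_1(\tau)-2\pi i$ where $\zeta$ is the Weierstrass zeta function of $\mathbb{Z}+\mathbb{Z}\tau$; $g_2(\tau)=60\sum_{(m,n)\neq(0,0)}(m\tau+n)^{-4}$. $\Gamma_0(2)=\{\begin{pmatrix}a&b\\c&d\end{pmatrix}\in SL(2,\mathbb{Z}):2\mid c\}$ acting by Möbius transformations, $\gamma(F_0)=\{\gamma\cdot\tau:\tau\in F_0\}$, $F_0=\{\tau\in\mathbb{H}:0\le\operatorname{Re}\tau\le1,|\tau-\frac12|\ge\frac12\}$, $F_0+m=\{\tau+m:\tau\in F_0\}$. For $C\in\mathbb{R}$, $f_C(\tau)=12(C\eta_1-\eta_2)^2-g_2(C-\tau)^2$;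 for $C\in\mathbb{R}\setminus\{0,1\}$ it has exactly one zero in $F_0$, denoted $\tau(C)$. *)

theory Defs
  imports "HOL-Complex_Analysis.Complex_Analysis"
begin

definition upper_half_plane :: "complex set" where
  "upper_half_plane = {\<tau>. Im \<tau> > 0}"

definition wzeta :: "complex \<Rightarrow> complex \<Rightarrow> complex" where
  "wzeta z \<tau> = 1 / z + (\<Sum>\<^sub>\<infinity>(m::int, n::int)\<in>UNIV - {(0, 0)}.
     let \<omega> = of_int m * \<tau> + of_int n in 1 / (z - \<omega>) + 1 / \<omega> + z / \<omega>^2)"

definition eta1 :: "complex \<Rightarrow> complex" where
  "eta1 \<tau> = 2 * wzeta (1/2) \<tau>"

definition eta2 :: "complex \<Rightarrow> complex" where
  "eta2 \<tau> = 2 * wzeta (\<tau>/2) \<tau>"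

definition g2 :: "complex \<Rightarrow> complex" where
  "g2 \<tau> = 60 * (\<Sum>\<^sub>\<infinity>(m::int, n::int)\<in>UNIV - {(0, 0)}. 1 / (of_int m * \<tau> + of_int n)^4)"

definition Gamma0_2 :: "(int^2^2) set" where
  "Gamma0_2 = {\<gamma>. det \<gamma> = 1 \<and> 2 dvd \<gamma>$2$1}"

definition moebius_act :: "int^2^2 \<Rightarrow> complex \<Rightarrow> complex" where
  "moebius_act \<gamma> = moebius (of_int (\<gamma>$1$1)) (of_int (\<gamma>$1$2)) (of_int (\<gamma>$2$1)) (of_int (\<gamma>$2$2))"

definition F0 :: "complex set" where
  "F0 = {\<tau>\<in>upper_half_plane. 0 \<le> Re \<tau> \<and> Re \<tau> \<le> 1 \<and> cmod (\<tau> - 1/2) \<ge> 1/2}"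

definition f_C :: "real \<Rightarrow> complex \<Rightarrow> complex" where
  "f_C C \<tau> = 12 * (of_real C * eta1 \<tau> - eta2 \<tau>)^2 - g2 \<tau> * (of_real C - \<tau>)^2"

(* Only meaningful for C other than 0 and 1, where the zero exists and is unique. *)
definition tau_zero :: "real \<Rightarrow> complex" where
  "tau_zero C = (THE \<tau>. \<tau> \<in> F0 \<and> f_C C \<tau> = 0)"

definition Theta :: "complex set" where
  "Theta = {moebius_act \<gamma> (tau_zero (- of_int (\<gamma>$2$2) / of_int (\<gamma>$2$1))) | \<gamma>. \<gamma> \<in> Gamma0_2 \<and> \<gamma>$2$1 \<noteq> 0}"

end

theory Submission
  imports Defs
begin

text \<open>
  Write \<open>\<eta>\<^sub>1 = (\<pi>\<^sup>2/3) E\<^sub>2\<close>. Summing the defining series of \<open>\<zeta>(1/2)\<close> and \<open>\<zeta>(\<tau>/2)\<close> row by row gives the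
  \<open>q\<close>-expansion of \<open>\<eta>\<^sub>1\<close> and, since the cotangents telescope, the Legendre relation; hence the behaviour
  of \<open>E\<^sub>2\<close> under \<open>\<tau> \<mapsto> -1/\<tau>\<close>. Ramanujan's identity \<open>12 \<eta>\<^sub>1\<^sup>2 - g\<^sub>2 = -24 \<pi> i \<eta>\<^sub>1'\<close> holds because the
  difference of both sides is a cusp form of weight 4. So \<open>\<eta>\<^sub>1'(\<gamma>\<tau>)\<close> is a nonvanishing multiple of
  \<open>f\<^sub>C(\<tau>)\<close> with \<open>C = -d/c\<close>, and it remains to count the zeros of \<open>f\<^sub>C\<close> in the ideal triangle \<open>F\<^sub>0\<close>.

  For real \<open>C\<close> the form \<open>f\<^sub>C\<close> has no zeros on the sides of \<open>F\<^sub>0\<close>, because \<open>E\<^sub>2\<close> is real and \<open>q dE\<^sub>2/dq < 0\<close> on the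
  imaginary axis, and no zeros near the cusps as long as \<open>C\<close> stays away from \<open>0, 1, \<infinity>\<close>. The rotation
  \<open>\<tau> \<mapsto> 1/(1 - \<tau>)\<close> of \<open>F\<^sub>0\<close> reduces everything to \<open>C > 1\<close>, where the number of zeros does not change
  along \<open>C \<rightarrow> \<infinity>\<close>. As \<open>\<eta>\<^sub>1'\<close> itself has no zero in \<open>F\<^sub>0\<close> (an explicit estimate), all zeros of \<open>f\<^sub>C\<close> move into
  the cusp \<open>\<infinity>\<close>, where \<open>f\<^sub>C\<close> is a perturbation of \<open>q - i/(24 \<pi> C)\<close> and has exactly one.
\<close>

subsection \<open>Continuation of a unique simple zero\<close>

text \<open>\<open>F0\<close> is not compact: it touches the real axis at 0 and 1 and reaches up to
  infinity, and a zero of f_C might be lost through any of these three cusps as C varies. For C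
  tending to infinity the zero does get lost, since the limiting form eta1' has none in
  \<open>F0\<close>. The count can therefore not be read off from the limit; it is made at one large
  finite C, by a second and explicit homotopy, and carried back to smaller C inside a truncation of
  \<open>F0\<close> that is fixed for the whole interval. Everything is expressed through one form
  \<open>Psi u v\<close>, quadratic in (u, v): up to nonzero factors (0, 1) gives eta1' and (1, -C)
  gives f_C. Integer substitutions of (u, v) permute the sides and the cusps of \<open>F0\<close>,
  so one estimate serves for all three. Explicit numerics are confined to Im \<tau> above 0.866,
  just below sqrt 3 / 2, where |q| is at most 0.0044. The modular triangle and its two rotates cover
  \<open>F0\<close>, and on the rotates eta1' turns into the forms with C = 0 and C = 1.\<close>

lemma uniform_continuity_in_parameter:
  fixes f :: "real \<Rightarrow> complex \<Rightarrow> complex"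
  assumes cont: "continuous_on (T \<times> K) (\<lambda>(t, z). f t z)" and "compact T" "compact K"
    and "t0 \<in> T" "d > 0"
  shows "\<exists>e>0. \<forall>t\<in>T. dist t t0 < e \<longrightarrow> (\<forall>z\<in>K. cmod (f t z - f t0 z) < d)"
proof -
  have "uniformly_continuous_on (T \<times> K) (\<lambda>(t, z). f t z)"
    using assms by (intro compact_uniformly_continuous compact_Times)
  then obtain e where e: "e > 0" "\<And>x y. \<lbrakk>x \<in> T \<times> K; y \<in> T \<times> K; dist y x < e\<rbrakk> \<Longrightarrow>
      dist ((\<lambda>(t, z). f t z) y) ((\<lambda>(t, z). f t z) x) < d"
    using \<open>d > 0\<close> unfolding uniformly_continuous_on_def by blast
  show ?thesis
  proof (intro exI conjI ballI impI)
    fix t z assume *: "t \<in> T" "dist t t0 < e" "z \<in> K"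
    then have "dist (t, z) (t0, z) < e" by (simp add: dist_Pair_Pair)
    then show "cmod (f t z - f t0 z) < d"
      using e(2)[of "(t0, z)" "(t, z)"] * \<open>t0 \<in> T\<close> by (auto simp: dist_norm)
  qed (fact e)
qed

text \<open>The strict inequality in the conclusion is the hypothesis of Rouche's theorem when
  \<open>K\<close> is a circle; it also forces \<open>f t\<close> to be nonzero on
  \<open>K\<close>.\<close>

lemma nonzero_on_compact_persists:
  fixes f :: "real \<Rightarrow> complex \<Rightarrow> complex"
  assumes cont: "continuous_on (T \<times> K) (\<lambda>(t, z). f t z)" and "compact T" "compact K"
    and "t0 \<in> T" and nz: "\<And>z. z \<in> K \<Longrightarrow> f t0 z \<noteq> 0"
  shows "\<exists>e>0. \<forall>t\<in>T. dist t t0 < e \<longrightarrow> (\<forall>z\<in>K. cmod (f t z - f t0 z) < cmod (f t0 z))"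
proof (cases "K = {}")
  case False
  have "continuous_on K (\<lambda>z. case (t0, z) of (t, z) \<Rightarrow> f t z)"
    by (rule continuous_on_compose2[OF cont]) (use \<open>t0 \<in> T\<close> in \<open>auto intro!: continuous_intros\<close>)
  then have "continuous_on K (\<lambda>z. cmod (f t0 z))"
    by (auto intro: continuous_intros)
  then obtain z0 where z0: "z0 \<in> K" "\<And>z. z \<in> K \<Longrightarrow> cmod (f t0 z0) \<le> cmod (f t0 z)"
    using continuous_attains_inf[OF \<open>compact K\<close> False] by blast
  obtain e where "e > 0" "\<forall>t\<in>T. dist t t0 < e \<longrightarrow> (\<forall>z\<in>K. cmod (f t z - f t0 z) < cmod (f t0 z0))"
    using uniform_continuity_in_parameter[OF cont \<open>compact T\<close> \<open>compact K\<close> \<open>t0 \<in> T\<close>, of "cmod (f t0 z0)"]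
      nz[OF z0(1)] by auto
  then show ?thesis
    using z0(2) by (meson less_le_trans)
qed (auto intro: exI[of _ 1])

text \<open>Rouche on the circle of radius \<open>r\<close>. The larger disc of radius
  \<open>r'\<close> is the open domain that the theorem asks for; \<open>f t\<close> may have
  further zeros in the ring between the radii, but the circle winds around them 0 times.\<close>

lemma zero_count_near_isolated_zero:
  fixes f :: "real \<Rightarrow> complex \<Rightarrow> complex"
  assumes U: "open U" "connected U"
    and holo: "\<And>t. t \<in> T \<Longrightarrow> f t holomorphic_on U"
    and cont: "continuous_on (T \<times> U) (\<lambda>(t, z). f t z)"
    and "compact T" "t0 \<in> T" and r: "0 < r" "r < r'" "cball z0 r' \<subseteq> U"
    and iso: "\<And>z. z \<in> cball z0 r' \<Longrightarrow> f t0 z = 0 \<Longrightarrow> z = z0" and z0: "f t0 z0 = 0"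
  shows "\<exists>e>0. \<forall>t\<in>T. dist t t0 < e \<longrightarrow> finite {z\<in>cball z0 r. f t z = 0} \<and>
           (\<Sum>p | p \<in> cball z0 r \<and> f t p = 0. zorder (f t) p) = zorder (f t0) z0"
proof -
  have sub: "sphere z0 r \<subseteq> U" "cball z0 r \<subseteq> ball z0 r'" "ball z0 r' \<subseteq> U"
    using r by auto
  have "continuous_on (T \<times> sphere z0 r) (\<lambda>(t, z). f t z)"
    by (rule continuous_on_subset[OF cont]) (use sub in auto)
  from nonzero_on_compact_persists[OF this \<open>compact T\<close> compact_sphere \<open>t0 \<in> T\<close>]
  obtain e where e: "e > 0"
    "\<And>t z. \<lbrakk>t \<in> T; dist t t0 < e; z \<in> sphere z0 r\<rbrakk> \<Longrightarrow> cmod (f t z - f t0 z) < cmod (f t0 z)"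
    using iso r by (metis (no_types, opaque_lifting) dist_self less_irrefl mem_sphere mem_cball less_imp_le)
  show ?thesis
  proof (intro exI[of _ e] conjI ballI impI)
    fix t assume t: "t \<in> T" "dist t t0 < e"
    have nz: "f t z \<noteq> 0" if "z \<in> sphere z0 r" for z
      using e(2)[OF t that] by auto
    have z1: "z0 + of_real r \<in> sphere z0 r"
      using r by (simp add: dist_norm)
    \<comment> \<open>Finiteness of the zeros in a compact set requires a nonconstant function. A
      constant \<open>g\<close> is nonzero because its value at a point of the circle is.\<close>
    have fin: "finite {z\<in>cball z0 r'. g z = 0}" if "g holomorphic_on U" "g (z0 + of_real r) \<noteq> 0" for g
    proof (cases "g constant_on U")
      case True
      then have "g z \<noteq> 0" if "z \<in> U" for z
        using \<open>g (z0 + of_real r) \<noteq> 0\<close> z1 sub that unfolding constant_on_def by fastforce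
      then have "{z\<in>cball z0 r'. g z = 0} = {}"
        using r by auto
      then show ?thesis by (metis finite.emptyI)
    next
      case False
      then show ?thesis
        by (intro holomorphic_compact_finite_zeros[of g U]) (use U r that in auto)
    qed
    have fin_t: "finite {z\<in>cball z0 r'. f t z = 0}"
      by (rule fin) (use holo t nz z1 in auto)
    show "finite {z\<in>cball z0 r. f t z = 0}"
      by (rule finite_subset[OF _ fin_t]) (use r in auto)
    let ?g = "\<lambda>z. f t z - f t0 z" and ?c = "circlepath z0 r"
    have w1: "winding_number ?c p = 1" if "dist z0 p < r" for p
      using that by (intro winding_number_circlepath) (simp add: dist_norm norm_minus_commute)
    have w0: "winding_number ?c p = 0" if "dist z0 p > r" for p
      using that r by (intro winding_number_zero_outside[of _ "cball z0 r"]) auto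
    have "(\<Sum>p\<in>{p\<in>ball z0 r'. f t0 p + ?g p = 0}. winding_number ?c p * zorder (\<lambda>p. f t0 p + ?g p) p) =
          (\<Sum>p\<in>{p\<in>ball z0 r'. f t0 p = 0}. winding_number ?c p * zorder (f t0) p)"
    proof (rule Rouche_theorem)
      show "finite {p \<in> ball z0 r'. f t0 p + ?g p = 0}"
        by (rule finite_subset[OF _ fin_t]) auto
      show "finite {p \<in> ball z0 r'. f t0 p = 0}"
        by (rule finite_subset[of _ "{z0}"]) (use iso in auto)
      show "f t0 holomorphic_on ball z0 r'" "?g holomorphic_on ball z0 r'"
        using holo[OF t(1)] holo[OF \<open>t0 \<in> T\<close>] sub by (auto intro!: holomorphic_intros intro: holomorphic_on_subset)
      show "path_image ?c \<subseteq> ball z0 r'"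
        using r by auto
      show "\<forall>z\<in>path_image ?c. cmod (?g z) < cmod (f t0 z)"
        using e(2)[OF t] r by auto
      show "\<forall>z. z \<notin> ball z0 r' \<longrightarrow> winding_number ?c z = 0"
        using w0 r by auto
    qed auto
    moreover have "{p\<in>ball z0 r'. f t0 p = 0} = {z0}"
      using iso z0 r by auto
    moreover have "(\<Sum>p\<in>{p\<in>ball z0 r'. f t p = 0}. winding_number ?c p * zorder (f t) p) =
       (\<Sum>p\<in>{p\<in>cball z0 r. f t p = 0}. winding_number ?c p * zorder (f t) p)"
    proof (rule sum.mono_neutral_right)
      show "finite {p \<in> ball z0 r'. f t p = 0}"
        by (rule finite_subset[OF _ fin_t]) auto
    qed (use r w0 in \<open>force+\<close>)
    moreover have "\<dots> = (\<Sum>p\<in>{p\<in>cball z0 r. f t p = 0}. of_int (zorder (f t) p))"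
      by (rule sum.cong) (use w1 nz in \<open>force simp: less_le\<close>)+
    ultimately have "(of_int (\<Sum>p | p \<in> cball z0 r \<and> f t p = 0. zorder (f t) p) :: complex)
        = of_int (zorder (f t0) z0)"
      using w1[of z0] r by simp
    then show "(\<Sum>p | p \<in> cball z0 r \<and> f t p = 0. zorder (f t) p) = zorder (f t0) z0"
      by (simp only: of_int_eq_iff)
  qed (fact e)
qed

text \<open>The order is part of the notion because uniqueness alone is unstable: a double zero may
  split in two under perturbation.\<close>

definition unique_simple_zero :: "(complex \<Rightarrow> complex) \<Rightarrow> complex set \<Rightarrow> bool" where
  "unique_simple_zero f S \<longleftrightarrow> (\<exists>z. {w\<in>S. f w = 0} = {z} \<and> zorder f z = 1)"

text \<open>No contour integral along the boundary of \<open>S\<close> is needed: all zeros lie in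
  the open set \<open>V\<close>, so small circles around the zeros of \<open>f t0\<close> carry the
  count, and compactness keeps \<open>f t\<close> away from 0 elsewhere. A point of
  \<open>S - V\<close> witnesses that no \<open>f t\<close> vanishes identically.\<close>

lemma unique_simple_zero_locally_constant:
  fixes f :: "real \<Rightarrow> complex \<Rightarrow> complex"
  assumes U: "open U" "connected U"
    and holo: "\<And>t. t \<in> T \<Longrightarrow> f t holomorphic_on U"
    and cont: "continuous_on (T \<times> U) (\<lambda>(t, z). f t z)"
    and "compact T" "t0 \<in> T" and S: "compact S" "S \<subseteq> U" "open V" "V \<subseteq> S" "S - V \<noteq> {}"
    and nz: "\<And>t z. t \<in> T \<Longrightarrow> z \<in> S - V \<Longrightarrow> f t z \<noteq> 0"
  shows "\<exists>e>0. \<forall>t\<in>T. dist t t0 < e \<longrightarrow> unique_simple_zero (f t) S = unique_simple_zero (f t0) S"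
proof -
  have not0: "\<exists>w\<in>U. f t w \<noteq> 0" if "t \<in> T" for t
    using nz[OF that] S by blast
  have pos: "zorder (f t) z > 0" if "t \<in> T" "z \<in> U" "f t z = 0" for t z
    using zorder_exist_zero[OF holo U, of t z] that not0 by auto
  have near: "\<exists>r>0. r < d \<and> cball z r \<subseteq> V \<and> (\<forall>w\<in>cball z r. f t0 w = 0 \<longrightarrow> w = z) \<and>
      (\<exists>e>0. \<forall>t\<in>T. dist t t0 < e \<longrightarrow> finite {w\<in>cball z r. f t w = 0} \<and>
           (\<Sum>p | p \<in> cball z r \<and> f t p = 0. zorder (f t) p) = zorder (f t0) z)"
    if z: "z \<in> S" "f t0 z = 0" and "d > 0" for z d
  proof -
    have "z \<in> V" using z nz \<open>t0 \<in> T\<close> by blast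
    have "z \<in> U" using z S by blast
    obtain r1 where r1: "r1 > 0" "\<forall>w\<in>cball z r1. f t0 w = zor_poly (f t0) z w * (w - z) ^ nat (zorder (f t0) z)
        \<and> zor_poly (f t0) z w \<noteq> 0"
      using zorder_exist_zero[OF holo[OF \<open>t0 \<in> T\<close>] U \<open>z \<in> U\<close>] not0[OF \<open>t0 \<in> T\<close>] by metis
    obtain r2 where r2: "r2 > 0" "cball z r2 \<subseteq> V"
      using \<open>open V\<close> \<open>z \<in> V\<close> open_contains_cball by blast
    define r' where "r' = min r1 (min r2 d)"
    have r': "r' > 0" "r' \<le> d" "cball z r' \<subseteq> V"
      using r1 r2 \<open>d > 0\<close> unfolding r'_def by auto
    have iso: "w = z" if "w \<in> cball z r'" "f t0 w = 0" for w
    proof -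
      have "w \<in> cball z r1" using that by (auto simp: r'_def)
      then show ?thesis using r1 that by auto
    qed
    show ?thesis
    proof (rule exI[of _ "r' / 2"], intro conjI)
      show "\<exists>e>0. \<forall>t\<in>T. dist t t0 < e \<longrightarrow> finite {w\<in>cball z (r'/2). f t w = 0} \<and>
           (\<Sum>p | p \<in> cball z (r'/2) \<and> f t p = 0. zorder (f t) p) = zorder (f t0) z"
        by (rule zero_count_near_isolated_zero[OF U holo cont \<open>compact T\<close> \<open>t0 \<in> T\<close>, of "r'/2" r'])
           (use r' iso z S in auto)
      have "cball z (r'/2) \<subseteq> cball z r'" using r' by auto
      then show "cball z (r'/2) \<subseteq> V" "\<forall>w\<in>cball z (r'/2). f t0 w = 0 \<longrightarrow> w = z"
        using r' iso by blast+
    qed (use r' in auto)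
  qed
  have persist: "\<exists>e>0. \<forall>t\<in>T. dist t t0 < e \<longrightarrow> (\<forall>w\<in>K. f t w \<noteq> 0)"
    if K: "compact K" "K \<subseteq> S" "\<And>w. w \<in> K \<Longrightarrow> f t0 w \<noteq> 0" for K
  proof -
    have "continuous_on (T \<times> K) (\<lambda>(t, z). f t z)"
      by (rule continuous_on_subset[OF cont]) (use K S in auto)
    from nonzero_on_compact_persists[OF this \<open>compact T\<close> K(1) \<open>t0 \<in> T\<close> K(3)]
    show ?thesis
      by (metis diff_0 norm_minus_cancel less_irrefl)
  qed
  show ?thesis
  proof (cases "\<exists>z\<in>S. f t0 z = 0")
    case False
    then obtain e where "e > 0" "\<forall>t\<in>T. dist t t0 < e \<longrightarrow> (\<forall>w\<in>S. f t w \<noteq> 0)"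
      using persist[OF S(1)] by blast
    then have "\<forall>t\<in>T. dist t t0 < e \<longrightarrow> \<not> unique_simple_zero (f t) S"
      unfolding unique_simple_zero_def by blast
    moreover have "\<not> unique_simple_zero (f t0) S"
      using False unfolding unique_simple_zero_def by blast
    ultimately show ?thesis
      using \<open>e > 0\<close> by blast
  next
    case True
    then obtain z where z: "z \<in> S" "f t0 z = 0" by blast
    show ?thesis
    proof (cases "\<exists>z'\<in>S. f t0 z' = 0 \<and> z' \<noteq> z")
      case True
      then obtain z' where z': "z' \<in> S" "f t0 z' = 0" "z' \<noteq> z" by blast
      \<comment> \<open>Discs of radius below half the distance are disjoint. Each of the two
        retains a zero of \<open>f t\<close>, so the failure of uniqueness persists.\<close>
      define d where "d = dist z z' / 2"
      have "d > 0" using z' by (simp add: d_def)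
      have dis: "cball z r \<inter> cball z' r' = {}" if "r < d" "r' < d" for r r'
        using that by (auto simp: d_def) metric
      have ex: "\<exists>r>0. r < d \<and> (\<exists>e>0. \<forall>t\<in>T. dist t t0 < e \<longrightarrow> (\<exists>w\<in>cball u r \<inter> S. f t w = 0))"
        if u: "u \<in> S" "f t0 u = 0" for u
      proof -
        obtain r e where r: "r > 0" "r < d" "cball u r \<subseteq> V" "e > 0"
          "\<forall>t\<in>T. dist t t0 < e \<longrightarrow> finite {w\<in>cball u r. f t w = 0} \<and>
           (\<Sum>p | p \<in> cball u r \<and> f t p = 0. zorder (f t) p) = zorder (f t0) u"
          by (insert near[OF u \<open>d > 0\<close>], elim exE conjE, rule that)
        have "\<exists>w\<in>cball u r \<inter> S. f t w = 0" if "t \<in> T" "dist t t0 < e" for t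
        proof (rule ccontr)
          assume "\<not> ?thesis"
          then have "{p. p \<in> cball u r \<and> f t p = 0} = {}"
            using r S by blast
          then have "zorder (f t0) u = 0"
            using r(5) that by (metis (no_types, lifting) sum.empty)
          then show False
            using pos[OF \<open>t0 \<in> T\<close>, of u] u S by auto
        qed
        then show ?thesis using r by blast
      qed
      obtain r e where r: "r < d" "e > 0" "\<forall>t\<in>T. dist t t0 < e \<longrightarrow> (\<exists>w\<in>cball z r \<inter> S. f t w = 0)"
        using ex[OF z] by blast
      obtain r' e' where r': "r' < d" "e' > 0" "\<forall>t\<in>T. dist t t0 < e' \<longrightarrow> (\<exists>w\<in>cball z' r' \<inter> S. f t w = 0)"
        using ex[OF z'(1,2)] by blast
      have "\<not> unique_simple_zero (f t) S" if t: "t \<in> T" "dist t t0 < min e e'" for t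
      proof -
        obtain w w' where w: "w \<in> cball z r" "w \<in> S" "f t w = 0" "w' \<in> cball z' r'" "w' \<in> S" "f t w' = 0"
          using r(3)[rule_format, of t] r'(3)[rule_format, of t] t by auto
        then have "w \<noteq> w'" using dis[OF r(1) r'(1)] by blast
        show ?thesis
        proof
          assume "unique_simple_zero (f t) S"
          then obtain p where p: "{w\<in>S. f t w = 0} = {p}" unfolding unique_simple_zero_def by blast
          have "w \<in> {w\<in>S. f t w = 0}" "w' \<in> {w\<in>S. f t w = 0}" using w by auto
          then show False using \<open>w \<noteq> w'\<close> unfolding p by simp
        qed
      qed
      then have "\<forall>t\<in>T. dist t t0 < min e e' \<longrightarrow> unique_simple_zero (f t) S = unique_simple_zero (f t0) S"
        using \<open>t0 \<in> T\<close> r(2) r'(2) by simp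
      then show ?thesis
        using r(2) r'(2) by (intro exI[of _ "min e e'"]) auto
    next
      case False
      then have zs: "{w\<in>S. f t0 w = 0} = {z}" using z by blast
      obtain r e where r: "r > 0" "cball z r \<subseteq> V" "e > 0"
          "\<forall>t\<in>T. dist t t0 < e \<longrightarrow> finite {w\<in>cball z r. f t w = 0} \<and>
           (\<Sum>p | p \<in> cball z r \<and> f t p = 0. zorder (f t) p) = zorder (f t0) z"
        by (insert near[OF z zero_less_one], elim exE conjE, rule that)
      have "\<exists>e>0. \<forall>t\<in>T. dist t t0 < e \<longrightarrow> (\<forall>w\<in>S - ball z r. f t w \<noteq> 0)"
        using False r by (intro persist compact_diff S) auto
      then obtain e' where e': "e' > 0" "\<forall>t\<in>T. dist t t0 < e' \<longrightarrow> (\<forall>w\<in>S - ball z r. f t w \<noteq> 0)"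
        by blast
      \<comment> \<open>All zeros of \<open>f t\<close> in \<open>S\<close> lie in the disc, and
        their orders, each at least 1, add up to the order of \<open>f t0\<close> at
        \<open>z\<close>. A total of 1 means one simple zero.\<close>
      have "unique_simple_zero (f t) S \<longleftrightarrow> zorder (f t0) z = 1" if t: "t \<in> T" "dist t t0 < min e e'" for t
      proof -
        define Z where "Z = {p. p \<in> cball z r \<and> f t p = 0}"
        have Z: "{w\<in>S. f t w = 0} = Z"
          using e'(2)[rule_format, of t] t r(2) S(4) unfolding Z_def by (fastforce simp: less_imp_le)
        have Zfin: "finite Z" and Zsum: "(\<Sum>p\<in>Z. zorder (f t) p) = zorder (f t0) z"
          using r(4) t unfolding Z_def by auto
        have Zpos: "zorder (f t) p \<ge> 1" if "p \<in> Z" for p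
          using pos[OF t(1), of p] that S Z by auto
        show ?thesis
        proof
          assume "unique_simple_zero (f t) S"
          then show "zorder (f t0) z = 1"
            unfolding unique_simple_zero_def Z using Zsum by auto
        next
          assume 1: "zorder (f t0) z = 1"
          have "int (card Z) = (\<Sum>p\<in>Z. 1)" by simp
          also have "\<dots> \<le> (\<Sum>p\<in>Z. zorder (f t) p)"
            by (intro sum_mono Zpos)
          finally have "card Z \<le> 1" using Zsum 1 by simp
          moreover have "Z \<noteq> {}" using Zsum 1 by auto
          ultimately have "card Z = 1" using Zfin by (simp add: le_less card_gt_0_iff less_one)
          then obtain p where "Z = {p}" by (auto simp: card_1_singleton_iff)
          then show "unique_simple_zero (f t) S"
            unfolding unique_simple_zero_def Z using Zsum 1 by auto
        qed
      qed
      then have "\<forall>t\<in>T. dist t t0 < min e e' \<longrightarrow> unique_simple_zero (f t) S = unique_simple_zero (f t0) S"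
        using \<open>t0 \<in> T\<close> r(3) e'(1) by simp
      then show ?thesis
        using r(3) e'(1) by (intro exI[of _ "min e e'"]) auto
    qed
  qed
qed

text \<open>A locally constant truth value on a connected interval is constant.\<close>

lemma unique_simple_zero_continuation:
  fixes f :: "real \<Rightarrow> complex \<Rightarrow> complex"
  assumes U: "open U" "connected U"
    and holo: "\<And>t. t \<in> {a..b} \<Longrightarrow> f t holomorphic_on U"
    and cont: "continuous_on ({a..b} \<times> U) (\<lambda>(t, z). f t z)"
    and S: "compact S" "S \<subseteq> U" "open V" "V \<subseteq> S" "S - V \<noteq> {}"
    and nz: "\<And>t z. t \<in> {a..b} \<Longrightarrow> z \<in> S - V \<Longrightarrow> f t z \<noteq> 0"
    and st: "s \<in> {a..b}" "t \<in> {a..b}"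
  shows "unique_simple_zero (f s) S \<longleftrightarrow> unique_simple_zero (f t) S"
proof -
  have "(\<lambda>t. unique_simple_zero (f t) S) constant_on {a..b}"
  proof (rule locally_constant_imp_constant)
    fix t0 assume t0: "t0 \<in> {a..b}"
    have "\<exists>e>0. \<forall>t\<in>{a..b}. dist t t0 < e \<longrightarrow> unique_simple_zero (f t) S = unique_simple_zero (f t0) S"
      by (rule unique_simple_zero_locally_constant[OF U _ cont compact_Icc t0 S]) (use holo nz in auto)
    then obtain e where e: "e > 0"
      "\<forall>t\<in>{a..b}. dist t t0 < e \<longrightarrow> unique_simple_zero (f t) S = unique_simple_zero (f t0) S"
      by (elim exE conjE) (rule that)
    show "\<exists>N. openin (top_of_set {a..b}) N \<and> t0 \<in> N \<and>
        (\<forall>t\<in>N. unique_simple_zero (f t) S = unique_simple_zero (f t0) S)"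
    proof (intro exI[of _ "{a..b} \<inter> ball t0 e"] conjI ballI)
      show "openin (top_of_set {a..b}) ({a..b} \<inter> ball t0 e)"
        by (simp add: openin_open_Int)
      show "t0 \<in> {a..b} \<inter> ball t0 e"
        using e(1) t0 by simp
      fix t assume "t \<in> {a..b} \<inter> ball t0 e"
      then show "unique_simple_zero (f t) S = unique_simple_zero (f t0) S"
        using e(2)[rule_format, of t] by (simp add: dist_commute)
    qed
  qed auto
  then show ?thesis
    using st by (metis constant_on_def)
qed

subsection \<open>Partial fractions over the integers\<close>

text \<open>Logarithmic derivative of
  \<open>Gamma z * Gamma (1 - z) = pi / sin (pi * z)\<close>.\<close>

lemma Digamma_reflection:
  fixes z :: complex
  assumes "z \<notin> \<int>"
  shows "Digamma (1 - z) - Digamma z = of_real pi * cot (of_real pi * z)"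
proof -
  have z1: "1 - z \<notin> \<int>"
    using Ints_diff[OF Ints_1, of "1 - z"] assms by auto
  have nz: "z \<notin> \<int>\<^sub>\<le>\<^sub>0" "1 - z \<notin> \<int>\<^sub>\<le>\<^sub>0"
    using assms z1 nonpos_Ints_Int by blast+
  have sin0: "sin (of_real pi * z) \<noteq> 0"
    using assms by (auto simp: sin_eq_0 mult.commute)
  let ?G = "Gamma z * Gamma (1 - z)"
  have "((\<lambda>z. Gamma z * Gamma (1 - z)) has_field_derivative
        ?G * (Digamma z - Digamma (1 - z))) (at z)"
    using nz by (auto intro!: derivative_eq_intros simp: algebra_simps)
  moreover have "((\<lambda>z. of_real pi / sin (of_real pi * z)) has_field_derivative
        - (of_real pi / sin (of_real pi * z)) * (of_real pi * cot (of_real pi * z))) (at z)"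
    using sin0 by (auto intro!: derivative_eq_intros simp: cot_def power2_eq_square field_simps)
  ultimately have "?G * (Digamma z - Digamma (1 - z)) =
      - (of_real pi / sin (of_real pi * z)) * (of_real pi * cot (of_real pi * z))"
    using Gamma_reflection_complex by (simp add: DERIV_unique)
  moreover have "?G \<noteq> 0"
    using sin0 by (simp add: Gamma_reflection_complex)
  ultimately have "Digamma z - Digamma (1 - z) = - (of_real pi * cot (of_real pi * z))"
    using Gamma_reflection_complex[of z]
    by (metis minus_mult_commute mult_left_cancel)
  then show ?thesis
    by (simp add: algebra_simps)
qed

text \<open>One differentiation step, to be iterated: the chain rule applied to \<open>1 - z\<close>
  flips the sign of the coefficient \<open>c\<close>.\<close>

lemma Polygamma_reflection_aux:
  fixes z :: complex and f f' :: "complex \<Rightarrow> complex"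
  assumes eq: "\<And>z. z \<notin> \<int> \<Longrightarrow> c * Polygamma n (1 - z) + d * Polygamma n z = f z"
  assumes f': "\<And>z. z \<notin> \<int> \<Longrightarrow> sin (of_real pi * z) \<noteq> 0 \<Longrightarrow> (f has_field_derivative f' z) (at z)"
  assumes "z \<notin> \<int>"
  shows "- c * Polygamma (Suc n) (1 - z) + d * Polygamma (Suc n) z = f' z"
proof -
  have z1: "1 - z \<notin> \<int>"
    using Ints_diff[OF Ints_1, of "1 - z"] assms by auto
  have nz: "z \<notin> \<int>\<^sub>\<le>\<^sub>0" "1 - z \<notin> \<int>\<^sub>\<le>\<^sub>0"
    using assms z1 nonpos_Ints_Int by blast+
  have sin0: "sin (of_real pi * z) \<noteq> 0"
    using assms by (auto simp: sin_eq_0 mult.commute)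
  have "((\<lambda>z. c * Polygamma n (1 - z) + d * Polygamma n z) has_field_derivative
      - c * Polygamma (Suc n) (1 - z) + d * Polygamma (Suc n) z) (at z)"
    using nz by (auto intro!: derivative_eq_intros)
  moreover have "((\<lambda>z. c * Polygamma n (1 - z) + d * Polygamma n z) has_field_derivative f' z) (at z)"
    by (rule has_field_derivative_transform_within_open[OF f'[OF \<open>z \<notin> \<int>\<close> sin0], of "- \<int>"])
       (use assms in auto)
  ultimately show ?thesis
    using DERIV_unique by blast
qed

text \<open>\<open>Digamma_reflection\<close> differentiated once and three times; the orders 1 and
  3 yield the exponents 2 and 4 occurring in the series of \<open>wzeta\<close> and
  \<open>g2\<close>.\<close>

lemma Polygamma_reflection:
  fixes z :: complex
  assumes "z \<notin> \<int>"
  shows "Polygamma 1 z + Polygamma 1 (1 - z) = of_real pi ^ 2 / sin (of_real pi * z) ^ 2"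
    and "Polygamma 3 z + Polygamma 3 (1 - z) =
          of_real pi ^ 4 * (6 / sin (of_real pi * z) ^ 4 - 4 / sin (of_real pi * z) ^ 2)"
proof -
  define p :: complex where "p = of_real pi"
  have 1: "- 1 * Polygamma (Suc 0) (1 - z) + (- 1) * Polygamma (Suc 0) z
      = - (p ^ 2 / sin (p * z) ^ 2)" if "z \<notin> \<int>" for z :: complex
  proof (rule Polygamma_reflection_aux[where f = "\<lambda>z. p * (cos (p * z) / sin (p * z))"])
    show "1 * Digamma (1 - z) + - 1 * Digamma z = p * (cos (p * z) / sin (p * z))" if "z \<notin> \<int>" for z
      using Digamma_reflection[OF that] by (simp add: cot_def p_def)
    fix z :: complex assume "sin (of_real pi * z) \<noteq> 0"
    then have s: "sin (p * z) \<noteq> 0" by (simp add: p_def)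
    have "- (sin (p * z) * p * p * sin (p * z)) - p * cos (p * z) * (cos (p * z) * p) = - (p * p)"
      using sin_cos_squared_add[of "p * z"] by algebra
    then show "((\<lambda>z. p * (cos (p * z) / sin (p * z))) has_field_derivative
        - (p ^ 2 / sin (p * z) ^ 2)) (at z)"
      using s by (auto intro!: derivative_eq_intros simp: power2_eq_square)
  qed (fact that)
  have 2: "- (- 1) * Polygamma (Suc (Suc 0)) (1 - z) + (- 1) * Polygamma (Suc (Suc 0)) z
      = 2 * p ^ 3 * cos (p * z) / sin (p * z) ^ 3" if "z \<notin> \<int>" for z :: complex
  proof (rule Polygamma_reflection_aux[OF 1])
    fix z :: complex assume "sin (of_real pi * z) \<noteq> 0"
    then have s: "sin (p * z) \<noteq> 0" by (simp add: p_def)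
    then show "((\<lambda>z. - (p ^ 2 / sin (p * z) ^ 2)) has_field_derivative
        2 * p ^ 3 * cos (p * z) / sin (p * z) ^ 3) (at z)"
      by (auto intro!: derivative_eq_intros simp: power2_eq_square power3_eq_cube mult_ac)
  qed (use that in auto)
  have 3: "- (- (- 1)) * Polygamma (Suc (Suc (Suc 0))) (1 - z) + (- 1) * Polygamma (Suc (Suc (Suc 0))) z
      = - (p ^ 4 * (6 / sin (p * z) ^ 4 - 4 / sin (p * z) ^ 2))"
    if "z \<notin> \<int>" for z :: complex
  proof (rule Polygamma_reflection_aux[OF 2])
    fix z :: complex assume "sin (of_real pi * z) \<noteq> 0"
    then have s: "sin (p * z) \<noteq> 0" by (simp add: p_def)
    let ?s = "sin (p * z)" and ?c = "cos (p * z)"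
    have "2 * p ^ 3 * (- (?s * p)) * ?s ^ 3 - 2 * p ^ 3 * ?c * (3 * (?c * p) * ?s ^ 2) =
        - (p ^ 4 * (6 * ?s ^ 2 - 4 * ?s ^ 4))"
      using sin_cos_squared_add[of "p * z"] by algebra
    also have "\<dots> = - (p ^ 4 * (6 / ?s ^ 4 - 4 / ?s ^ 2)) * (?s ^ 3 * ?s ^ 3)"
      using s by (simp add: divide_simps power_numeral_reduce) (simp add: algebra_simps)
    finally have e: "(2 * p ^ 3 * (- (?s * p)) * ?s ^ 3 - 2 * p ^ 3 * ?c * (3 * (?c * p) * ?s ^ 2)) / (?s ^ 3 * ?s ^ 3)
        = - (p ^ 4 * (6 / ?s ^ 4 - 4 / ?s ^ 2))"
      using s by (subst divide_eq_eq) auto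
    show "((\<lambda>z. 2 * p ^ 3 * cos (p * z) / sin (p * z) ^ 3) has_field_derivative
       - (p ^ 4 * (6 / ?s ^ 4 - 4 / ?s ^ 2))) (at z)"
      unfolding e[symmetric] using s
      by (auto intro!: derivative_eq_intros simp: mult_ac)
  qed (use that in auto)
  show "Polygamma 1 z + Polygamma 1 (1 - z) = of_real pi ^ 2 / sin (of_real pi * z) ^ 2"
    using 1[OF assms] unfolding p_def by (simp add: add.commute) (metis add.commute minus_add_distrib neg_equal_iff_equal diff_conv_add_uminus)
  show "Polygamma 3 z + Polygamma 3 (1 - z) =
          of_real pi ^ 4 * (6 / sin (of_real pi * z) ^ 4 - 4 / sin (of_real pi * z) ^ 2)"
    using 3[OF assms] unfolding p_def eval_nat_numeral(3)[symmetric] by (simp add: numeral_3_eq_3) algebra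
qed

lemma summable_norm_shift_power:
  fixes w :: complex
  assumes "k \<ge> 2"
  shows "summable (\<lambda>n. norm (1 / (w + of_nat n) ^ k))"
proof (rule summable_comparison_test_ev)
  show "summable (\<lambda>n. 4 * inverse (real n ^ 2))"
    using inverse_power_summable[of 2, where 'a=real] by (intro summable_mult) simp
  \<comment> \<open>From \<open>2 * norm w + 2\<close> on, \<open>norm (w + of_nat n)\<close> is at
    least n/2 and at least 1; the second bound allows the exponent \<open>k\<close> to be lowered to
    2.\<close>
  show "eventually (\<lambda>n. norm (norm (1 / (w + of_nat n) ^ k)) \<le> 4 * inverse (real n ^ 2)) sequentially"
    using eventually_ge_at_top[of "nat \<lceil>2 * norm w + 2\<rceil>"]
  proof eventually_elim
    case (elim n)
    then have n: "real n \<ge> 2 * norm w + 2" by linarith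
    have "real n - norm w \<le> norm (w + of_nat n)"
      using norm_triangle_ineq2[of "of_nat n" "- w"] by (simp add: add.commute)
    then have *: "real n / 2 \<le> norm (w + of_nat n)" "1 \<le> norm (w + of_nat n)"
      using n norm_ge_zero[of w] by linarith+
    have "(real n / 2) ^ 2 \<le> norm (w + of_nat n) ^ 2"
      using * by (intro power_mono) auto
    also have "\<dots> \<le> norm (w + of_nat n) ^ k"
      using * assms by (intro power_increasing) auto
    finally have "1 / norm (w + of_nat n) ^ k \<le> 1 / (real n / 2) ^ 2"
      using * \<open>real n - norm w \<le> norm (w + of_nat n)\<close> n norm_ge_zero[of w]
      by (intro divide_left_mono mult_pos_pos zero_less_power) linarith+
    then show ?case
      by (simp add: norm_divide norm_power field_simps)
  qed
qed

text \<open>The negative half is indexed by \<open>- 1 - int n\<close>: then w + k becomes -((1 - w)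
  + n), and the two halves meet in a reflection formula.\<close>

lemma has_sum_int_split:
  fixes f :: "int \<Rightarrow> 'a :: real_normed_vector"
  assumes "((\<lambda>n::nat. f (int n)) has_sum a) UNIV" "((\<lambda>n::nat. f (- 1 - int n)) has_sum b) UNIV"
  shows "(f has_sum (a + b)) UNIV"
proof -
  have "(f has_sum a) {0..}"
    using assms(1) by (subst has_sum_reindex_bij_witness[symmetric, of UNIV nat int]) auto
  moreover have "(f has_sum b) {..<0}"
    using assms(2)
    by (subst has_sum_reindex_bij_witness[symmetric, of UNIV "\<lambda>k. nat (- 1 - k)" "\<lambda>n. - 1 - int n"]) auto
  ultimately have "(f has_sum (a + b)) ({0..} \<union> {..<0})"
    by (intro has_sum_Un_disjoint) auto
  moreover have "{0..} \<union> {..<0} = (UNIV :: int set)" by auto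
  ultimately show ?thesis by simp
qed

lemma not_Ints_D:
  fixes w :: complex
  assumes "w \<notin> \<int>"
  shows "w + of_int n \<noteq> 0" "w \<noteq> 0" "1 - w \<noteq> 0" "1 - w \<notin> \<int>"
proof -
  show "w + of_int n \<noteq> 0"
    proof
    assume "w + of_int n = 0"
    then have "w = of_int (- n)" by (simp add: eq_neg_iff_add_eq_0)
    then show False using assms by (metis Ints_of_int)
  qed
  then show "w \<noteq> 0" "1 - w \<noteq> 0"
    using assms by auto
  show "1 - w \<notin> \<int>"
    using Ints_diff[OF Ints_1, of "1 - w"] assms by auto
qed

text \<open>Polygamma series at \<open>w\<close> for the nonnegative integers and at
  \<open>1 - w\<close> for the negative ones, where the even exponent absorbs the sign.\<close>

lemma
  fixes w :: complex
  assumes "w \<notin> \<int>"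
  shows has_sum_shift_square_int:
      "((\<lambda>n::int. 1 / (w + of_int n) ^ 2) has_sum of_real pi ^ 2 / sin (of_real pi * w) ^ 2) UNIV"
    and has_sum_shift_fourth_int:
      "((\<lambda>n::int. 1 / (w + of_int n) ^ 4) has_sum
          of_real pi ^ 4 * (1 / sin (of_real pi * w) ^ 4 - 2 / 3 / sin (of_real pi * w) ^ 2)) UNIV"
proof -
  note w = not_Ints_D[OF assms]
  have *: "((\<lambda>n::nat. 1 / (v + of_nat n) ^ Suc k) has_sum ((-1) ^ Suc k * Polygamma k v / fact k)) UNIV"
    if "v \<noteq> 0" "k > 0" for v :: complex and k
    using Polygamma_LIMSEQ[OF that] summable_norm_shift_power[of "Suc k" v] that
    by (intro norm_summable_imp_has_sum) (auto simp: inverse_eq_divide)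
  have neg: "1 / (w + of_int (- 1 - int n)) ^ k = 1 / ((1 - w) + of_nat n) ^ k" if "even k" for n k
  proof -
    have "w + of_int (- 1 - int n) = - ((1 - w) + of_nat n)" by simp
    then show ?thesis using that by (metis power_minus_even)
  qed
  have "((\<lambda>n::int. 1 / (w + of_int n) ^ 2) has_sum (Polygamma 1 w + Polygamma 1 (1 - w))) UNIV"
    using *[of w 1] *[of "1 - w" 1] w neg[of 2]
    by (intro has_sum_int_split) (simp_all add: eval_nat_numeral)
  then show "((\<lambda>n::int. 1 / (w + of_int n) ^ 2) has_sum of_real pi ^ 2 / sin (of_real pi * w) ^ 2) UNIV"
    by (simp only: Polygamma_reflection(1)[OF assms])
  have "((\<lambda>n::int. 1 / (w + of_int n) ^ 4) has_sum (Polygamma 3 w / 6 + Polygamma 3 (1 - w) / 6)) UNIV"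
    using *[of w 3] *[of "1 - w" 3] w neg[of 4]
    by (intro has_sum_int_split) (simp_all add: fact_numeral)
  also have "Polygamma 3 w / 6 + Polygamma 3 (1 - w) / 6 =
     of_real pi ^ 4 * (1 / sin (of_real pi * w) ^ 4 - 2 / 3 / sin (of_real pi * w) ^ 2)"
    using Polygamma_reflection(2)[OF assms] by (simp add: add_divide_distrib[symmetric])
  finally show "((\<lambda>n::int. 1 / (w + of_int n) ^ 4) has_sum
          of_real pi ^ 4 * (1 / sin (of_real pi * w) ^ 4 - 2 / 3 / sin (of_real pi * w) ^ 2)) UNIV" .
qed

lemma summable_norm_diff_inverse_shift:
  fixes v w :: complex
  assumes "\<And>n. v + of_nat n \<noteq> 0" "\<And>n. w + of_nat n \<noteq> 0"
  shows "summable (\<lambda>n. norm (1 / (v + of_nat n) - 1 / (w + of_nat n)))"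
proof (rule summable_comparison_test')
  show "summable (\<lambda>n. norm (w - v) * (norm (1 / (v + of_nat n) ^ 2) + norm (1 / (w + of_nat n) ^ 2)))"
    by (intro summable_mult summable_add summable_norm_shift_power) auto
  fix n :: nat
  let ?a = "norm (1 / (v + of_nat n))" and ?b = "norm (1 / (w + of_nat n))"
  \<comment> \<open>The difference is a multiple of a product a b, and a b is at most a^2 + b^2, so
    square-summability suffices.\<close>
  have "1 / (v + of_nat n) - 1 / (w + of_nat n) = (w - v) * ((1 / (v + of_nat n)) * (1 / (w + of_nat n)))"
    using assms[of n] by (simp add: field_simps)
  then have "norm (1 / (v + of_nat n) - 1 / (w + of_nat n)) = norm (w - v) * (?a * ?b)"
    by (simp only: norm_mult)
  also have "?a * ?b \<le> ?a ^ 2 + ?b ^ 2"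
    using sum_squares_bound[of ?a ?b] mult_nonneg_nonneg[OF norm_ge_zero norm_ge_zero, of "1 / (v + of_nat n)" "1 / (w + of_nat n)"]
    by linarith
  finally show "norm (norm (1 / (v + of_nat n) - 1 / (w + of_nat n))) \<le>
      norm (w - v) * (norm (1 / (v + of_nat n) ^ 2) + norm (1 / (w + of_nat n) ^ 2))"
    by (simp add: norm_divide norm_power power_divide mult_left_mono)
qed

text \<open>Difference of two defining series of \<open>Digamma\<close>; the harmonic terms and the
  Euler constant cancel.\<close>

lemma has_sum_diff_inverse_shift_nat:
  fixes v w :: complex
  assumes "\<And>n. v + of_nat n \<noteq> 0" "\<And>n. w + of_nat n \<noteq> 0"
  shows "((\<lambda>n::nat. 1 / (v + of_nat n) - 1 / (w + of_nat n)) has_sum (Digamma w - Digamma v)) UNIV"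
proof (rule norm_summable_imp_has_sum[OF summable_norm_diff_inverse_shift[OF assms]])
  have "(\<lambda>n. inverse (of_nat (Suc n)) - inverse (u + of_nat n)) sums (Digamma u + euler_mascheroni)"
    if "u \<noteq> 0" for u :: complex
    using summable_sums[OF summable_Digamma[OF that]] by (simp add: Digamma_def)
  from sums_diff[OF this[of w] this[of v]]
  show "(\<lambda>n::nat. 1 / (v + of_nat n) - 1 / (w + of_nat n)) sums (Digamma w - Digamma v)"
    using assms[of 0] by (simp add: inverse_eq_divide)
qed

lemma has_sum_diff_inverse_shift_int:
  fixes v w :: complex
  assumes "v \<notin> \<int>" "w \<notin> \<int>"
  shows "((\<lambda>n::int. 1 / (v + of_int n) - 1 / (w + of_int n)) has_sum
           of_real pi * (cot (of_real pi * v) - cot (of_real pi * w))) UNIV"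
proof -
  note v = not_Ints_D[OF assms(1)] and w = not_Ints_D[OF assms(2)]
  have nat: "u + of_nat n \<noteq> 0" if "u \<notin> \<int>" for u :: complex and n
    using not_Ints_D(1)[OF that, of "int n"] by simp
  have neg: "1 / (v + of_int (- 1 - int n)) - 1 / (w + of_int (- 1 - int n)) =
      1 / ((1 - w) + of_nat n) - 1 / ((1 - v) + of_nat n)" for n
  proof -
    have "v + of_int (- 1 - int n) = - ((1 - v) + of_nat n)" "w + of_int (- 1 - int n) = - ((1 - w) + of_nat n)"
      by simp_all
    then show ?thesis by (metis (no_types, lifting) divide_minus_right minus_diff_minus minus_diff_eq)
  qed
  have "((\<lambda>n::int. 1 / (v + of_int n) - 1 / (w + of_int n)) has_sum
      ((Digamma w - Digamma v) + (Digamma (1 - v) - Digamma (1 - w)))) UNIV"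
  proof (rule has_sum_int_split)
    show "((\<lambda>n. 1 / (v + of_int (int n)) - 1 / (w + of_int (int n))) has_sum (Digamma w - Digamma v)) UNIV"
      using has_sum_diff_inverse_shift_nat[OF nat[OF assms(1)] nat[OF assms(2)]] by simp
    show "((\<lambda>n. 1 / (v + of_int (- 1 - int n)) - 1 / (w + of_int (- 1 - int n)))
        has_sum (Digamma (1 - v) - Digamma (1 - w))) UNIV"
      unfolding neg by (rule has_sum_diff_inverse_shift_nat[OF nat[OF w(4)] nat[OF v(4)]])
  qed
  also have "(Digamma w - Digamma v) + (Digamma (1 - v) - Digamma (1 - w)) =
      of_real pi * (cot (of_real pi * v) - cot (of_real pi * w))"
    using Digamma_reflection[OF assms(1)] Digamma_reflection[OF assms(2)] by (simp add: algebra_simps)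
  finally show ?thesis .
qed

subsection \<open>Row sums of the Weierstrass zeta function\<close>

lemma summable_on_int_split:
  fixes f :: "int \<Rightarrow> real"
  assumes "summable (\<lambda>n. f (int n))" "summable (\<lambda>n. f (- 1 - int n))" "\<And>n. f n \<ge> 0"
  shows "f summable_on UNIV"
proof -
  have "(\<lambda>n. f (int n)) summable_on UNIV" "(\<lambda>n. f (- 1 - int n)) summable_on UNIV"
    using assms by (auto intro!: summable_nonneg_imp_summable_on)
  then show ?thesis
    using has_sum_int_split[of f] unfolding summable_on_def by blast
qed

lemma summable_on_powr_int: "(\<lambda>n::int. (1 + \<bar>real_of_int n\<bar>) powr (- 3 / 2)) summable_on UNIV"
proof (rule summable_on_int_split)
  have s: "summable (\<lambda>n. real n powr (- 3 / 2))"
    by (simp add: summable_real_powr_iff)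
  have "summable (\<lambda>n. real (n + 1) powr (- 3 / 2))" "summable (\<lambda>n. real (n + 2) powr (- 3 / 2))"
    using summable_ignore_initial_segment[OF s, of 1] summable_ignore_initial_segment[OF s, of 2] by auto
  then show "summable (\<lambda>n. (1 + \<bar>real_of_int (int n)\<bar>) powr (- 3 / 2))"
     "summable (\<lambda>n. (1 + \<bar>real_of_int (- 1 - int n)\<bar>) powr (- 3 / 2))"
    by (simp_all add: add_ac)
qed simp

abbreviation lat :: "(int \<times> int) set" where "lat \<equiv> UNIV - {(0, 0)}"

lemma lat_height_ge_1: "p \<in> lat \<Longrightarrow> \<bar>real_of_int (fst p)\<bar> + \<bar>real_of_int (snd p)\<bar> \<ge> 1"
  by (cases p) (auto simp flip: of_int_abs of_int_add)

text \<open>With h = |m| + |n| at least 1, (1 + |m|)(1 + |n|) is at most (2h)^2. Hence h^(-3) is at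
  most 8 times the product of (1 + |m|)^(-3/2) and (1 + |n|)^(-3/2), and the double sum splits into
  two convergent single sums.\<close>

lemma summable_on_lat_height:
  assumes "k \<ge> 3"
  shows "(\<lambda>p. 1 / (\<bar>real_of_int (fst p)\<bar> + \<bar>real_of_int (snd p)\<bar>) ^ k) summable_on lat"
proof (rule summable_on_comparison_test)
  let ?u = "\<lambda>n::int. (1 + \<bar>real_of_int n\<bar>) powr (- 3 / 2)"
  have "(\<lambda>p. norm (?u (fst p) * ?u (snd p))) summable_on (UNIV \<times> UNIV)"
    unfolding Infinite_Sum.abs_summable_on_Sigma_iff
    using summable_on_powr_int
    by (auto simp: abs_mult infsum_cmult_right' intro!: summable_on_cmult_right summable_on_cmult_left)
  then have "(\<lambda>p. ?u (fst p) * ?u (snd p)) summable_on UNIV"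
    by (simp add: abs_mult)
  then have "(\<lambda>p. ?u (fst p) * ?u (snd p)) summable_on lat"
    by (rule summable_on_subset) auto
  then show "(\<lambda>p. 8 * (?u (fst p) * ?u (snd p))) summable_on lat"
    by (rule summable_on_cmult_right)
  fix p assume p: "p \<in> lat"
  let ?a = "\<bar>real_of_int (fst p)\<bar>" and ?b = "\<bar>real_of_int (snd p)\<bar>"
  let ?h = "?a + ?b"
  have h: "?h \<ge> 1" using lat_height_ge_1[OF p] .
  have "(1 + ?a) * (1 + ?b) \<le> (1 + ?h) * (1 + ?h)"
    by (intro mult_mono) auto
  also have "\<dots> \<le> (2 * ?h) * (2 * ?h)"
    using h by (intro mult_mono) auto
  also have "\<dots> = (2 * ?h) powr 2"
    using h by (simp add: powr_numeral power2_eq_square)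
  finally have "((1 + ?a) * (1 + ?b)) powr (3/2) \<le> ((2 * ?h) powr 2) powr (3/2)"
    by (intro powr_mono2) auto
  also have "\<dots> = (2 * ?h) ^ 3"
    using h by (simp only: powr_powr) (simp add: powr_numeral)
  finally have "(1 + ?a) powr (3/2) * (1 + ?b) powr (3/2) \<le> 8 * ?h ^ 3"
    by (simp only: powr_mult power_mult_distrib) (simp add: powr_mult)
  also have "\<dots> \<le> 8 * ?h ^ k"
    using h assms by (intro mult_left_mono power_increasing) auto
  finally have "8 / (8 * ?h ^ k) \<le> 8 / ((1 + ?a) powr (3/2) * (1 + ?b) powr (3/2))"
    using h by (intro divide_left_mono) auto
  then show "1 / ?h ^ k \<le> 8 * (?u (fst p) * ?u (snd p))"
    by (simp add: powr_minus field_simps)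
qed simp

text \<open>The imaginary part controls |m|, and then the triangle inequality controls |n|. This
  linear growth is what makes the lattice sums absolutely convergent.\<close>

lemma lattice_norm_bound:
  assumes "Im \<tau> > 0"
  obtains \<kappa> where "\<kappa> > 0" "\<And>m n::int. cmod (of_int m * \<tau> + of_int n) \<ge> \<kappa> * (\<bar>real_of_int m\<bar> + \<bar>real_of_int n\<bar>)"
proof
  let ?k = "1 / Im \<tau> + 1 + cmod \<tau> / Im \<tau>"
  have k: "?k > 0" using assms by (simp add: add_pos_nonneg)
  show "1 / ?k > 0" using k by simp
  fix m n :: int
  let ?w = "cmod (of_int m * \<tau> + of_int n)"
  have "\<bar>real_of_int m\<bar> * Im \<tau> = \<bar>Im (of_int m * \<tau> + of_int n)\<bar>"
    using assms by (simp add: abs_mult)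
  also have "\<dots> \<le> ?w" by (rule abs_Im_le_cmod)
  finally have m: "\<bar>real_of_int m\<bar> \<le> ?w / Im \<tau>"
    using assms by (simp add: field_simps)
  have "\<bar>real_of_int n\<bar> = cmod ((of_int m * \<tau> + of_int n) - of_int m * \<tau>)" by simp
  also have "\<dots> \<le> ?w + \<bar>real_of_int m\<bar> * cmod \<tau>"
    by (metis norm_triangle_ineq4 norm_mult norm_of_int)
  also have "\<dots> \<le> ?w + ?w / Im \<tau> * cmod \<tau>"
    using m by (intro add_left_mono mult_right_mono) auto
  finally have "\<bar>real_of_int m\<bar> + \<bar>real_of_int n\<bar> \<le> ?w * ?k"
    using m by (simp add: algebra_simps)
  then show "1 / ?k * (\<bar>real_of_int m\<bar> + \<bar>real_of_int n\<bar>) \<le> ?w"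
    using k by (simp add: field_simps)
qed

lemma lat_eq_Sigma: "lat = Sigma UNIV (\<lambda>m. {n. m = 0 \<longrightarrow> n \<noteq> 0})"
  by auto

lemma has_sum_int_nonzero:
  fixes f :: "int \<Rightarrow> 'a :: real_normed_vector"
  assumes "((\<lambda>n::nat. f (int (Suc n))) has_sum a) UNIV" "((\<lambda>n::nat. f (- int (Suc n))) has_sum b) UNIV"
  shows "(f has_sum (a + b)) {n. n \<noteq> 0}"
proof -
  have "(f has_sum a) {0<..}"
    using assms(1)
    by (subst has_sum_reindex_bij_witness[symmetric, of UNIV "\<lambda>k. nat (k - 1)" "\<lambda>n. int (Suc n)"]) auto
  moreover have "(f has_sum b) {..<0}"
    using assms(2)
    by (subst has_sum_reindex_bij_witness[symmetric, of UNIV "\<lambda>k. nat (- 1 - k)" "\<lambda>n. - int (Suc n)"]) auto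
  ultimately have "(f has_sum (a + b)) ({0<..} \<union> {..<0})"
    by (intro has_sum_Un_disjoint) auto
  moreover have "{0<..} \<union> {..<0} = {n::int. n \<noteq> 0}" by auto
  ultimately show ?thesis by simp
qed

text \<open>Pairs the terms at n and -n. Applied to row sums, it exposes the cancellation between
  the rows m and -m.\<close>

lemma has_sum_int_imp_sums:
  fixes f :: "int \<Rightarrow> complex"
  assumes "(f has_sum S) UNIV"
  shows "(\<lambda>n. f (int (Suc n)) + f (- int (Suc n))) sums (S - f 0)"
proof -
  have "f summable_on UNIV" using assms by (auto simp: summable_on_def)
  then have "f summable_on {0<..}" "f summable_on {..<0}"
    by (auto intro: summable_on_subset)
  then obtain a b where "(f has_sum a) {0<..}" "(f has_sum b) {..<0}"
    by (auto simp: summable_on_def)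
  then have a: "((\<lambda>n::nat. f (int (Suc n))) has_sum a) UNIV" and b: "((\<lambda>n::nat. f (- int (Suc n))) has_sum b) UNIV"
    by (subst has_sum_reindex_bij_witness[of "UNIV :: nat set" "\<lambda>k. nat (k - 1)" "\<lambda>n. int (Suc n)" "{0<..}" f]
       has_sum_reindex_bij_witness[of "UNIV :: nat set" "\<lambda>k. nat (- 1 - k)" "\<lambda>n. - int (Suc n)" "{..<0}" f]; auto)+
  have "(f has_sum (a + b)) {n. n \<noteq> 0}"
    by (rule has_sum_int_nonzero[OF a b])
  then have "(f has_sum (f 0 + (a + b))) ({0} \<union> {n. n \<noteq> 0})"
    by (intro has_sum_Un_disjoint has_sum_finiteI[of "{0}" "f 0" f]) auto
  moreover have "{0} \<union> {n. n \<noteq> 0} = (UNIV :: int set)" by auto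
  ultimately have "S - f 0 = a + b"
    using has_sum_unique[OF assms] by auto
  then show ?thesis
    using sums_add[OF has_sum_imp_sums[OF a] has_sum_imp_sums[OF b]] by simp
qed

lemma not_Ints_if_Im_nonzero: "Im z \<noteq> 0 \<Longrightarrow> z \<notin> \<int>"
  by (auto simp: Ints_def)

lemma has_sum_int_uminus:
  "((\<lambda>n::int. f (- n)) has_sum S) UNIV \<longleftrightarrow> (f has_sum S) UNIV"
  by (rule has_sum_reindex_bij_witness[of _ uminus uminus]) auto

lemma has_sum_int_nonzero_squares:
  "((\<lambda>n::int. 1 / of_int n ^ 2 :: complex) has_sum (of_real pi ^ 2 / 3)) {n. n \<noteq> 0}"
proof -
  have "((\<lambda>n. 1 / (real n + 1) ^ 2) has_sum (pi ^ 2 / 6)) UNIV"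
    using inverse_squares_sums by (intro sums_nonneg_imp_has_sum) (auto simp: add_ac)
  from has_sum_of_real[OF this, where 'a = complex]
  have *: "((\<lambda>n. 1 / (of_nat n + 1) ^ 2) has_sum (of_real pi ^ 2 / 6 :: complex)) UNIV"
    by simp
  have "((\<lambda>n::int. 1 / of_int n ^ 2 :: complex) has_sum (of_real pi ^ 2 / 6 + of_real pi ^ 2 / 6)) {n. n \<noteq> 0}"
  proof (rule has_sum_int_nonzero)
    show "((\<lambda>n. 1 / of_int (int (Suc n)) ^ 2 :: complex) has_sum (of_real pi ^ 2 / 6)) UNIV"
      using * by (simp add: add_ac)
    have "(of_int (- int (Suc n)) :: complex) ^ 2 = (of_nat n + 1) ^ 2" for n
      by (simp only: of_int_minus power2_minus) (simp add: add_ac)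
    then show "((\<lambda>n. 1 / of_int (- int (Suc n)) ^ 2 :: complex) has_sum (of_real pi ^ 2 / 6)) UNIV"
      using * by simp
  qed
  then show ?thesis by simp
qed

text \<open>The row through the origin. The two halves give
  \<open>Digamma (1 - z) - Digamma (1 + z)\<close>, one step of the recurrence away from the
  reflection formula, which accounts for -1/z; the squares contribute pi^2/3.\<close>

lemma has_sum_zeta_row_0:
  fixes z :: complex
  assumes "z \<notin> \<int>"
  shows "((\<lambda>n::int. 1 / (z - of_int n) + 1 / of_int n + z / of_int n ^ 2) has_sum
     (of_real pi * cot (of_real pi * z) - 1 / z + z * (of_real pi ^ 2 / 3))) {n. n \<noteq> 0}"
proof -
  note z = not_Ints_D[OF assms]
  have z': "1 + z \<notin> \<int>"
    using Ints_diff[OF _ Ints_1, of "1 + z"] assms by auto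
  have nat: "u + of_nat n \<noteq> 0" if "u \<notin> \<int>" for u :: complex and n
    using not_Ints_D(1)[OF that, of "int n"] by simp
  have nat1: "1 + of_nat n \<noteq> (0 :: complex)" for n
    by (metis of_nat_Suc of_nat_eq_0_iff nat.distinct(1))
  have 1: "((\<lambda>n. - (1 / ((1 - z) + of_nat n) - 1 / (1 + of_nat n))) has_sum - (Digamma 1 - Digamma (1 - z))) UNIV"
    using has_sum_diff_inverse_shift_nat[OF nat[OF z(4)] nat1] by (simp only: has_sum_uminus minus_minus)
  have 2: "((\<lambda>n. 1 / ((1 + z) + of_nat n) - 1 / (1 + of_nat n)) has_sum (Digamma 1 - Digamma (1 + z))) UNIV"
    by (rule has_sum_diff_inverse_shift_nat[OF nat[OF z'] nat1])
  have "((\<lambda>n::int. 1 / (z - of_int n) + 1 / of_int n) has_sum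
      (- (Digamma 1 - Digamma (1 - z)) + (Digamma 1 - Digamma (1 + z)))) {n. n \<noteq> 0}"
  proof (rule has_sum_int_nonzero)
    have "1 / (z - of_int (int (Suc n))) + 1 / of_int (int (Suc n)) =
        - (1 / ((1 - z) + of_nat n) - 1 / (1 + of_nat n))" for n
    proof -
      have "z - of_int (int (Suc n)) = - ((1 - z) + of_nat n)" by simp
      then show ?thesis by (simp only: divide_minus_right) simp
    qed
    then show "((\<lambda>n. 1 / (z - of_int (int (Suc n))) + 1 / of_int (int (Suc n))) has_sum
        - (Digamma 1 - Digamma (1 - z))) UNIV"
      using 1 by simp
    have "1 / (z - of_int (- int (Suc n))) + 1 / of_int (- int (Suc n)) =
        1 / ((1 + z) + of_nat n) - 1 / (1 + of_nat n)" for n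
    proof -
      have "z - of_int (- int (Suc n)) = (1 + z) + of_nat n" "of_int (- int (Suc n)) = (- (1 + of_nat n) :: complex)"
        by simp_all
      then show ?thesis by (simp only: divide_minus_right) simp
    qed
    then show "((\<lambda>n. 1 / (z - of_int (- int (Suc n))) + 1 / of_int (- int (Suc n))) has_sum
        (Digamma 1 - Digamma (1 + z))) UNIV"
      using 2 by simp
  qed
  also have "- (Digamma 1 - Digamma (1 - z)) + (Digamma 1 - Digamma (1 + z)) =
      of_real pi * cot (of_real pi * z) - 1 / z"
    using Digamma_reflection[OF assms] Digamma_plus1[OF z(2)] by (simp add: algebra_simps)
  finally show ?thesis
    using has_sum_add[OF _ has_sum_cmult_right[OF has_sum_int_nonzero_squares, of z]] by simp
qed

text \<open>The terms 1/(z - \<omega>) and 1/\<omega> are kept together because only their sum is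
  absolutely summable along a row; it is a difference of shifted inverses at z - w and -w.\<close>

lemma has_sum_zeta_row:
  fixes z w :: complex
  assumes "w \<notin> \<int>" "z - w \<notin> \<int>"
  shows "((\<lambda>n::int. 1 / (z - (w + of_int n)) + 1 / (w + of_int n) + z / (w + of_int n) ^ 2) has_sum
     (of_real pi * (cot (of_real pi * (z - w)) + cot (of_real pi * w))
        + z * (of_real pi ^ 2 / sin (of_real pi * w) ^ 2))) UNIV"
proof -
  have w: "- w \<notin> \<int>" using assms(1) by (metis Ints_minus minus_minus)
  have "((\<lambda>n::int. 1 / ((z - w) + of_int (- n)) - 1 / (- w + of_int (- n))) has_sum
     of_real pi * (cot (of_real pi * (z - w)) - cot (of_real pi * (- w)))) UNIV"
    using has_sum_diff_inverse_shift_int[OF assms(2) w] by (subst has_sum_int_uminus)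
  moreover have "1 / ((z - w) + of_int (- n)) - 1 / (- w + of_int (- n)) =
      1 / (z - (w + of_int n)) + 1 / (w + of_int n)" for n :: int
  proof -
    have "- w + of_int (- n) = - (w + of_int n)" by simp
    then show ?thesis by (simp only: divide_minus_right) (simp add: algebra_simps)
  qed
  moreover have "cot (of_real pi * (- w)) = - cot (of_real pi * w)"
    by (simp add: cot_def)
  ultimately have "((\<lambda>n::int. 1 / (z - (w + of_int n)) + 1 / (w + of_int n)) has_sum
     of_real pi * (cot (of_real pi * (z - w)) + cot (of_real pi * w))) UNIV"
    by simp
  from has_sum_add[OF this has_sum_cmult_right[OF has_sum_shift_square_int[OF assms(1)], of z]]
  show ?thesis by simp
qed

text \<open>The inner sum over \<open>n\<close> in the defining series of \<open>wzeta\<close>, for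
  fixed \<open>m\<close>. Row 0 lacks the lattice point 0 and so has its own formula.\<close>

definition zeta_row :: "complex \<Rightarrow> complex \<Rightarrow> int \<Rightarrow> complex" where
  "zeta_row z \<tau> m = (if m = 0 then of_real pi * cot (of_real pi * z) - 1 / z + z * (of_real pi ^ 2 / 3)
     else of_real pi * (cot (of_real pi * (z - of_int m * \<tau>)) + cot (of_real pi * (of_int m * \<tau>)))
        + z * (of_real pi ^ 2 / sin (of_real pi * (of_int m * \<tau>)) ^ 2))"

text \<open>The general term equals z^2 / (\<omega>^2 (z - \<omega>)) and is thus of order h^(-3) in
  the height h; absolute convergence permits summation by rows. The hypothesis \<open>far\<close>
  provides the lower bound on z - \<omega> and keeps z off the nonzero lattice points.\<close>

lemma has_sum_zeta_rows:
  assumes "Im \<tau> > 0" "c > 0" "z \<notin> \<int>"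
    and far: "\<And>m n. (m, n) \<in> lat \<Longrightarrow> cmod (z - (of_int m * \<tau> + of_int n)) \<ge> c * (\<bar>real_of_int m\<bar> + \<bar>real_of_int n\<bar>)"
  shows "(zeta_row z \<tau> has_sum (wzeta z \<tau> - 1 / z)) UNIV"
proof -
  obtain \<kappa> where \<kappa>: "\<kappa> > 0"
    "\<And>m n::int. cmod (of_int m * \<tau> + of_int n) \<ge> \<kappa> * (\<bar>real_of_int m\<bar> + \<bar>real_of_int n\<bar>)"
    using lattice_norm_bound[OF assms(1)] by blast
  define f where "f = (\<lambda>(m::int, n::int). let \<omega> = of_int m * \<tau> + of_int n in 1 / (z - \<omega>) + 1 / \<omega> + z / \<omega>^2)"
  have "(\<lambda>p. norm (f p)) summable_on lat"
  proof (rule summable_on_comparison_test)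
    show "(\<lambda>p. (cmod z ^ 2 / (\<kappa> ^ 2 * c)) * (1 / (\<bar>real_of_int (fst p)\<bar> + \<bar>real_of_int (snd p)\<bar>) ^ 3)) summable_on lat"
      by (intro summable_on_cmult_right summable_on_lat_height) auto
    fix p :: "int \<times> int" assume p: "p \<in> lat"
    obtain m n where mn: "p = (m, n)" by (cases p)
    let ?h = "\<bar>real_of_int m\<bar> + \<bar>real_of_int n\<bar>" and ?w = "of_int m * \<tau> + of_int n"
    have h: "?h \<ge> 1" using lat_height_ge_1[OF p] mn by simp
    have w: "cmod ?w \<ge> \<kappa> * ?h" "cmod (z - ?w) \<ge> c * ?h"
      using \<kappa>(2) far p mn by auto
    have h0: "\<kappa> * ?h > 0" "c * ?h > 0" using h \<kappa>(1) \<open>c > 0\<close> by auto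
    then have nz: "?w \<noteq> 0" "z - ?w \<noteq> 0"
      using w by (smt (verit) norm_zero)+
    have "1 / (z - ?w) + 1 / ?w + z / ?w ^ 2 = z ^ 2 / (?w ^ 2 * (z - ?w))"
      using nz by (simp add: divide_simps power2_eq_square) (simp add: algebra_simps)
    then have "cmod (f p) = cmod z ^ 2 / (cmod ?w ^ 2 * cmod (z - ?w))"
      by (simp add: f_def mn Let_def norm_divide norm_mult norm_power)
    also have "\<dots> \<le> cmod z ^ 2 / ((\<kappa> * ?h) ^ 2 * (c * ?h))"
      using w h0 nz h \<kappa>(1) \<open>c > 0\<close> by (intro divide_left_mono mult_mono power_mono mult_pos_pos zero_less_power) auto
    also have "\<dots> = (cmod z ^ 2 / (\<kappa> ^ 2 * c)) * (1 / ?h ^ 3)"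
      by (simp add: power_mult_distrib power3_eq_cube power2_eq_square mult_ac)
    finally show "cmod (f p) \<le> (cmod z ^ 2 / (\<kappa> ^ 2 * c)) * (1 / (\<bar>real_of_int (fst p)\<bar> + \<bar>real_of_int (snd p)\<bar>) ^ 3)"
      by (simp add: mn)
  qed simp
  then have "f summable_on lat"
    by (rule Infinite_Sum.abs_summable_summable)
  then have "(f has_sum infsum f lat) lat"
    by simp
  moreover have "infsum f lat = wzeta z \<tau> - 1 / z"
    by (simp add: wzeta_def f_def)
  ultimately have f: "(f has_sum (wzeta z \<tau> - 1 / z)) (Sigma UNIV (\<lambda>m. {n. m = 0 \<longrightarrow> n \<noteq> 0}))"
    by (simp add: lat_eq_Sigma)
  show ?thesis
  proof (rule has_sum_Sigma[OF isUCont_plus f])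
    fix m :: int
    show "((\<lambda>n. f (m, n)) has_sum zeta_row z \<tau> m) {n. m = 0 \<longrightarrow> n \<noteq> 0}"
    proof (cases "m = 0")
      case True
      then show ?thesis
        using has_sum_zeta_row_0[OF \<open>z \<notin> \<int>\<close>] by (simp add: f_def zeta_row_def Let_def)
    next
      case False
      have 1: "of_int m * \<tau> \<notin> \<int>"
        using False assms(1) by (intro not_Ints_if_Im_nonzero) simp
      have 2: "z - of_int m * \<tau> \<notin> \<int>"
      proof
        assume "z - of_int m * \<tau> \<in> \<int>"
        then obtain n :: int where "z - of_int m * \<tau> = of_int n" by (auto simp: Ints_def)
        then have "cmod (z - (of_int m * \<tau> + of_int n)) = 0" by (simp add: algebra_simps)
        moreover have "c * (\<bar>real_of_int m\<bar> + \<bar>real_of_int n\<bar>) > 0"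
          using False \<open>c > 0\<close> by (simp add: add_pos_nonneg)
        ultimately show False
          using far[of m n] False by auto
      qed
      show ?thesis
        using has_sum_zeta_row[OF 1 2] False by (simp add: f_def zeta_row_def Let_def)
    qed
  qed
qed

section \<open>Passage to the variable q = exp(2 pi i \<tau>), the square of the classical nome, and
  the quasi-periods\<close>

definition nome :: "complex \<Rightarrow> complex" where
  "nome \<tau> = exp (2 * of_real pi * \<i> * \<tau>)"

lemma norm_nome: "cmod (nome \<tau>) = exp (- 2 * pi * Im \<tau>)"
  by (simp add: nome_def norm_exp_eq_Re)

lemma norm_nome_less_1: "Im \<tau> > 0 \<Longrightarrow> cmod (nome \<tau>) < 1"
  by (simp add: norm_nome)

lemma nome_of_nat_mult: "nome (of_nat n * \<tau>) = nome \<tau> ^ n"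
  by (simp add: nome_def flip: exp_of_nat_mult) (simp add: mult_ac)

lemma nome_add_1: "nome (\<tau> + 1) = nome \<tau>"
  using exp_two_pi_i by (simp add: nome_def distrib_left exp_add mult_ac)

text \<open>Holds also at the poles, where both sides are \<open>0\<close> because of division by zero.\<close>
lemma inverse_sin_squared_nome:
  "1 / sin (of_real pi * w) ^ 2 = - 4 * (nome w / (1 - nome w) ^ 2)"
proof -
  define E where "E = exp (\<i> * (of_real pi * w))"
  have E: "E \<noteq> 0" and E2: "nome w = E ^ 2"
    by (simp_all add: E_def nome_def mult_ac flip: exp_of_nat_mult)
  have "sin (of_real pi * w) = (E - 1 / E) / (2 * \<i>)"
    by (simp add: sin_exp_eq E_def exp_minus inverse_eq_divide)
  then have "sin (of_real pi * w) ^ 2 = - ((1 - E ^ 2) ^ 2 / (4 * E ^ 2))"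
    using E by (simp add: power_divide power_mult_distrib) (simp add: field_simps power2_eq_square)
  then show ?thesis
    using E by (simp add: E2)
qed

lemma cot_nome:
  "cot (of_real pi * w) = \<i> * (nome w + 1) / (nome w - 1)"
proof -
  define E where "E = exp (\<i> * (of_real pi * w))"
  have E: "E \<noteq> 0" and E2: "nome w = E ^ 2"
    by (simp_all add: E_def nome_def mult_ac flip: exp_of_nat_mult)
  have "sin (of_real pi * w) = (E ^ 2 - 1) / (2 * \<i> * E)" "cos (of_real pi * w) = (E ^ 2 + 1) / (2 * E)"
    using E by (simp_all add: sin_exp_eq cos_exp_eq E_def[symmetric] exp_minus inverse_eq_divide)
       (simp_all add: field_simps power2_eq_square)
  then have "cot (of_real pi * w) = ((E ^ 2 + 1) / (2 * E)) / ((E ^ 2 - 1) / (2 * \<i> * E))"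
    by (simp add: cot_def)
  also have "\<dots> = \<i> * (nome w + 1) / (nome w - 1)"
  proof -
    have "(X / (2 * E)) / (Y / (2 * \<i> * E)) = \<i> * X / Y" for X Y
      using E by (cases "Y = 0") (simp_all add: field_simps)
    then show ?thesis by (simp only: E2)
  qed
  finally show ?thesis .
qed

text \<open>At z = 1/2 the cotangents of the rows m and -m cancel, because cot(pi/2 - x) + cot(pi/2
  + x) = 0; only the 1/sin^2 parts remain.\<close>

lemma eta1_sums:
  assumes "Im \<tau> > 0"
  shows "(\<lambda>j. 2 * of_real pi ^ 2 / sin (of_real pi * (of_nat (Suc j) * \<tau>)) ^ 2) sums (eta1 \<tau> - of_real pi ^ 2 / 3)"
proof -
  obtain \<kappa> where \<kappa>: "\<kappa> > 0"
    "\<And>m n::int. cmod (of_int m * \<tau> + of_int n) \<ge> \<kappa> * (\<bar>real_of_int m\<bar> + \<bar>real_of_int n\<bar>)"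
    using lattice_norm_bound[OF assms(1)] by blast
  have half: "(1/2 :: complex) \<notin> \<int>"
    using fraction_not_in_Ints[of 2 1, where 'a = complex] by simp
  \<comment> \<open>1/2 - \<omega> is half of the lattice point with coordinates -2m and 1 - 2n,
    whose height is at least |m| + |n|.\<close>
  have far: "cmod (1/2 - (of_int m * \<tau> + of_int n)) \<ge> \<kappa> / 2 * (\<bar>real_of_int m\<bar> + \<bar>real_of_int n\<bar>)" for m n :: int
  proof -
    have "\<kappa> * (\<bar>real_of_int m\<bar> + \<bar>real_of_int n\<bar>) \<le> \<kappa> * (\<bar>real_of_int (- 2 * m)\<bar> + \<bar>real_of_int (1 - 2 * n)\<bar>)"
    proof (intro mult_left_mono)
      have "real_of_int (\<bar>m\<bar> + \<bar>n\<bar>) \<le> real_of_int (\<bar>- 2 * m\<bar> + \<bar>1 - 2 * n\<bar>)"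
        by (subst of_int_le_iff) arith
      then show "\<bar>real_of_int m\<bar> + \<bar>real_of_int n\<bar> \<le> \<bar>real_of_int (- 2 * m)\<bar> + \<bar>real_of_int (1 - 2 * n)\<bar>"
        by (simp only: of_int_add of_int_abs)
    qed (use \<kappa>(1) in simp)
    also have "\<dots> \<le> cmod (of_int (- 2 * m) * \<tau> + of_int (1 - 2 * n))" by (rule \<kappa>(2))
    also have "of_int (- 2 * m) * \<tau> + of_int (1 - 2 * n) = 2 * (1/2 - (of_int m * \<tau> + of_int n))"
      by (simp add: algebra_simps)
    finally show ?thesis by (simp only: norm_mult) simp
  qed
  have "(zeta_row (1/2) \<tau> has_sum (wzeta (1/2) \<tau> - 1 / (1/2))) UNIV"
    by (rule has_sum_zeta_rows[OF assms _ half far]) (use \<kappa>(1) in auto)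
  from has_sum_int_imp_sums[OF this]
  have s: "(\<lambda>j. zeta_row (1/2) \<tau> (int (Suc j)) + zeta_row (1/2) \<tau> (- int (Suc j))) sums (wzeta (1/2) \<tau> - of_real pi ^ 2 / 6)"
    by (simp add: zeta_row_def cot_def)
  have "zeta_row (1/2) \<tau> (int (Suc j)) + zeta_row (1/2) \<tau> (- int (Suc j)) =
      of_real pi ^ 2 / sin (of_real pi * (of_nat (Suc j) * \<tau>)) ^ 2" for j
  proof -
    define w where "w = of_real pi * (of_nat (Suc j) * \<tau>)"
    have "cot (of_real pi * (1 / 2 - of_nat (Suc j) * \<tau>)) + cot (of_real pi * (1 / 2 + of_nat (Suc j) * \<tau>)) = 0"
      by (simp only: distrib_left right_diff_distrib w_def[symmetric])
         (simp add: cot_def sin_add cos_add sin_diff cos_diff)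
    moreover have "cot (- w) = - cot w" "sin (- w) ^ 2 = sin w ^ 2"
      by (simp_all add: cot_def)
    moreover have "of_real pi * (of_int (- int (Suc j)) * \<tau>) = - w" "of_int (- int (Suc j)) * \<tau> = - (of_nat (Suc j) * \<tau>)"
       "of_real pi * (of_int (int (Suc j)) * \<tau>) = w" "of_int (int (Suc j)) = (of_nat (Suc j) :: complex)"
      by (simp_all add: w_def algebra_simps)
    ultimately show ?thesis
      unfolding zeta_row_def w_def[symmetric]
      by (simp del: of_nat_Suc of_int_minus of_int_of_nat_eq add: algebra_simps)
         (simp flip: distrib_left)
  qed
  then show ?thesis
    using sums_mult[OF s, of 2] by (simp add: eta1_def algebra_simps)
qed

text \<open>At z = \<tau>/2 the 1/sin^2 parts are \<tau>/2 times the series of \<open>eta1\<close>,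
  while the cotangents of the rows m and -m sit at consecutive half-odd multiples of \<tau>.\<close>

lemma legendre_relation:
  assumes "Im \<tau> > 0"
  shows "eta2 \<tau> = \<tau> * eta1 \<tau> - 2 * of_real pi * \<i>"
proof -
  obtain \<kappa> where \<kappa>: "\<kappa> > 0"
    "\<And>m n::int. cmod (of_int m * \<tau> + of_int n) \<ge> \<kappa> * (\<bar>real_of_int m\<bar> + \<bar>real_of_int n\<bar>)"
    using lattice_norm_bound[OF assms(1)] by blast
  have half: "\<tau> / 2 \<notin> \<int>"
    using assms by (intro not_Ints_if_Im_nonzero) simp
  have far: "cmod (\<tau>/2 - (of_int m * \<tau> + of_int n)) \<ge> \<kappa> / 2 * (\<bar>real_of_int m\<bar> + \<bar>real_of_int n\<bar>)" for m n :: int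
  proof -
    have "\<kappa> * (\<bar>real_of_int m\<bar> + \<bar>real_of_int n\<bar>) \<le> \<kappa> * (\<bar>real_of_int (1 - 2 * m)\<bar> + \<bar>real_of_int (- 2 * n)\<bar>)"
    proof (intro mult_left_mono)
      have "real_of_int (\<bar>m\<bar> + \<bar>n\<bar>) \<le> real_of_int (\<bar>1 - 2 * m\<bar> + \<bar>- 2 * n\<bar>)"
        by (subst of_int_le_iff) arith
      then show "\<bar>real_of_int m\<bar> + \<bar>real_of_int n\<bar> \<le> \<bar>real_of_int (1 - 2 * m)\<bar> + \<bar>real_of_int (- 2 * n)\<bar>"
        by (simp only: of_int_add of_int_abs)
    qed (use \<kappa>(1) in simp)
    also have "\<dots> \<le> cmod (of_int (1 - 2 * m) * \<tau> + of_int (- 2 * n))" by (rule \<kappa>(2))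
    also have "of_int (1 - 2 * m) * \<tau> + of_int (- 2 * n) = 2 * (\<tau>/2 - (of_int m * \<tau> + of_int n))"
      by (simp add: algebra_simps)
    finally show ?thesis by (simp only: norm_mult) simp
  qed
  let ?c = "\<lambda>j::nat. cot (of_real pi * ((of_nat j + 1/2) * \<tau>))"
  have "(zeta_row (\<tau>/2) \<tau> has_sum (wzeta (\<tau>/2) \<tau> - 1 / (\<tau>/2))) UNIV"
    by (rule has_sum_zeta_rows[OF assms _ half far]) (use \<kappa>(1) in auto)
  from has_sum_int_imp_sums[OF this]
  have s: "(\<lambda>j. zeta_row (\<tau>/2) \<tau> (int (Suc j)) + zeta_row (\<tau>/2) \<tau> (- int (Suc j))) sums
      (wzeta (\<tau>/2) \<tau> - of_real pi * ?c 0 - \<tau> * of_real pi ^ 2 / 6)"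
    by (simp add: zeta_row_def algebra_simps)
  have row: "zeta_row (\<tau>/2) \<tau> (int (Suc j)) + zeta_row (\<tau>/2) \<tau> (- int (Suc j)) =
      \<tau> * (of_real pi ^ 2 / sin (of_real pi * (of_nat (Suc j) * \<tau>)) ^ 2) + of_real pi * (?c (Suc j) - ?c j)" for j
  proof -
    define w where "w = of_real pi * (of_nat (Suc j) * \<tau>)"
    have cm: "cot (- w) = - cot w" "sin (- w) ^ 2 = sin w ^ 2" for w :: complex
      by (simp_all add: cot_def)
    have e1: "of_real pi * (\<tau> / 2 - of_int (int (Suc j)) * \<tau>) = - (of_real pi * ((of_nat j + 1/2) * \<tau>))"
      and e2: "of_real pi * (\<tau> / 2 - of_int (- int (Suc j)) * \<tau>) = of_real pi * ((of_nat (Suc j) + 1/2) * \<tau>)"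
      by (simp_all add: algebra_simps)
    have e3: "of_real pi * (of_int (- int (Suc j)) * \<tau>) = - w" "of_real pi * (of_int (int (Suc j)) * \<tau>) = w"
      by (simp_all add: w_def algebra_simps)
    have nz: "int (Suc j) \<noteq> 0" "- int (Suc j) \<noteq> 0" by simp_all
    have gen: "p * (- a + c) + \<tau> / 2 * X + (p * (b + - c) + \<tau> / 2 * X) = \<tau> * X + p * (b - a)" for p a b c X :: complex
      by (simp add: field_simps)
    show ?thesis
      unfolding zeta_row_def e1 e2 e3 cm w_def[symmetric] if_not_P[OF nz(1)] if_not_P[OF nz(2)]
      by (rule gen)
  qed
  \<comment> \<open>Here q tends to 0 and the cotangent to i * 1 / (-1). This limit is the origin of
    the term 2 pi i.\<close>
  have lim: "?c \<longlonglongrightarrow> - \<i>"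
  proof -
    have "(\<lambda>j. nome \<tau> ^ j * nome (\<tau>/2)) \<longlonglongrightarrow> 0 * nome (\<tau>/2)"
      using norm_nome_less_1[OF assms] by (intro tendsto_intros LIMSEQ_power_zero) auto
    then have n0: "(\<lambda>j. nome ((of_nat j + 1/2) * \<tau>)) \<longlonglongrightarrow> 0"
      by (simp add: nome_of_nat_mult[symmetric]) (simp add: nome_def distrib_left distrib_right flip: exp_add)
    have "(\<lambda>j. \<i> * (nome ((of_nat j + 1/2) * \<tau>) + 1) / (nome ((of_nat j + 1/2) * \<tau>) - 1)) \<longlonglongrightarrow> \<i> * (0 + 1) / (0 - 1)"
      by (intro tendsto_intros n0) auto
    then show ?thesis by (simp add: cot_nome)
  qed
  from telescope_sums[OF lim] have "(\<lambda>j. ?c (Suc j) - ?c j) sums (- \<i> - ?c 0)" .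
  from sums_add[OF sums_mult[OF eta1_sums[OF assms], of "\<tau> / 2"] sums_mult[OF this, of "of_real pi"]]
  have "(\<lambda>j. zeta_row (\<tau>/2) \<tau> (int (Suc j)) + zeta_row (\<tau>/2) \<tau> (- int (Suc j))) sums
     (\<tau> / 2 * (eta1 \<tau> - of_real pi ^ 2 / 3) + of_real pi * (- \<i> - ?c 0))"
    unfolding row by (simp add: mult.assoc)
  with s have "wzeta (\<tau>/2) \<tau> - of_real pi * ?c 0 - \<tau> * of_real pi ^ 2 / 6 =
      \<tau> / 2 * (eta1 \<tau> - of_real pi ^ 2 / 3) + of_real pi * (- \<i> - ?c 0)"
    by (rule sums_unique2)
  then have "wzeta (\<tau>/2) \<tau> = \<tau> / 2 * (eta1 \<tau> - of_real pi ^ 2 / 3) + of_real pi * (- \<i> - ?c 0)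
      + \<tau> * of_real pi ^ 2 / 6 + of_real pi * ?c 0"
    by (simp only: diff_eq_eq)
  then have "wzeta (\<tau>/2) \<tau> = \<tau> / 2 * eta1 \<tau> - of_real pi * \<i>"
    by (simp add: algebra_simps)
  then show ?thesis by (simp add: eta2_def algebra_simps)
qed

text \<open>The odd integers come from \<open>has_sum_shift_fourth_int\<close> at w = 1/2 and
  contribute pi^4/48; the even ones contribute 1/16 of the whole sum S. So S = pi^4/48 +
  S/16.\<close>

lemma has_sum_int_nonzero_fourth:
  "((\<lambda>n::int. 1 / of_int n ^ 4 :: complex) has_sum (of_real pi ^ 4 / 45)) {n. n \<noteq> 0}"
proof -
  let ?f = "\<lambda>n::int. 1 / of_int n ^ 4 :: complex"
  have half: "(1/2 :: complex) \<notin> \<int>"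
    using fraction_not_in_Ints[of 2 1, where 'a = complex] by simp
  have "((\<lambda>n::int. (1/16) * (1 / (1/2 + of_int n) ^ 4)) has_sum (1/16 * (of_real pi ^ 4 / 3) :: complex)) UNIV"
    using has_sum_cmult_right[OF has_sum_shift_fourth_int[OF half], of "1/16"] by simp
  moreover have "(1/16) * (1 / (1/2 + of_int n :: complex) ^ 4) = ?f (2 * n + 1)" for n
  proof -
    have "(of_int (2 * n + 1) :: complex) = 2 * (1/2 + of_int n)" by simp
    then show ?thesis by (simp only: power_mult_distrib) simp
  qed
  ultimately have "((\<lambda>n::int. ?f (2 * n + 1)) has_sum (of_real pi ^ 4 / 48)) UNIV"
    by simp
  then have odd: "(?f has_sum (of_real pi ^ 4 / 48)) {n. odd n}"
    by (subst (asm) has_sum_reindex_bij_witness[of UNIV "\<lambda>n. (n - 1) div 2" "\<lambda>n. 2 * n + 1" "{n. odd n}" ?f]) auto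
  have "(\<lambda>n. 1 / (of_nat (Suc n)) ^ 4 :: complex) summable_on UNIV"
    using summable_norm_shift_power[of 4 1]
    by (intro norm_summable_imp_summable_on) (simp add: add_ac)
  then obtain a where a: "((\<lambda>n. 1 / (of_nat (Suc n)) ^ 4 :: complex) has_sum a) UNIV"
    by (auto simp: summable_on_def)
  have S: "(?f has_sum (a + a)) {n. n \<noteq> 0}"
  proof (rule has_sum_int_nonzero)
    have "(of_int (- int (Suc n)) :: complex) ^ 4 = (of_nat (Suc n)) ^ 4" for n
      by (simp only: of_int_minus power_minus_even even_numeral) simp
    then show "((\<lambda>n. ?f (- int (Suc n))) has_sum a) UNIV"
      using a by simp
  qed (use a in simp)
  have "((\<lambda>n::int. (1/16) * ?f n) has_sum ((1/16) * (a + a))) {n. n \<noteq> 0}"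
    by (rule has_sum_cmult_right[OF S])
  then have "((\<lambda>n::int. ?f (2 * n)) has_sum ((1/16) * (a + a))) {n. n \<noteq> 0}"
    by (simp add: power_mult_distrib)
  then have even: "(?f has_sum ((1/16) * (a + a))) {n. even n \<and> n \<noteq> 0}"
    by (subst (asm) has_sum_reindex_bij_witness[of _ "\<lambda>n. n div 2" "\<lambda>n. 2 * n" "{n. even n \<and> n \<noteq> 0}" ?f]) auto
  have "(?f has_sum (of_real pi ^ 4 / 48 + (1/16) * (a + a))) ({n. odd n} \<union> {n. even n \<and> n \<noteq> 0})"
    by (rule has_sum_Un_disjoint[OF odd even]) auto
  moreover have "{n. odd n} \<union> {n. even n \<and> n \<noteq> 0} = {n::int. n \<noteq> 0}" by auto
  ultimately have "a + a = of_real pi ^ 4 / 48 + (1/16) * (a + a)"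
    using has_sum_unique[OF S] by simp
  then have "a + a = of_real pi ^ 4 / 45" by (simp add: field_simps)
  then show ?thesis using S by (simp only:)
qed

lemma g2_sums:
  assumes "Im \<tau> > 0"
  shows "(\<lambda>j. 120 * of_real pi ^ 4 * (1 / sin (of_real pi * (of_nat (Suc j) * \<tau>)) ^ 4
            - 2 / 3 / sin (of_real pi * (of_nat (Suc j) * \<tau>)) ^ 2))
          sums (g2 \<tau> - 4 / 3 * of_real pi ^ 4)"
proof -
  obtain \<kappa> where \<kappa>: "\<kappa> > 0"
    "\<And>m n::int. cmod (of_int m * \<tau> + of_int n) \<ge> \<kappa> * (\<bar>real_of_int m\<bar> + \<bar>real_of_int n\<bar>)"
    using lattice_norm_bound[OF assms(1)] by blast
  define f where "f = (\<lambda>(m::int, n::int). 1 / (of_int m * \<tau> + of_int n) ^ 4)"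
  define R where "R = (\<lambda>m::int. if m = 0 then of_real pi ^ 4 / 45 else of_real pi ^ 4 *
     (1 / sin (of_real pi * (of_int m * \<tau>)) ^ 4 - 2 / 3 / sin (of_real pi * (of_int m * \<tau>)) ^ 2))"
  have "(\<lambda>p. norm (f p)) summable_on lat"
  proof (rule summable_on_comparison_test)
    show "(\<lambda>p. (1 / \<kappa> ^ 4) * (1 / (\<bar>real_of_int (fst p)\<bar> + \<bar>real_of_int (snd p)\<bar>) ^ 4)) summable_on lat"
      by (intro summable_on_cmult_right summable_on_lat_height) auto
    fix p :: "int \<times> int" assume p: "p \<in> lat"
    obtain m n where mn: "p = (m, n)" by (cases p)
    let ?h = "\<bar>real_of_int m\<bar> + \<bar>real_of_int n\<bar>" and ?w = "of_int m * \<tau> + of_int n"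
    have h: "?h \<ge> 1" using lat_height_ge_1[OF p] mn by simp
    have "1 / cmod ?w ^ 4 \<le> 1 / (\<kappa> * ?h) ^ 4"
    proof (intro divide_left_mono power_mono mult_pos_pos zero_less_power)
      have "\<kappa> * ?h > 0" using h \<kappa>(1) by simp
      then show "0 < cmod ?w" using \<kappa>(2)[of m n] by linarith
    qed (use h \<kappa> in auto)
    then show "cmod (f p) \<le> (1 / \<kappa> ^ 4) * (1 / (\<bar>real_of_int (fst p)\<bar> + \<bar>real_of_int (snd p)\<bar>) ^ 4)"
      by (simp add: mn f_def norm_divide norm_power power_mult_distrib)
  qed simp
  then have "f summable_on lat"
    by (rule Infinite_Sum.abs_summable_summable)
  then have "(f has_sum infsum f lat) lat"
    by simp
  moreover have "infsum f lat = g2 \<tau> / 60"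
    by (simp add: g2_def f_def)
  ultimately have f: "(f has_sum (g2 \<tau> / 60)) (Sigma UNIV (\<lambda>m. {n. m = 0 \<longrightarrow> n \<noteq> 0}))"
    by (simp only: lat_eq_Sigma)
  have "(R has_sum (g2 \<tau> / 60)) UNIV"
  proof (rule has_sum_Sigma[OF isUCont_plus f])
    fix m :: int
    show "((\<lambda>n. f (m, n)) has_sum R m) {n. m = 0 \<longrightarrow> n \<noteq> 0}"
    proof (cases "m = 0")
      case True
      then show ?thesis
        using has_sum_int_nonzero_fourth by (simp add: f_def R_def)
    next
      case False
      have 1: "of_int m * \<tau> \<notin> \<int>"
        using False assms(1) by (intro not_Ints_if_Im_nonzero) simp
      show ?thesis
        using has_sum_shift_fourth_int[OF 1] False by (simp add: f_def R_def)
    qed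
  qed
  \<comment> \<open>Row 0 is split off: 60 * pi^4/45 = 4/3 pi^4.\<close>
  from sums_mult[OF has_sum_int_imp_sums[OF this], of 60]
  have s: "(\<lambda>j. 60 * (R (int (Suc j)) + R (- int (Suc j)))) sums (g2 \<tau> - 4 / 3 * of_real pi ^ 4)"
    by (simp add: R_def right_diff_distrib)
  have "60 * (R (int (Suc j)) + R (- int (Suc j))) = 120 * of_real pi ^ 4 * (1 / sin (of_real pi * (of_nat (Suc j) * \<tau>)) ^ 4
            - 2 / 3 / sin (of_real pi * (of_nat (Suc j) * \<tau>)) ^ 2)" for j
  proof -
    define w where "w = of_real pi * (of_nat (Suc j) * \<tau>)"
    have e3: "of_real pi * (of_int (- int (Suc j)) * \<tau>) = - w" "of_real pi * (of_int (int (Suc j)) * \<tau>) = w"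
      by (simp_all add: w_def algebra_simps)
    have nz: "int (Suc j) \<noteq> 0" "- int (Suc j) \<noteq> 0" by simp_all
    have "sin (- w) ^ 4 = sin w ^ 4" "sin (- w) ^ 2 = sin w ^ 2" by simp_all
    then show ?thesis
      unfolding R_def e3 w_def[symmetric] if_not_P[OF nz(1)] if_not_P[OF nz(2)] by simp
  qed
  then show ?thesis using s by simp
qed

subsection \<open>Lambert series and Eisenstein series\<close>

text \<open>In the induction on \<open>k\<close> one factor n is traded for a larger ratio s,
  halfway between t and 1, since n (t/s)^n stays bounded.\<close>

lemma summable_power_times_geometric:
  fixes t :: real
  assumes "0 \<le> t" "t < 1"
  shows "summable (\<lambda>n. real n ^ k * t ^ n)"
  using assms
proof (induction k arbitrary: t)
  case 0
  then show ?case by (simp add: summable_geometric)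
next
  case (Suc k)
  define s where "s = (1 + t) / 2"
  have s: "0 < s" "s < 1" "t < s" using Suc.prems by (auto simp: s_def)
  have "(\<lambda>n. of_nat n * (t / s) ^ n) \<longlonglongrightarrow> 0"
    using s Suc.prems by (intro powser_times_n_limit_0) simp
  then have "Bseq (\<lambda>n. of_nat n * (t / s) ^ n)"
    using convergent_imp_Bseq convergentI by blast
  then obtain K where K: "K > 0" "\<And>n. norm (of_nat n * (t / s) ^ n) \<le> K"
    by (auto simp: Bseq_def)
  show ?case
  proof (rule summable_comparison_test')
    show "summable (\<lambda>n. K * (real n ^ k * s ^ n))"
      using s by (intro summable_mult Suc.IH) auto
    fix n :: nat
    have "norm (real n ^ Suc k * t ^ n) = (real n ^ k * s ^ n) * norm (of_nat n * (t / s) ^ n)"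
      using s Suc.prems by (simp add: abs_mult power_divide)
    also have "\<dots> \<le> (real n ^ k * s ^ n) * K"
      using s by (intro mult_left_mono K) auto
    finally show "norm (real n ^ Suc k * t ^ n) \<le> K * (real n ^ k * s ^ n)"
      by (simp add: mult_ac)
  qed
qed

definition divisor_sum :: "(nat \<Rightarrow> real) \<Rightarrow> nat \<Rightarrow> real" where
  "divisor_sum c n = (\<Sum>d | d dvd n. c d)"

text \<open>The Lambert series with terms c(r) z^(m r), m and r at least 1, collected by powers of
  z. For c(r) = r the coefficients are the divisor sums sigma_1.\<close>

definition lambert :: "(nat \<Rightarrow> real) \<Rightarrow> complex \<Rightarrow> complex" where
  "lambert c z = (\<Sum>n. of_real (divisor_sum c n) * z ^ n)"

text \<open>The operator z d/dz applied to \<open>lambert\<close>, as confirmed by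
  \<open>dlambert_eq\<close>.\<close>

definition dlambert :: "(nat \<Rightarrow> real) \<Rightarrow> complex \<Rightarrow> complex" where
  "dlambert c z = (\<Sum>n. of_nat n * of_real (divisor_sum c n) * z ^ n)"

text \<open>The set of divisors of \<open>0\<close> is infinite, so the constant term vanishes.\<close>
lemma divisor_sum_0 [simp]: "divisor_sum c 0 = 0"
  by (simp add: divisor_sum_def)

lemma divisor_sum_bounds:
  assumes "\<And>r. 0 \<le> c r" "\<And>r. c r \<le> real r ^ k"
  shows "0 \<le> divisor_sum c n" "divisor_sum c n \<le> real n ^ Suc k"
proof -
  show "0 \<le> divisor_sum c n"
    unfolding divisor_sum_def using assms(1) by (intro sum_nonneg) auto
  show "divisor_sum c n \<le> real n ^ Suc k"
  proof (cases "n = 0")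
    case False
    have "divisor_sum c n \<le> (\<Sum>d | d dvd n. real n ^ k)"
      unfolding divisor_sum_def
      by (intro sum_mono order_trans[OF assms(2)] power_mono) (use False in \<open>auto dest: dvd_imp_le\<close>)
    also have "\<dots> = real (card {d. d dvd n}) * real n ^ k" by simp
    also have "card {d. d dvd n} \<le> card {1..n}"
      using False by (intro card_mono) (auto dest: dvd_imp_le intro: Suc_leI dvd_pos_nat)
    then have "real (card {d. d dvd n}) * real n ^ k \<le> real n * real n ^ k"
      by (intro mult_right_mono) auto
    finally show ?thesis by simp
  qed simp
qed

text \<open>The cubic bound covers both instances: \<open>real\<close>, which occurs in
  \<open>E2\<close>, and \<open>c4\<close>, which the fourth powers in \<open>g2\<close> bring
  in.\<close>

locale lambert_series =
  fixes c :: "nat \<Rightarrow> real"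
  assumes nonneg: "\<And>r. 0 \<le> c r" and le: "\<And>r. c r \<le> real r ^ 3"
begin

lemmas coeff_bounds = divisor_sum_bounds[of c 3, OF nonneg le]

lemma summable_norm:
  assumes "cmod z < 1"
  shows "summable (\<lambda>n. cmod (of_nat n ^ k * of_real (divisor_sum c n) * z ^ n))"
proof (rule summable_comparison_test')
  show "summable (\<lambda>n. real n ^ (k + 4) * cmod z ^ n)"
    using assms by (intro summable_power_times_geometric) auto
  show "norm (cmod (of_nat n ^ k * of_real (divisor_sum c n) * z ^ n)) \<le> real n ^ (k + 4) * cmod z ^ n" for n
    using coeff_bounds[of n] by (auto simp: norm_mult norm_power power_add intro!: mult_mono)
qed

lemma summable:
  assumes "cmod z < 1"
  shows "summable (\<lambda>n. of_nat n ^ k * of_real (divisor_sum c n) * z ^ n)"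
  using summable_norm[OF assms] by (rule summable_norm_cancel)

lemma lambert_sums: "cmod z < 1 \<Longrightarrow> (\<lambda>n. of_real (divisor_sum c n) * z ^ n) sums lambert c z"
  using summable[of z 0] by (simp add: lambert_def summable_sums)

lemma dlambert_sums: "cmod z < 1 \<Longrightarrow> (\<lambda>n. of_nat n * of_real (divisor_sum c n) * z ^ n) sums dlambert c z"
  using summable[of z 1] by (simp add: dlambert_def summable_sums)

lemma lambert_deriv:
  assumes "cmod z < 1"
  obtains d where "(lambert c has_field_derivative d) (at z)" "z * d = dlambert c z"
proof
  define K where "K = (1 + cmod z) / 2"
  have K: "cmod z < K" "K < 1" "0 \<le> K" using assms norm_ge_zero[of z] by (auto simp: K_def simp del: norm_ge_zero)
  let ?a = "\<lambda>n. of_real (divisor_sum c n) :: complex"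
  have s: "summable (\<lambda>n. ?a n * of_real K ^ n)"
    using summable[of "of_real K" 0] K by simp
  have "((\<lambda>x. \<Sum>n. ?a n * x ^ n) has_field_derivative (\<Sum>n. diffs ?a n * z ^ n)) (at z)"
    by (rule termdiffs_strong[OF s]) (use K in simp)
  then show "(lambert c has_field_derivative (\<Sum>n. diffs ?a n * z ^ n)) (at z)"
    by (simp add: lambert_def[abs_def])
  have "(\<lambda>n. of_nat n * ?a n * z ^ n) sums dlambert c z"
    using dlambert_sums[OF assms] .
  then have d: "(\<lambda>n. of_nat (Suc n) * ?a (Suc n) * z ^ Suc n) sums dlambert c z"
    by (subst sums_Suc_iff) simp
  have "summable (\<lambda>n. diffs ?a n * z ^ n)"
    by (rule termdiff_converges[of _ K]) (use K summable[of _ 0] in auto)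
  from sums_mult[OF summable_sums[OF this], of z]
  have "(\<lambda>n. of_nat (Suc n) * ?a (Suc n) * z ^ Suc n) sums (z * (\<Sum>n. diffs ?a n * z ^ n))"
    by (simp add: diffs_def mult_ac)
  with d show "z * (\<Sum>n. diffs ?a n * z ^ n) = dlambert c z"
    using sums_unique2 by blast
qed

lemma holomorphic_lambert: "lambert c holomorphic_on ball 0 1"
proof (rule holomorphic_onI)
  fix z :: complex assume "z \<in> ball 0 1"
  then have "cmod z < 1" by simp
  then show "lambert c field_differentiable at z within ball 0 1"
    using lambert_deriv field_differentiable_at_within field_differentiable_def by metis
qed

lemma dlambert_eq: "cmod z < 1 \<Longrightarrow> dlambert c z = z * deriv (lambert c) z"
  using lambert_deriv[of z] by (metis DERIV_imp_deriv)

lemma holomorphic_dlambert: "dlambert c holomorphic_on ball 0 1"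
proof -
  have "(\<lambda>z. z * deriv (lambert c) z) holomorphic_on ball 0 1"
    using holomorphic_lambert by (intro holomorphic_intros holomorphic_deriv) auto
  then show ?thesis
    by (rule holomorphic_transform) (simp add: dlambert_eq)
qed

text \<open>The terms c(r) z^n over the pairs with r dividing n form an absolutely summable family.
  Summation over r at fixed n gives the power series; after the substitution n = m r, summation over
  r at fixed m gives \<open>C m\<close>.\<close>

lemma has_sum_lambert:
  assumes "cmod z < 1" and C: "\<And>m. m \<ge> 1 \<Longrightarrow> ((\<lambda>r. of_real (c r) * (z ^ m) ^ r) has_sum C m) {1..}"
  shows "(C has_sum lambert c z) {1..}"
proof -
  define f where "f = (\<lambda>(n, r). of_real (c r) * z ^ n :: complex)"
  let ?S = "Sigma {1..} (\<lambda>n::nat. {r. r dvd n})"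
  have fin: "finite {r. r dvd n}" if "n \<ge> 1" for n :: nat
    using that by simp
  have inner: "(\<Sum>\<^sub>\<infinity>r\<in>{r. r dvd n}. norm (f (n, r))) = divisor_sum c n * cmod z ^ n" if "n \<ge> 1" for n
    using fin[OF that] nonneg
    by (simp add: f_def norm_mult norm_power divisor_sum_def sum_distrib_right)
  have "(\<lambda>p. norm (f p)) summable_on ?S"
    unfolding Infinite_Sum.abs_summable_on_Sigma_iff
  proof (intro conjI ballI)
    show "(\<lambda>r. norm (f (n, r))) summable_on {r. r dvd n}" if "n \<in> {1..}" for n
      using fin that by (intro summable_on_finite) auto
    have "summable (\<lambda>n. cmod (of_real (divisor_sum c n) * z ^ n))"
      using summable_norm[OF assms(1), of 0] by simp
    then have "(\<lambda>n. divisor_sum c n * cmod z ^ n) summable_on UNIV"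
      using coeff_bounds by (intro summable_nonneg_imp_summable_on) (simp_all add: norm_mult norm_power)
    then have "(\<lambda>n. divisor_sum c n * cmod z ^ n) summable_on {1..}"
      by (rule summable_on_subset) auto
    then show "(\<lambda>n. norm (\<Sum>\<^sub>\<infinity>r\<in>{r. r dvd n}. norm (f (n, r)))) summable_on {1..}"
      by (rule summable_on_cong[THEN iffD1, rotated]) (use inner coeff_bounds in auto)
  qed
  then have "f summable_on ?S"
    by (rule Infinite_Sum.abs_summable_summable)
  then obtain T where T: "(f has_sum T) ?S"
    by (auto simp: summable_on_def)
  have "((\<lambda>n. of_real (divisor_sum c n) * z ^ n) has_sum T) {1..}"
  proof (rule has_sum_Sigma[OF isUCont_plus T])
    show "((\<lambda>r. f (n, r)) has_sum (of_real (divisor_sum c n) * z ^ n)) {r. r dvd n}" if "n \<in> {1..}" for n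
      using fin that by (intro has_sum_finiteI) (auto simp: f_def divisor_sum_def sum_distrib_right)
  qed
  then have "((\<lambda>n. of_real (divisor_sum c n) * z ^ n) has_sum T) UNIV"
    by (rule has_sum_cong_neutral[THEN iffD1, rotated -1]) (auto simp: not_le)
  then have "(\<lambda>n. of_real (divisor_sum c n) * z ^ n) sums T"
    by (rule has_sum_imp_sums)
  then have "T = lambert c z"
    using lambert_sums[OF assms(1)] sums_unique2 by blast
  have "((\<lambda>(m, r). of_real (c r) * (z ^ m) ^ r) has_sum T) ({1..} \<times> {1..})"
  proof (subst has_sum_reindex_bij_witness[of _ "\<lambda>(n, r). (n div r, r)" "\<lambda>(m, r). (m * r, r)" ?S f])
    show "(f has_sum T) ?S" by (fact T)
  qed (auto simp: f_def power_mult dvd_pos_nat Suc_le_eq div_greater_zero_iff dvd_imp_le)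
  then have "(C has_sum T) {1..}"
    by (rule has_sum_Sigma[OF isUCont_plus]) (use C in auto)
  then show ?thesis
    using \<open>T = lambert c z\<close> by simp
qed

end

lemma has_sum_Suc:
  fixes f :: "nat \<Rightarrow> complex"
  assumes "summable (\<lambda>n. norm (f n))" "(\<lambda>n. f (Suc n)) sums S"
  shows "(f has_sum S) {1..}"
proof -
  have "summable (\<lambda>n. norm (f (Suc n)))"
    using assms(1) by (subst summable_Suc_iff)
  then have "((\<lambda>n. f (Suc n)) has_sum S) UNIV"
    using assms(2) by (rule norm_summable_imp_has_sum)
  then show ?thesis
    by (subst (asm) has_sum_reindex_bij_witness[of _ "\<lambda>n. n - 1" Suc "{1..}" f]) auto
qed

lemma has_sum_nat_geometric:
  fixes x :: complex
  assumes "cmod x < 1"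
  shows "((\<lambda>r. of_nat r * x ^ r) has_sum (x / (1 - x) ^ 2)) {1..}"
proof (rule has_sum_Suc)
  show "summable (\<lambda>n. norm (of_nat n * x ^ n))"
    using summable_power_times_geometric[of "cmod x" 1] assms by (simp add: norm_mult norm_power)
  show "(\<lambda>n. of_nat (Suc n) * x ^ Suc n) sums (x / (1 - x)\<^sup>2)"
    using sums_mult[OF geometric_deriv_sums[OF assms], of x] by (simp add: mult_ac)
qed

text \<open>The coefficients of \<open>(x / (1 - x)\<^sup>2)\<^sup>2\<close>.\<close>
definition c4 :: "nat \<Rightarrow> real" where
  "c4 k = (\<Sum>i\<le>k. real (i * (k - i)))"

lemma c4_bounds: "0 \<le> c4 k" "c4 k \<le> real k ^ 3"
proof -
  show "0 \<le> c4 k" unfolding c4_def by (rule sum_nonneg) (simp only: of_nat_0_le_iff)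
  have "c4 k = (\<Sum>i\<in>{1..k}. real (i * (k - i)))"
    unfolding c4_def by (rule sum.mono_neutral_right) (auto simp: Suc_le_eq)
  also have "\<dots> \<le> (\<Sum>i\<in>{1..k}. real (k * k))"
    by (intro sum_mono of_nat_mono mult_le_mono) auto
  finally show "c4 k \<le> real k ^ 3" by (simp add: power3_eq_cube)
qed

text \<open>Cauchy square of the series of n x^n, whose sum is x/(1 - x)^2.\<close>

lemma has_sum_c4:
  fixes x :: complex
  assumes "cmod x < 1"
  shows "((\<lambda>r. of_real (c4 r) * x ^ r) has_sum (x / (1 - x) ^ 2) ^ 2) {1..}"
proof (rule has_sum_Suc)
  let ?a = "\<lambda>n. of_nat n * x ^ n"
  have s: "summable (\<lambda>n. norm (?a n))"
    using summable_power_times_geometric[of "cmod x" 1] assms by (simp add: norm_mult norm_power)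
  have a: "?a sums (x / (1 - x) ^ 2)"
    using sums_mult[OF geometric_deriv_sums[OF assms], of x]
    by (subst sums_Suc_iff[symmetric, of ?a "x / (1 - x) ^ 2", simplified]) (simp add: mult_ac)
  have e: "(\<Sum>i\<le>k. ?a i * ?a (k - i)) = of_real (c4 k) * x ^ k" for k
  proof -
    have "?a i * ?a (k - i) = of_real (real (i * (k - i))) * x ^ k" if "i \<le> k" for i
    proof -
      have "x ^ k = x ^ i * x ^ (k - i)" using that by (simp flip: power_add)
      then show ?thesis by simp
    qed
    then have "(\<Sum>i\<le>k. ?a i * ?a (k - i)) = (\<Sum>i\<le>k. of_real (real (i * (k - i))) * x ^ k)"
      by (intro sum.cong) auto
    then show ?thesis by (simp only: c4_def sum_distrib_right of_real_sum)
  qed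
  have "(\<lambda>k. of_real (c4 k) * x ^ k) sums ((x / (1 - x) ^ 2) ^ 2)"
    using Cauchy_product_sums[OF s s] sums_unique[OF a] unfolding e by (simp add: power2_eq_square)
  then show "(\<lambda>n. of_real (c4 (Suc n)) * x ^ Suc n) sums ((x / (1 - x) ^ 2) ^ 2)"
    by (subst sums_Suc_iff) (simp add: c4_def)
  show "summable (\<lambda>n. norm (of_real (c4 n) * x ^ n))"
  proof (rule summable_comparison_test')
    show "summable (\<lambda>n. real n ^ 3 * cmod x ^ n)"
      using assms by (intro summable_power_times_geometric) auto
    show "norm (norm (of_real (c4 n) * x ^ n)) \<le> real n ^ 3 * cmod x ^ n" for n
      using c4_bounds[of n] by (auto simp: norm_mult norm_power intro!: mult_right_mono)
  qed
qed


interpretation sig: lambert_series real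
proof
  show "real r \<le> real r ^ 3" for r
    using self_le_power[of "real r" 3] by (cases "r = 0") auto
qed auto

interpretation c4: lambert_series c4
  by unfold_locales (fact c4_bounds)+

lemma lambert_sums_geometric:
  assumes "cmod z < 1"
  shows "(\<lambda>j. z ^ Suc j / (1 - z ^ Suc j) ^ 2) sums lambert real z"
    and "(\<lambda>j. (z ^ Suc j / (1 - z ^ Suc j) ^ 2) ^ 2) sums lambert c4 z"
proof -
  have lt: "cmod (z ^ m) < 1" if "m \<ge> 1" for m
    using assms that by (simp add: norm_power power_less_one_iff)
  have *: "(\<lambda>j. C (Suc j)) sums S" if "(C has_sum S) {1..}" for C and S :: complex
    using that by (subst (asm) has_sum_reindex_bij_witness[of _ Suc "\<lambda>n. n - 1" UNIV "\<lambda>j. C (Suc j)"])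
      (auto dest: has_sum_imp_sums)
  show "(\<lambda>j. z ^ Suc j / (1 - z ^ Suc j) ^ 2) sums lambert real z"
    by (rule *, rule sig.has_sum_lambert[OF assms]) (use has_sum_nat_geometric lt in simp)
  show "(\<lambda>j. (z ^ Suc j / (1 - z ^ Suc j) ^ 2) ^ 2) sums lambert c4 z"
    by (rule *, rule c4.has_sum_lambert[OF assms]) (use has_sum_c4 lt in simp)
qed

section \<open>Eisenstein series in the variable q and their behaviour under inversion\<close>

definition E2 :: "complex \<Rightarrow> complex" where
  "E2 \<tau> = 1 - 24 * lambert real (nome \<tau>)"

text \<open>The series of n sigma_1(n) q^n, that is, -1/24 of q dE2/dq. Up to a constant factor it
  is eta1'.\<close>

definition DG :: "complex \<Rightarrow> complex" where
  "DG \<tau> = dlambert real (nome \<tau>)"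

text \<open>\<open>g2\<close> as a function of q in the shape that the row sums deliver, before it
  is recognised as a multiple of \<open>E4\<close>. The 16 and the 8/3 come from 1/sin^2 = -4x with
  x = q/(1 - q)^2.\<close>

definition G4 :: "complex \<Rightarrow> complex" where
  "G4 z = 4 / 3 * of_real pi ^ 4 + 120 * of_real pi ^ 4 * (16 * lambert c4 z + 8 / 3 * lambert real z)"

lemma eta1_eq_E2:
  assumes "Im \<tau> > 0"
  shows "eta1 \<tau> = of_real pi ^ 2 / 3 * E2 \<tau>"
proof -
  have "2 * of_real pi ^ 2 / sin (of_real pi * (of_nat (Suc j) * \<tau>)) ^ 2 =
      - 8 * of_real pi ^ 2 * (nome \<tau> ^ Suc j / (1 - nome \<tau> ^ Suc j) ^ 2)" for j
  proof -
    have "2 * of_real pi ^ 2 / sin (of_real pi * (of_nat (Suc j) * \<tau>)) ^ 2 =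
        2 * of_real pi ^ 2 * (1 / sin (of_real pi * (of_nat (Suc j) * \<tau>)) ^ 2)" by simp
    then show ?thesis
      by (simp only: inverse_sin_squared_nome nome_of_nat_mult) simp
  qed
  then have "(\<lambda>j. - 8 * of_real pi ^ 2 * (nome \<tau> ^ Suc j / (1 - nome \<tau> ^ Suc j) ^ 2)) sums (eta1 \<tau> - of_real pi ^ 2 / 3)"
    using eta1_sums[OF assms] by (simp only:)
  moreover have "(\<lambda>j. - 8 * of_real pi ^ 2 * (nome \<tau> ^ Suc j / (1 - nome \<tau> ^ Suc j) ^ 2)) sums
      (- 8 * of_real pi ^ 2 * lambert real (nome \<tau>))"
    by (intro sums_mult lambert_sums_geometric norm_nome_less_1 assms)
  ultimately have "eta1 \<tau> - of_real pi ^ 2 / 3 = - 8 * of_real pi ^ 2 * lambert real (nome \<tau>)"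
    by (rule sums_unique2)
  then show ?thesis
    by (simp add: E2_def algebra_simps)
qed

lemma g2_eq_G4:
  assumes "Im \<tau> > 0"
  shows "g2 \<tau> = G4 (nome \<tau>)"
proof -
  let ?x = "\<lambda>j. nome \<tau> ^ Suc j / (1 - nome \<tau> ^ Suc j) ^ 2"
  have "120 * of_real pi ^ 4 * (1 / sin (of_real pi * (of_nat (Suc j) * \<tau>)) ^ 4
            - 2 / 3 / sin (of_real pi * (of_nat (Suc j) * \<tau>)) ^ 2) =
      120 * of_real pi ^ 4 * (16 * ?x j ^ 2 + 8 / 3 * ?x j)" for j
  proof -
    let ?s = "sin (of_real pi * (of_nat (Suc j) * \<tau>))"
    have e: "1 / ?s ^ 2 = - 4 * ?x j"
      by (simp only: inverse_sin_squared_nome nome_of_nat_mult)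
    have "1 / ?s ^ 4 = (1 / ?s ^ 2) ^ 2" "2 / 3 / ?s ^ 2 = 2 / 3 * (1 / ?s ^ 2)"
      by (simp_all add: power_divide flip: power_mult)
    then show ?thesis unfolding e by (simp only: power_mult_distrib) simp
  qed
  then have "(\<lambda>j. 120 * of_real pi ^ 4 * (16 * ?x j ^ 2 + 8 / 3 * ?x j)) sums (g2 \<tau> - 4 / 3 * of_real pi ^ 4)"
    using g2_sums[OF assms] by (simp only:)
  moreover have "(\<lambda>j. 120 * of_real pi ^ 4 * (16 * ?x j ^ 2 + 8 / 3 * ?x j)) sums
      (120 * of_real pi ^ 4 * (16 * lambert c4 (nome \<tau>) + 8 / 3 * lambert real (nome \<tau>)))"
    by (intro sums_mult sums_add lambert_sums_geometric norm_nome_less_1 assms)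
  ultimately have "g2 \<tau> - 4 / 3 * of_real pi ^ 4 = 120 * of_real pi ^ 4 * (16 * lambert c4 (nome \<tau>) + 8 / 3 * lambert real (nome \<tau>))"
    by (rule sums_unique2)
  then show ?thesis
    by (simp add: G4_def algebra_simps)
qed

lemma nome_nonzero: "nome \<tau> \<noteq> 0"
  by (simp add: nome_def)

lemma E2_has_derivative:
  assumes "Im \<tau> > 0"
  shows "(E2 has_field_derivative - 48 * of_real pi * \<i> * DG \<tau>) (at \<tau>)"
proof -
  obtain d where d: "(lambert real has_field_derivative d) (at (nome \<tau>))" "nome \<tau> * d = dlambert real (nome \<tau>)"
    using sig.lambert_deriv[OF norm_nome_less_1[OF assms]] by blast
  have n: "(nome has_field_derivative 2 * of_real pi * \<i> * nome \<tau>) (at \<tau>)"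
    unfolding nome_def[abs_def] by (auto intro!: derivative_eq_intros)
  have "((\<lambda>\<tau>. 1 - 24 * lambert real (nome \<tau>)) has_field_derivative 0 - 24 * (d * (2 * of_real pi * \<i> * nome \<tau>))) (at \<tau>)"
    by (intro DERIV_diff DERIV_const DERIV_cmult DERIV_chain2[OF d(1) n])
  also have "0 - 24 * (d * (2 * of_real pi * \<i> * nome \<tau>)) = - 48 * of_real pi * \<i> * DG \<tau>"
    by (simp add: DG_def flip: d(2))
  finally show ?thesis
    by (simp add: E2_def[abs_def])
qed

lemma open_upper_half_plane: "open {\<tau>. Im \<tau> > 0}"
  by (simp add: open_halfspace_Im_gt)

lemma deriv_eta1:
  assumes "Im \<tau> > 0"
  shows "deriv eta1 \<tau> = - 16 * of_real pi ^ 3 * \<i> * DG \<tau>"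
proof (rule DERIV_imp_deriv)
  have "((\<lambda>\<tau>. of_real pi ^ 2 / 3 * E2 \<tau>) has_field_derivative of_real pi ^ 2 / 3 * (- 48 * of_real pi * \<i> * DG \<tau>)) (at \<tau>)"
    by (rule DERIV_cmult[OF E2_has_derivative[OF assms]])
  then have "(eta1 has_field_derivative of_real pi ^ 2 / 3 * (- 48 * of_real pi * \<i> * DG \<tau>)) (at \<tau>)"
    by (rule has_field_derivative_transform_within_open[OF _ open_upper_half_plane]) (use assms eta1_eq_E2 in auto)
  then show "(eta1 has_field_derivative - 16 * of_real pi ^ 3 * \<i> * DG \<tau>) (at \<tau>)"
    by (simp add: power3_eq_cube power2_eq_square mult_ac)
qed

lemma lattice_scale:
  fixes \<tau> :: complex
  assumes "\<tau> \<noteq> 0"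
  shows "of_int m * (- 1 / \<tau>) + of_int n = (of_int n * \<tau> + of_int (- m)) / \<tau>"
  using assms by (simp add: field_simps)

lemma infsum_lat_rotate:
  fixes h :: "int \<times> int \<Rightarrow> complex"
  shows "infsum (\<lambda>(m, n). h (n, - m)) lat = infsum h lat"
  by (rule infsum_reindex_bij_witness[of _ "\<lambda>(m, n). (- n, m)" "\<lambda>(m, n). (n, - m)"]) auto

text \<open>Division by \<tau> maps the lattice of \<tau> onto that of -1/\<tau>, permuting the
  indices by (m, n) to (n, -m) and taking \<tau>/2 to 1/2; the zeta function is homogeneous of
  degree -1.\<close>

lemma eta1_inversion:
  assumes "\<tau> \<noteq> 0"
  shows "eta1 (- 1 / \<tau>) = \<tau> * eta2 \<tau>"
proof -
  define h where "h = (\<lambda>(m, n). let \<omega> = of_int m * \<tau> + of_int n in 1 / (\<tau> / 2 - \<omega>) + 1 / \<omega> + \<tau> / 2 / \<omega>^2)"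
  have scale: "1 / (1 / 2 - \<omega> / \<tau>) + 1 / (\<omega> / \<tau>) + 1 / 2 / (\<omega> / \<tau>) ^ 2 =
      \<tau> * (1 / (\<tau> / 2 - \<omega>) + 1 / \<omega> + \<tau> / 2 / \<omega>^2)" for \<omega>
  proof -
    have "1 / 2 - \<omega> / \<tau> = (\<tau> / 2 - \<omega>) / \<tau>" using assms by (simp add: field_simps)
    then show ?thesis
      using assms by (simp only: power_divide) (simp add: distrib_left power2_eq_square)
  qed
  have "infsum (\<lambda>(m::int, n::int). let \<omega> = of_int m * (- 1 / \<tau>) + of_int n in
      1 / (1 / 2 - \<omega>) + 1 / \<omega> + 1 / 2 / \<omega>^2) lat = infsum (\<lambda>(m, n). \<tau> * h (n, - m)) lat"
  proof -
    have "(let \<omega> = of_int m * (- 1 / \<tau>) + of_int n in 1 / (1 / 2 - \<omega>) + 1 / \<omega> + 1 / 2 / \<omega>^2) = \<tau> * h (n, - m)" for m n :: int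
      unfolding lattice_scale[OF assms] h_def case_prod_conv Let_def by (rule scale)
    then show ?thesis by (simp only:)
  qed
  also have "\<dots> = infsum (\<lambda>p. \<tau> * h p) lat"
    using infsum_lat_rotate[of "\<lambda>p. \<tau> * h p"] .
  also have "\<dots> = \<tau> * infsum h lat"
    by (rule infsum_cmult_right')
  finally have "wzeta (1 / 2) (- 1 / \<tau>) = 2 + \<tau> * infsum h lat"
    by (simp add: wzeta_def)
  also have "\<dots> = \<tau> * (1 / (\<tau> / 2) + infsum h lat)"
    using assms by (simp add: distrib_left)
  also have "\<dots> = \<tau> * wzeta (\<tau> / 2) \<tau>"
    by (simp add: wzeta_def h_def)
  finally show ?thesis
    by (simp add: eta1_def eta2_def)
qed

lemma g2_inversion:
  assumes "\<tau> \<noteq> 0"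
  shows "g2 (- 1 / \<tau>) = \<tau> ^ 4 * g2 \<tau>"
proof -
  define h where "h = (\<lambda>(m::int, n::int). 1 / (of_int m * \<tau> + of_int n) ^ 4)"
  have "infsum (\<lambda>(m::int, n::int). 1 / (of_int m * (- 1 / \<tau>) + of_int n) ^ 4) lat = infsum (\<lambda>(m, n). \<tau> ^ 4 * h (n, - m)) lat"
  proof -
    have "1 / (of_int m * (- 1 / \<tau>) + of_int n) ^ 4 = \<tau> ^ 4 * h (n, - m)" for m n :: int
      unfolding lattice_scale[OF assms] h_def case_prod_conv power_divide by simp
    then show ?thesis by (simp only:)
  qed
  also have "\<dots> = infsum (\<lambda>p. \<tau> ^ 4 * h p) lat"
    using infsum_lat_rotate[of "\<lambda>p. \<tau> ^ 4 * h p"] .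
  also have "\<dots> = \<tau> ^ 4 * infsum h lat"
    by (rule infsum_cmult_right')
  finally show ?thesis
    by (simp add: g2_def h_def)
qed

lemma Im_inversion_pos: "Im \<tau> > 0 \<Longrightarrow> Im (- 1 / \<tau>) > 0"
  by (auto simp: Im_divide complex_eq_iff intro!: divide_pos_pos add_nonneg_pos)

lemma E2_inversion:
  assumes "Im \<tau> > 0"
  shows "E2 (- 1 / \<tau>) = \<tau> ^ 2 * E2 \<tau> - 6 * \<i> / of_real pi * \<tau>"
proof -
  have "\<tau> \<noteq> 0" using assms by auto
  have "of_real pi ^ 2 / 3 * E2 (- 1 / \<tau>) = \<tau> * (\<tau> * (of_real pi ^ 2 / 3 * E2 \<tau>) - 2 * of_real pi * \<i>)"
    using eta1_inversion[OF \<open>\<tau> \<noteq> 0\<close>] legendre_relation[OF assms] eta1_eq_E2[OF assms]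
      eta1_eq_E2[OF Im_inversion_pos[OF assms]] by simp
  then have "E2 (- 1 / \<tau>) = \<tau> * (\<tau> * (of_real pi ^ 2 / 3 * E2 \<tau>) - 2 * of_real pi * \<i>) / (of_real pi ^ 2 / 3)"
    by (simp add: eq_divide_eq mult.commute)
  also have "\<dots> = \<tau> ^ 2 * E2 \<tau> - 6 * \<i> / of_real pi * \<tau>"
    by (simp add: field_simps power2_eq_square)
  finally show ?thesis .
qed

text \<open>The derivative of \<open>E2_inversion\<close>; the defect of \<open>E2\<close> from
  modularity produces the two lower-order terms.\<close>

lemma DG_inversion:
  assumes "Im \<tau> > 0"
  shows "DG (- 1 / \<tau>) = \<tau> ^ 4 * DG \<tau> + \<i> / (24 * of_real pi) * \<tau> ^ 3 * E2 \<tau> + \<tau> ^ 2 / (8 * of_real pi ^ 2)"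
proof -
  have "\<tau> \<noteq> 0" using assms by auto
  let ?k = "- 48 * of_real pi * \<i>"
  have i: "((\<lambda>\<tau>. - 1 / \<tau>) has_field_derivative 1 / \<tau> ^ 2) (at \<tau>)"
    using \<open>\<tau> \<noteq> 0\<close> by (auto intro!: derivative_eq_intros simp: power2_eq_square)
  have l: "((\<lambda>\<tau>. E2 (- 1 / \<tau>)) has_field_derivative ?k * DG (- 1 / \<tau>) * (1 / \<tau> ^ 2)) (at \<tau>)"
    by (rule DERIV_chain2[OF E2_has_derivative[OF Im_inversion_pos[OF assms]] i])
  have "((\<lambda>\<tau>. \<tau> ^ 2 * E2 \<tau> - 6 * \<i> / of_real pi * \<tau>) has_field_derivative
      2 * \<tau> * E2 \<tau> + \<tau> ^ 2 * (?k * DG \<tau>) - 6 * \<i> / of_real pi) (at \<tau>)"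
    by (rule derivative_eq_intros E2_has_derivative[OF assms] refl | simp)+
  then have "((\<lambda>\<tau>. E2 (- 1 / \<tau>)) has_field_derivative
      2 * \<tau> * E2 \<tau> + \<tau> ^ 2 * (?k * DG \<tau>) - 6 * \<i> / of_real pi) (at \<tau>)"
    by (rule has_field_derivative_transform_within_open[OF _ open_upper_half_plane]) (use assms E2_inversion in auto)
  with l have "?k * DG (- 1 / \<tau>) * (1 / \<tau> ^ 2) = 2 * \<tau> * E2 \<tau> + \<tau> ^ 2 * (?k * DG \<tau>) - 6 * \<i> / of_real pi"
    using DERIV_unique by blast
  then have "DG (- 1 / \<tau>) = (2 * \<tau> * E2 \<tau> + \<tau> ^ 2 * (?k * DG \<tau>) - 6 * \<i> / of_real pi) * \<tau> ^ 2 / ?k"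
    using \<open>\<tau> \<noteq> 0\<close> by (simp add: field_simps)
  also have "\<dots> = \<tau> ^ 4 * DG \<tau> + \<i> / (24 * of_real pi) * \<tau> ^ 3 * E2 \<tau> + \<tau> ^ 2 / (8 * of_real pi ^ 2)"
    using \<open>\<tau> \<noteq> 0\<close> by (simp add: divide_simps power_numeral_reduce) (simp add: algebra_simps)
  finally show ?thesis .
qed

lemma E2_DG_add_1:
  "E2 (\<tau> + 1) = E2 \<tau>" "DG (\<tau> + 1) = DG \<tau>"
  by (simp_all add: E2_def DG_def nome_add_1)

lemma g2_add_1: "Im \<tau> > 0 \<Longrightarrow> g2 (\<tau> + 1) = g2 \<tau>"
  by (simp add: g2_eq_G4 nome_add_1)

subsection \<open>The modular group\<close>

text \<open>The Euclidean algorithm on the first column: subtracting a multiple of the lower row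
  brings |a| below |c|, and the inversion exchanges the rows, so that |c| decreases. The cases are
  the translation, its inverse and the inversion; minus the identity is the square of the
  inversion.\<close>

lemma SL2Z_induct [consumes 1, case_names one add sub inv]:
  fixes P :: "int \<Rightarrow> int \<Rightarrow> int \<Rightarrow> int \<Rightarrow> bool"
  assumes det: "a * d - b * c = 1"
    and one: "P 1 0 0 1"
    and add: "\<And>a b c d. a * d - b * c = 1 \<Longrightarrow> P a b c d \<Longrightarrow> P (a + c) (b + d) c d"
    and sub: "\<And>a b c d. a * d - b * c = 1 \<Longrightarrow> P a b c d \<Longrightarrow> P (a - c) (b - d) c d"
    and inv: "\<And>a b c d. a * d - b * c = 1 \<Longrightarrow> P a b c d \<Longrightarrow> P (- c) (- d) a b"
  shows "P a b c d"
proof -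
  have translate: "P (a + k * c) (b + k * d) c d" if "a * d - b * c = 1" "P a b c d" for a b c d k
  proof (induction k rule: int_induct[of _ 0])
    case base
    then show ?case using that by simp
  next
    case (step1 i)
    have "P (a + i * c + c) (b + i * d + d) c d"
      by (rule add) (use step1 that in \<open>auto simp: algebra_simps\<close>)
    then show ?case by (simp add: algebra_simps)
  next
    case (step2 i)
    have "P (a + i * c - c) (b + i * d - d) c d"
      by (rule sub) (use step2 that in \<open>auto simp: algebra_simps\<close>)
    then show ?case by (simp add: algebra_simps)
  qed
  have neg: "P (- a) (- b) (- c) (- d)" if "a * d - b * c = 1" "P a b c d" for a b c d
    by (rule inv, simp add: that(1) mult.commute algebra_simps, use that in \<open>simp add: algebra_simps\<close>)
       (rule inv; use that in \<open>simp add: algebra_simps\<close>)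
  show ?thesis
    using det
  proof (induction "nat \<bar>c\<bar>" arbitrary: a b c d rule: less_induct)
    case less
    show ?case
    proof (cases "c = 0")
      case True
      then have ad: "a * d = 1" using less.prems by simp
      then consider "a = 1" "d = 1" | "a = - 1" "d = - 1"
        using zmult_eq_1_iff by auto
      then show ?thesis
      proof cases
        case 1
        then show ?thesis using translate[OF _ one, of b] True by simp
      next
        case 2
        have "P 1 (- b) 0 1" using translate[OF _ one, of "- b"] by simp
        from neg[OF _ this] show ?thesis using 2 True by simp
      qed
    next
      case False
      define k where "k = a div c"
      define a' b' where "a' = a - k * c" and "b' = b - k * d"
      have a': "a' = a mod c" by (simp add: a'_def k_def minus_div_mult_eq_mod)
      have lt: "nat \<bar>a'\<bar> < nat \<bar>c\<bar>"
        using False abs_mod_less[of c a] by (simp add: a')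
      have det': "a' * d - b' * c = 1"
        using less.prems by (simp add: a'_def b'_def algebra_simps)
      have "P (- c) (- d) a' b'"
        by (rule less.hyps[OF lt]) (use det' in \<open>simp add: algebra_simps\<close>)
      then have "P (- a') (- b') (- c) (- d)"
        by (rule inv[rotated]) (use det' in \<open>simp add: algebra_simps\<close>)
      then have "P a' b' c d"
        using neg[of "- a'" "- d" "- b'" "- c"] det' by simp
      from translate[OF det' this, of k] show ?thesis
        by (simp add: a'_def b'_def)
    qed
  qed
qed

lemma moebius_denom_nonzero:
  fixes \<tau> :: complex
  assumes "Im \<tau> > 0" "(c, d) \<noteq> (0, 0)"
  shows "of_int c * \<tau> + of_int d \<noteq> 0"
proof
  assume *: "of_int c * \<tau> + of_int d = 0"
  then have "Im (of_int c * \<tau> + of_int d) = 0" by simp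
  then have "c = 0" using assms by simp
  then show False using * assms by simp
qed

lemma moebius_Im:
  fixes \<tau> :: complex
  assumes "Im \<tau> > 0" "a * d - b * c = 1"
  shows "Im ((of_int a * \<tau> + of_int b) / (of_int c * \<tau> + of_int d)) = Im \<tau> / cmod (of_int c * \<tau> + of_int d) ^ 2"
proof -
  have "real_of_int a * real_of_int d - real_of_int b * real_of_int c = 1"
    using assms(2) by (metis of_int_1 of_int_diff of_int_mult)
  then have "real_of_int a * Im \<tau> * (real_of_int c * Re \<tau> + real_of_int d) -
      (real_of_int a * Re \<tau> + real_of_int b) * (real_of_int c * Im \<tau>) = Im \<tau>"
    by algebra
  then show ?thesis
    by (simp add: Im_divide cmod_power2)
qed

lemma moebius_Im_pos:
  fixes \<tau> :: complex
  assumes "Im \<tau> > 0" "a * d - b * c = 1"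
  shows "Im ((of_int a * \<tau> + of_int b) / (of_int c * \<tau> + of_int d)) > 0"
proof -
  have "of_int c * \<tau> + of_int d \<noteq> 0"
    using assms by (intro moebius_denom_nonzero) auto
  then show ?thesis
    using moebius_Im[OF assms] assms(1) by simp
qed

lemma moebius_steps:
  fixes \<tau> :: complex
  assumes "Im \<tau> > 0" "a * d - b * c = 1"
  defines "z \<equiv> (of_int a * \<tau> + of_int b) / (of_int c * \<tau> + of_int d)"
  shows "(of_int (a + c) * \<tau> + of_int (b + d)) / (of_int c * \<tau> + of_int d) = z + 1"
    and "(of_int (a - c) * \<tau> + of_int (b - d)) / (of_int c * \<tau> + of_int d) = z - 1"
    and "(of_int (- c) * \<tau> + of_int (- d)) / (of_int a * \<tau> + of_int b) = - 1 / z"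
proof -
  have nz: "of_int c * \<tau> + of_int d \<noteq> 0"
    using assms by (intro moebius_denom_nonzero) auto
  show "(of_int (a + c) * \<tau> + of_int (b + d)) / (of_int c * \<tau> + of_int d) = z + 1"
     "(of_int (a - c) * \<tau> + of_int (b - d)) / (of_int c * \<tau> + of_int d) = z - 1"
    using nz by (simp_all add: z_def divide_simps) (simp_all add: algebra_simps)
  have "of_int (- c) * \<tau> + of_int (- d) = - (of_int c * \<tau> + of_int d)" by simp
  then show "(of_int (- c) * \<tau> + of_int (- d)) / (of_int a * \<tau> + of_int b) = - 1 / z"
    by (simp only: z_def) simp
qed

lemma weight_4_transformation:
  fixes F :: "complex \<Rightarrow> complex"
  assumes T: "\<And>\<tau>. Im \<tau> > 0 \<Longrightarrow> F (\<tau> + 1) = F \<tau>" and S: "\<And>\<tau>. Im \<tau> > 0 \<Longrightarrow> F (- 1 / \<tau>) = \<tau> ^ 4 * F \<tau>"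
    and "a * d - b * c = 1" and \<tau>: "Im \<tau> > 0"
  shows "F ((of_int a * \<tau> + of_int b) / (of_int c * \<tau> + of_int d)) = (of_int c * \<tau> + of_int d) ^ 4 * F \<tau>"
  using \<open>a * d - b * c = 1\<close>
proof (induction rule: SL2Z_induct)
  case one
  then show ?case by simp
next
  case (add a b c d)
  then show ?case
    using T[OF moebius_Im_pos[OF \<tau> add(1)]] by (simp only: moebius_steps[OF \<tau> add(1)])
next
  case (sub a b c d)
  let ?z = "(of_int a * \<tau> + of_int b) / (of_int c * \<tau> + of_int d)"
  have "Im (?z - 1) > 0" using moebius_Im_pos[OF \<tau> sub(1)] by simp
  from T[OF this] show ?case
    using sub by (simp only: moebius_steps[OF \<tau> sub(1)]) simp
next
  case (inv a b c d)
  let ?z = "(of_int a * \<tau> + of_int b) / (of_int c * \<tau> + of_int d)"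
  have nz: "of_int c * \<tau> + of_int d \<noteq> 0"
    using \<tau> inv(1) by (intro moebius_denom_nonzero) auto
  have "F (- 1 / ?z) = ?z ^ 4 * F ?z"
    using S[OF moebius_Im_pos[OF \<tau> inv(1)]] .
  also have "\<dots> = (?z * (of_int c * \<tau> + of_int d)) ^ 4 * F \<tau>"
    by (simp only: inv(2) power_mult_distrib mult.assoc)
  also have "?z * (of_int c * \<tau> + of_int d) = of_int a * \<tau> + of_int b"
    using nz by simp
  finally show ?case
    by (simp only: moebius_steps[OF \<tau> inv(1)])
qed

text \<open>A fundamental domain of SL(2,Z) in the strip from 0 to 1 instead of the usual one around
  0: in this position it is symmetric about Re \<tau> = 1/2, lies in \<open>F0\<close>, and fills
  \<open>F0\<close> together with its two rotates.\<close>

definition modular_domain :: "complex set" where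
  "modular_domain = {\<tau>. Im \<tau> > 0 \<and> 0 \<le> Re \<tau> \<and> Re \<tau> \<le> 1 \<and> 1 \<le> cmod \<tau> \<and> 1 \<le> cmod (\<tau> - 1)}"

lemma modular_domain_Im:
  assumes "\<tau> \<in> modular_domain"
  shows "3 / 4 \<le> Im \<tau> ^ 2" "Im \<tau> > 0" "1 - Re \<tau> ^ 2 \<le> Im \<tau> ^ 2" "1 - (1 - Re \<tau>) ^ 2 \<le> Im \<tau> ^ 2"
proof -
  have *: "1 \<le> cmod \<tau> ^ 2" "1 \<le> cmod (\<tau> - 1) ^ 2" "0 \<le> Re \<tau>" "Re \<tau> \<le> 1"
    using assms by (auto simp: modular_domain_def)
  then show 1: "1 - Re \<tau> ^ 2 \<le> Im \<tau> ^ 2" "1 - (1 - Re \<tau>) ^ 2 \<le> Im \<tau> ^ 2"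
    by (simp_all add: cmod_power2 power2_commute)
  show "Im \<tau> > 0" using assms by (auto simp: modular_domain_def)
  show "3 / 4 \<le> Im \<tau> ^ 2"
  proof (cases "Re \<tau> \<le> 1 / 2")
    case True
    then have "Re \<tau> ^ 2 \<le> (1 / 2) ^ 2" using * by (intro power_mono) auto
    then show ?thesis using 1 by (simp add: power2_eq_square)
  next
    case False
    then have "(1 - Re \<tau>) ^ 2 \<le> (1 / 2) ^ 2" using * by (intro power_mono) auto
    then show ?thesis using 1 by (simp add: power2_eq_square)
  qed
qed

text \<open>(c, d) is chosen so that c\<tau> + d is a shortest nonzero lattice vector. Minimality
  makes c and d coprime, and the comparison with (a, b) and (a - c, b - d) yields |z| >= 1 and |z -
  1| >= 1 for the image point z.\<close>

lemma modular_reduction: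
  fixes \<tau> :: complex
  assumes \<tau>: "Im \<tau> > 0"
  obtains a b c d :: int where "a * d - b * c = 1"
    "(of_int a * \<tau> + of_int b) / (of_int c * \<tau> + of_int d) \<in> modular_domain"
proof -
  obtain \<kappa> where \<kappa>: "\<kappa> > 0"
    "\<And>m n::int. cmod (of_int m * \<tau> + of_int n) \<ge> \<kappa> * (\<bar>real_of_int m\<bar> + \<bar>real_of_int n\<bar>)"
    using lattice_norm_bound[OF \<tau>] by blast
  define N where "N = (\<lambda>(m::int, n::int). cmod (of_int m * \<tau> + of_int n))"
  \<comment> \<open>The vector (0, 1) has length 1, so the minimum over the whole lattice is
    attained in this finite set.\<close>
  define A where "A = {p \<in> lat. N p \<le> 1}"
  have "A \<subseteq> {- \<lfloor>1 / \<kappa>\<rfloor>..\<lfloor>1 / \<kappa>\<rfloor>} \<times> {- \<lfloor>1 / \<kappa>\<rfloor>..\<lfloor>1 / \<kappa>\<rfloor>}"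
  proof
    fix p assume "p \<in> A"
    then obtain m n where p: "p = (m, n)" "cmod (of_int m * \<tau> + of_int n) \<le> 1"
      by (cases p) (auto simp: A_def N_def)
    have "\<kappa> * (\<bar>real_of_int m\<bar> + \<bar>real_of_int n\<bar>) \<le> 1"
      using \<kappa>(2)[of m n] p by linarith
    then have "\<bar>real_of_int m\<bar> + \<bar>real_of_int n\<bar> \<le> 1 / \<kappa>"
      using \<kappa>(1) by (simp add: field_simps)
    then have "real_of_int \<bar>m\<bar> \<le> 1 / \<kappa>" "real_of_int \<bar>n\<bar> \<le> 1 / \<kappa>" by auto
    then have "\<bar>m\<bar> \<le> \<lfloor>1 / \<kappa>\<rfloor>" "\<bar>n\<bar> \<le> \<lfloor>1 / \<kappa>\<rfloor>" by (simp_all add: le_floor_iff)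
    then show "p \<in> {- \<lfloor>1 / \<kappa>\<rfloor>..\<lfloor>1 / \<kappa>\<rfloor>} \<times> {- \<lfloor>1 / \<kappa>\<rfloor>..\<lfloor>1 / \<kappa>\<rfloor>}"
      using p by auto
  qed
  then have "finite A" by (rule finite_subset) auto
  moreover have "(0, 1) \<in> A" by (simp add: A_def N_def)
  ultimately obtain p where p: "p \<in> A" "\<And>p'. p' \<in> A \<Longrightarrow> N p \<le> N p'"
    using ex_min_if_finite[of "N ` A"] by (metis (mono_tags, lifting) finite_imageI image_is_empty empty_iff imageE imageI not_le)
  obtain c d where cd: "p = (c, d)" by (cases p)
  have pl: "(c, d) \<noteq> (0, 0)" and N1: "N (c, d) \<le> 1" using p(1) cd by (auto simp: A_def)
  have min: "N (c, d) \<le> N (c', d')" if "(c', d') \<noteq> (0, 0)" for c' d'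
  proof (cases "N (c', d') \<le> 1")
    case True
    then show ?thesis using p(2)[of "(c', d')"] that cd by (auto simp: A_def)
  next
    case False
    then show ?thesis using N1 by simp
  qed
  have Npos: "N (c, d) > 0"
    using moebius_denom_nonzero[OF \<tau> pl] by (simp add: N_def)
  have g1: "gcd c d = 1"
  proof -
    define g where "g = gcd c d"
    have g: "g > 0" using pl by (auto simp: g_def)
    obtain c' d' where c': "c = g * c'" "d = g * d'"
      by (metis g_def dvdE gcd_dvd1 gcd_dvd2)
    have "N (c, d) = real_of_int g * N (c', d')"
    proof -
      have "of_int c * \<tau> + of_int d = of_int g * (of_int c' * \<tau> + of_int d')"
        by (simp add: c' algebra_simps)
      then show ?thesis using g by (simp add: N_def norm_mult)
    qed
    moreover have "N (c, d) \<le> N (c', d')"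
      by (rule min) (use pl c' in auto)
    ultimately have "real_of_int g * N (c', d') \<le> 1 * N (c', d')" by simp
    moreover have "N (c', d') > 0"
      using \<open>N (c, d) \<le> N (c', d')\<close> Npos by linarith
    ultimately have "real_of_int g \<le> 1" by (simp only: mult_le_cancel_right_pos)
    then show ?thesis using g unfolding g_def[symmetric] by linarith
  qed
  obtain u v where "u * c + v * d = 1"
    using bezout_int[of c d] g1 by auto
  then have det: "v * d - (- u) * c = 1" by simp
  define z where "z = (of_int v * \<tau> + of_int (- u)) / (of_int c * \<tau> + of_int d)"
  define k where "k = \<lfloor>Re z\<rfloor>"
  define a b where "a = v - k * c" and "b = - u - k * d"
  have det': "a * d - b * c = 1" using det by (simp add: a_def b_def algebra_simps)
  have nz: "of_int c * \<tau> + of_int d \<noteq> 0"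
    by (rule moebius_denom_nonzero[OF \<tau> pl])
  have zk: "(of_int a * \<tau> + of_int b) / (of_int c * \<tau> + of_int d) = z - of_int k"
    using nz by (simp add: z_def a_def b_def divide_simps) (simp add: algebra_simps)
  have zk1: "(of_int (a - c) * \<tau> + of_int (b - d)) / (of_int c * \<tau> + of_int d) = z - of_int k - 1"
    using moebius_steps(2)[OF \<tau> det'] zk by simp
  have "cmod (z - of_int k) \<ge> 1"
  proof -
    have "N (c, d) \<le> N (a, b)" by (rule min) (use det' in auto)
    then show ?thesis unfolding zk[symmetric] using Npos by (simp add: N_def norm_divide)
  qed
  moreover have "cmod (z - of_int k - 1) \<ge> 1"
  proof -
    have "(a - c, b - d) \<noteq> (0, 0)"
    proof
      assume "(a - c, b - d) = (0, 0)"
      then have "a = c" "b = d" by auto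
      then show False using det' by simp
    qed
    then have "N (c, d) \<le> N (a - c, b - d)" by (rule min)
    then show ?thesis unfolding zk1[symmetric] using Npos by (simp add: N_def norm_divide)
  qed
  moreover have "Im (z - of_int k) > 0"
    unfolding zk[symmetric] by (rule moebius_Im_pos[OF \<tau> det'])
  moreover have "0 \<le> Re (z - of_int k)" "Re (z - of_int k) \<le> 1"
    by (simp_all add: k_def) linarith+
  ultimately have "(of_int a * \<tau> + of_int b) / (of_int c * \<tau> + of_int d) \<in> modular_domain"
    unfolding zk by (simp add: modular_domain_def)
  then show ?thesis using that det' by blast
qed

section \<open>Weight 4 and Ramanujan's identity\<close>

definition E4 :: "complex \<Rightarrow> complex" where
  "E4 \<tau> = E2 \<tau> ^ 2 + 288 * DG \<tau>"

text \<open>\<open>E4\<close> is E2^2 - 12 q dE2/dq, with 288 = 12 * 24. In this combination the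
  terms with \<tau>^3 and \<tau>^2 in the two transformation laws cancel.\<close>

lemma E4_inversion:
  assumes "Im \<tau> > 0"
  shows "E4 (- 1 / \<tau>) = \<tau> ^ 4 * E4 \<tau>"
proof -
  define p :: complex where "p = of_real pi"
  have p: "p \<noteq> 0" by (simp add: p_def)
  have e: "E2 (- 1 / \<tau>) = \<tau> ^ 2 * E2 \<tau> - 6 * \<i> / p * \<tau>"
    "DG (- 1 / \<tau>) = \<tau> ^ 4 * DG \<tau> + \<i> / (24 * p) * \<tau> ^ 3 * E2 \<tau> + \<tau> ^ 2 / (8 * p ^ 2)"
    using E2_inversion[OF assms] DG_inversion[OF assms] by (simp_all add: p_def)
  show ?thesis
    unfolding E4_def e using p
    by (simp add: divide_simps power_numeral_reduce) (simp add: algebra_simps)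
qed

text \<open>A cusp form of weight 4 vanishes: \<open>|F| y\<^sup>2\<close> attains its maximum at a point with
  \<open>y\<^sup>2 \<ge> 3/4\<close>, whereas the maximum principle for \<open>F / q\<close> bounds it by a smaller multiple of the
  values on the line \<open>y = 1/2\<close>.\<close>
lemma weight_4_cusp_form_vanishes:
  fixes F G :: "complex \<Rightarrow> complex"
  assumes T: "\<And>\<tau>. Im \<tau> > 0 \<Longrightarrow> F (\<tau> + 1) = F \<tau>" and S: "\<And>\<tau>. Im \<tau> > 0 \<Longrightarrow> F (- 1 / \<tau>) = \<tau> ^ 4 * F \<tau>"
    and FG: "\<And>\<tau>. Im \<tau> > 0 \<Longrightarrow> F \<tau> = G (nome \<tau>)"
    and G: "G holomorphic_on ball 0 1" "G 0 = 0" and "Im \<sigma> > 0"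
  shows "F \<sigma> = 0"
proof (rule ccontr)
  assume "F \<sigma> \<noteq> 0"
  define \<phi> where "\<phi> = (\<lambda>\<tau>. cmod (F \<tau>) * Im \<tau> ^ 2)"
  have inv: "\<exists>\<tau>'\<in>modular_domain. \<phi> \<tau> = \<phi> \<tau>'" if \<tau>: "Im \<tau> > 0" for \<tau>
  proof -
    obtain a b c d :: int where det: "a * d - b * c = 1"
      and mem: "(of_int a * \<tau> + of_int b) / (of_int c * \<tau> + of_int d) \<in> modular_domain"
      using modular_reduction[OF \<tau>] by blast
    have nz: "of_int c * \<tau> + of_int d \<noteq> 0"
      using \<tau> det by (intro moebius_denom_nonzero) auto
    let ?j = "cmod (of_int c * \<tau> + of_int d)"
    have "\<phi> ((of_int a * \<tau> + of_int b) / (of_int c * \<tau> + of_int d)) = (?j ^ 4 * cmod (F \<tau>)) * (Im \<tau> / ?j ^ 2) ^ 2"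
    proof -
      have "F ((of_int a * \<tau> + of_int b) / (of_int c * \<tau> + of_int d)) = (of_int c * \<tau> + of_int d) ^ 4 * F \<tau>"
        by (rule weight_4_transformation[OF _ _ det \<tau>]) (use T S in auto)
      then show ?thesis
        unfolding \<phi>_def moebius_Im[OF \<tau> det] by (simp only: norm_mult norm_power)
    qed
    also have "\<dots> = \<phi> \<tau>"
      using nz by (simp add: \<phi>_def power_divide flip: power_mult)
    finally show ?thesis using mem by metis
  qed
  \<comment> \<open>F/q, extended holomorphically over the cusp; this is where G 0 = 0
    enters.\<close>
  define K where "K = (\<lambda>z. if z = 0 then deriv G 0 else G z / z)"
  have K: "K holomorphic_on ball 0 1"
    by (rule pole_theorem_open_0[OF G(1), of 0]) (auto simp: K_def G(2))
  have GK: "G z = z * K z" for z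
    using G(2) by (simp add: K_def)
  \<comment> \<open>The circle of this radius is the image of the line Im \<tau> = 1/2.\<close>
  define r where "r = exp (- pi)"
  have r: "0 < r" "r < 1" by (simp_all add: r_def)
  have Kc: "continuous_on (cball 0 r) K"
    using holomorphic_on_imp_continuous_on[OF K] by (rule continuous_on_subset) (use r in auto)
  then have "bounded (K ` cball 0 r)"
    by (intro compact_imp_bounded compact_continuous_image) auto
  then obtain B where B: "B > 0" "\<And>z. z \<in> cball 0 r \<Longrightarrow> cmod (K z) \<le> B"
    unfolding bounded_pos by auto
  have small: "\<phi> \<tau> \<le> B * (exp (- 2 * pi * Im \<tau>) * Im \<tau> ^ 2)" if "Im \<tau> \<ge> 1/2" for \<tau>
  proof -
    have "nome \<tau> \<in> cball 0 r"
      using that by (simp add: norm_nome r_def)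
    then have "cmod (F \<tau>) \<le> exp (- 2 * pi * Im \<tau>) * B"
      using FG[of \<tau>] that B(2) by (simp add: GK norm_mult norm_nome mult_left_mono)
    then have "cmod (F \<tau>) * Im \<tau> ^ 2 \<le> (exp (- 2 * pi * Im \<tau>) * B) * Im \<tau> ^ 2"
      by (rule mult_right_mono) simp
    then show ?thesis by (simp add: \<phi>_def mult_ac)
  qed
  obtain \<sigma>' where \<sigma>': "\<sigma>' \<in> modular_domain" "\<phi> \<sigma> = \<phi> \<sigma>'"
    using inv[OF \<open>Im \<sigma> > 0\<close>] by blast
  have pos: "\<phi> \<sigma>' > 0"
    unfolding \<sigma>'(2)[symmetric] using \<open>F \<sigma> \<noteq> 0\<close> \<open>Im \<sigma> > 0\<close> by (simp add: \<phi>_def)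
  \<comment> \<open>Exponential decay excludes great heights from the competition for the maximum,
    which can then be sought on a compact set.\<close>
  have "eventually (\<lambda>y::real. y ^ 2 / exp y < \<phi> \<sigma>' / B) at_top"
    using tendsto_power_div_exp_0 pos B(1) by (intro order_tendstoD) auto
  then obtain Y0 where Y0: "\<And>y::real. y \<ge> Y0 \<Longrightarrow> y ^ 2 / exp y < \<phi> \<sigma>' / B"
    by (auto simp: eventually_at_top_linorder)
  define Y where "Y = max Y0 0"
  have Y: "B * (exp (- 2 * pi * y) * y ^ 2) < \<phi> \<sigma>'" if "y \<ge> Y" for y
  proof -
    have y: "y \<ge> 0" "y \<ge> Y0" using that by (auto simp: Y_def)
    have "exp (- 2 * pi * y) \<le> exp (- y)"
      using mult_right_mono[of 1 "2 * pi" y] y pi_gt3 by simp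
    then have "exp (- 2 * pi * y) * y ^ 2 \<le> exp (- y) * y ^ 2"
      by (rule mult_right_mono) simp
    also have "\<dots> = y ^ 2 / exp y" by (simp add: exp_minus divide_inverse mult.commute)
    also have "\<dots> < \<phi> \<sigma>' / B" by (rule Y0[OF y(2)])
    finally show ?thesis using B(1) by (simp add: field_simps)
  qed
  have half: "Im \<tau> \<ge> 1/2" if "\<tau> \<in> modular_domain" for \<tau>
    using modular_domain_Im(1,2)[OF that] by (intro power2_le_imp_le[of "1/2"]) (auto simp: power2_eq_square)
  define M where "M = {\<tau> \<in> modular_domain. Im \<tau> \<le> Y}"
  have Mbig: "\<phi> \<tau> < \<phi> \<sigma>'" if "\<tau> \<in> modular_domain" "\<tau> \<notin> M" for \<tau>
    using that Y[of "Im \<tau>"] small[OF half, of \<tau>] by (auto simp: M_def)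
  have "M = {\<tau>. 1/2 \<le> Im \<tau>} \<inter> {\<tau>. Im \<tau> \<le> Y} \<inter> {\<tau>. 0 \<le> Re \<tau>} \<inter> {\<tau>. Re \<tau> \<le> 1} \<inter> {\<tau>. 1 \<le> cmod \<tau>} \<inter> {\<tau>. 1 \<le> cmod (\<tau> - 1)}"
    using half by (auto simp: M_def modular_domain_def)
  then have "closed M"
    by (auto intro!: closed_Int closed_Collect_le continuous_intros)
  moreover have "M \<subseteq> cball 0 (1 + \<bar>Y\<bar>)"
  proof
    fix \<tau> assume "\<tau> \<in> M"
    then have "\<bar>Re \<tau>\<bar> \<le> 1" "\<bar>Im \<tau>\<bar> \<le> \<bar>Y\<bar>" by (auto simp: M_def modular_domain_def)
    then show "\<tau> \<in> cball 0 (1 + \<bar>Y\<bar>)"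
      using cmod_le[of \<tau>] by simp
  qed
  ultimately have "compact M"
    by (meson bounded_cball bounded_subset compact_eq_bounded_closed)
  moreover have "\<sigma>' \<in> M"
    using Mbig \<sigma>'(1) by blast
  moreover have "continuous_on M \<phi>"
  proof -
    have "continuous_on M (\<lambda>\<tau>. G (nome \<tau>))"
      by (rule continuous_on_compose2[OF holomorphic_on_imp_continuous_on[OF G(1)]])
         (auto simp: nome_def[abs_def] M_def modular_domain_def norm_exp_eq_Re intro!: continuous_intros)
    then have "continuous_on M F"
      by (rule continuous_on_eq) (use FG in \<open>auto simp: M_def modular_domain_def\<close>)
    then show ?thesis
      unfolding \<phi>_def by (intro continuous_intros)
  qed
  ultimately obtain \<tau>0 where \<tau>0: "\<tau>0 \<in> M" "\<And>\<tau>. \<tau> \<in> M \<Longrightarrow> \<phi> \<tau> \<le> \<phi> \<tau>0"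
    using continuous_attains_sup[of M \<phi>] by blast
  have "\<phi> \<tau> \<le> \<phi> \<tau>0" if "\<tau> \<in> modular_domain" for \<tau>
    using \<tau>0(2)[of \<tau>] \<tau>0(2)[OF \<open>\<sigma>' \<in> M\<close>] Mbig[OF that] by fastforce
  then have max: "\<phi> \<tau> \<le> \<phi> \<tau>0" if "Im \<tau> > 0" for \<tau>
    using inv[OF that] by metis
  define m where "m = \<phi> \<tau>0"
  have m: "m > 0" using pos \<tau>0(2)[OF \<open>\<sigma>' \<in> M\<close>] by (simp add: m_def)
  define y where "y = Im \<tau>0"
  have y: "y ^ 2 \<ge> 3/4" "y \<ge> 1/2" "y > 0"
    using modular_domain_Im[of \<tau>0] half \<tau>0(1) by (auto simp: M_def y_def)
  have "cmod (K (nome \<tau>0)) \<le> 4 * m * exp pi"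
  proof (rule maximum_modulus_frontier[of K "cball 0 r"])
    show "K holomorphic_on interior (cball 0 r)"
      by (rule holomorphic_on_subset[OF K]) (use r in auto)
    show "continuous_on (closure (cball 0 r)) K" using Kc by simp
    show "nome \<tau>0 \<in> cball 0 r"
      using y by (simp add: norm_nome r_def y_def)
    fix z :: complex assume "z \<in> frontier (cball 0 r)"
    then have z: "cmod z = r" using r by simp
    define \<tau> where "\<tau> = Ln z / (2 * of_real pi * \<i>)"
    have "z \<noteq> 0" using z r by auto
    then have nome: "nome \<tau> = z" by (simp add: nome_def \<tau>_def)
    have "exp (- 2 * pi * Im \<tau>) = exp (- pi)"
      using norm_nome[of \<tau>] z by (simp add: nome r_def)
    then have Im: "Im \<tau> = 1/2" by simp
    then have "\<phi> \<tau> \<le> m"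
      using max[of \<tau>] by (simp add: m_def)
    then have "cmod (F \<tau>) * (1/2) ^ 2 \<le> m"
      unfolding \<phi>_def Im .
    then have "cmod (F \<tau>) \<le> 4 * m"
      by (simp add: power2_eq_square)
    then have "cmod (G z) \<le> 4 * m"
      using FG[of \<tau>] Im nome by simp
    then have "cmod (G z) * exp pi \<le> 4 * m * exp pi"
      by (rule mult_right_mono) simp
    moreover have "cmod (K z) = cmod (G z) * exp pi"
      using \<open>z \<noteq> 0\<close> by (simp add: K_def norm_divide z) (simp add: r_def exp_minus divide_inverse)
    ultimately show "cmod (K z) \<le> 4 * m * exp pi"
      by simp
  qed auto
  then have "cmod (F \<tau>0) \<le> exp (- 2 * pi * y) * (4 * m * exp pi)"
    using FG[of \<tau>0] y by (simp add: GK norm_mult norm_nome y_def mult_left_mono)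
  then have "m \<le> (exp (- 2 * pi * y) * (4 * m * exp pi)) * y ^ 2"
    unfolding m_def \<phi>_def y_def[symmetric] by (rule mult_right_mono) simp
  also have "\<dots> = m * (4 * y ^ 2 * exp (- (2 * pi * (y - 1/2))))"
  proof -
    have "- (2 * pi * (y - 1/2)) = - 2 * pi * y + pi" by (simp add: algebra_simps)
    then show ?thesis by (simp only: exp_add) simp
  qed
  finally have "1 \<le> 4 * y ^ 2 * exp (- (2 * pi * (y - 1/2)))"
    using m by simp
  then have "exp (2 * pi * (y - 1/2)) \<le> 4 * y ^ 2"
    by (simp add: exp_minus field_simps)
  \<comment> \<open>6 is a lower bound for 2 pi. Since 2y = 1 + u/3, the last inequality would imply
    exp u <= 1 + 2u/3 + u^2/9, against exp u >= 1 + u + u^2/2.\<close>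
  moreover define u where "u = 6 * (y - 1/2)"
  have u: "u > 0"
  proof -
    have "y \<noteq> 1/2"
    proof
      assume "y = 1/2"
      then have "y ^ 2 = (1/2) ^ 2" by (simp only:)
      then show False using y(1) by (simp add: power2_eq_square)
    qed
    then show ?thesis using y by (simp add: u_def)
  qed
  have "u \<le> 2 * pi * (y - 1/2)"
    unfolding u_def using pi_gt3 y by (intro mult_right_mono) auto
  then have "1 + u + u ^ 2 / 2 \<le> exp (2 * pi * (y - 1/2))"
    using exp_lower_Taylor_quadratic[of u] u by (smt (verit) exp_le_cancel_iff)
  moreover have "4 * y ^ 2 = 1 + 2 * u / 3 + u ^ 2 / 9"
    by (simp add: u_def field_simps power2_eq_square)
  moreover have "u ^ 2 > 0" using u by simp
  ultimately show False using u by linarith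
qed

lemma ramanujan_g2:
  assumes "Im \<tau> > 0"
  shows "g2 \<tau> = 4 / 3 * of_real pi ^ 4 * E4 \<tau>"
proof -
  define F where "F = (\<lambda>\<tau>. 4 / 3 * of_real pi ^ 4 * E4 \<tau> - g2 \<tau>)"
  define G where "G = (\<lambda>z. 4 / 3 * of_real pi ^ 4 * ((1 - 24 * lambert real z) ^ 2 + 288 * dlambert real z) - G4 z)"
  have "F \<tau> = 0"
  proof (rule weight_4_cusp_form_vanishes[of F G])
    show "F (\<tau> + 1) = F \<tau>" if "Im \<tau> > 0" for \<tau>
      using that by (simp add: F_def E4_def E2_DG_add_1 g2_add_1)
    show "F (- 1 / \<tau>) = \<tau> ^ 4 * F \<tau>" if "Im \<tau> > 0" for \<tau>
    proof -
      have "\<tau> \<noteq> 0" using that by auto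
      show ?thesis
        unfolding F_def E4_inversion[OF that] g2_inversion[OF \<open>\<tau> \<noteq> 0\<close>] by (simp add: algebra_simps)
    qed
    show "F \<tau> = G (nome \<tau>)" if "Im \<tau> > 0" for \<tau>
      using that by (simp add: F_def G_def E4_def E2_def DG_def g2_eq_G4)
    show "G holomorphic_on ball 0 1"
      unfolding G_def G4_def
      by (intro holomorphic_intros sig.holomorphic_lambert sig.holomorphic_dlambert c4.holomorphic_lambert)
    have "lambert c 0 = 0" "dlambert c 0 = 0" for c
      by (simp_all add: lambert_def dlambert_def powser_zero[of "\<lambda>n. of_real (divisor_sum c n)"]
          powser_zero[of "\<lambda>n. of_nat n * of_real (divisor_sum c n)"])
    then show "G 0 = 0"
      by (simp add: G_def G4_def)
  qed (fact assms)
  then show ?thesis by (simp add: F_def)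
qed

text \<open>The constant of the anomalous term in \<open>E2_inversion\<close>, freed of the factor
  i.\<close>

definition kap :: real where "kap = 6 / pi"

text \<open>Up to the factor \<open>- 4/3 \<pi>\<^sup>4\<close> this is \<open>12 (u \<eta>\<^sub>2 + v \<eta>\<^sub>1)\<^sup>2 - g\<^sub>2 (u \<tau> + v)\<^sup>2\<close>, a binary form on which
  \<open>SL\<^sub>2(\<int>)\<close> acts through \<open>(u, v)\<close>.\<close>
definition Psi :: "complex \<Rightarrow> complex \<Rightarrow> complex \<Rightarrow> complex" where
  "Psi u v \<tau> = of_real kap ^ 2 * u ^ 2 + 2 * \<i> * of_real kap * u * (u * \<tau> + v) * E2 \<tau> + 288 * DG \<tau> * (u * \<tau> + v) ^ 2"

lemma f_C_eq_Psi:
  assumes "Im \<tau> > 0"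
  shows "f_C C \<tau> = - 4 / 3 * of_real pi ^ 4 * Psi 1 (- of_real C) \<tau>"
proof -
  define p :: complex where "p = of_real pi"
  have p: "p \<noteq> 0" by (simp add: p_def)
  have e: "eta1 \<tau> = p ^ 2 / 3 * E2 \<tau>" "eta2 \<tau> = \<tau> * (p ^ 2 / 3 * E2 \<tau>) - 2 * p * \<i>"
    "g2 \<tau> = 4 / 3 * p ^ 4 * (E2 \<tau> ^ 2 + 288 * DG \<tau>)" "of_real kap = 6 / p"
    using eta1_eq_E2[OF assms] legendre_relation[OF assms] ramanujan_g2[OF assms]
    by (simp_all add: p_def E4_def kap_def)
  show ?thesis
    unfolding f_C_def Psi_def e p_def[symmetric] using p
    by (simp add: divide_simps power_numeral_reduce) (simp add: algebra_simps)
qed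

lemma Psi_scale: "Psi (c * u) (c * v) \<tau> = c ^ 2 * Psi u v \<tau>"
  by (simp add: Psi_def power_mult_distrib algebra_simps power2_eq_square)

lemma Psi_add_1: "Psi u v (\<tau> + 1) = Psi u (u + v) \<tau>"
  unfolding Psi_def E2_DG_add_1 by (simp add: algebra_simps)

lemma Psi_inversion:
  assumes "Im \<tau> > 0"
  shows "Psi u v (- 1 / \<tau>) = \<tau> ^ 2 * Psi v (- u) \<tau>"
proof -
  define p :: complex where "p = of_real pi"
  have p: "p \<noteq> 0" by (simp add: p_def)
  have t: "\<tau> \<noteq> 0" using assms by auto
  have e: "E2 (- 1 / \<tau>) = \<tau> ^ 2 * E2 \<tau> - 6 * \<i> / p * \<tau>"
    "DG (- 1 / \<tau>) = \<tau> ^ 4 * DG \<tau> + \<i> / (24 * p) * \<tau> ^ 3 * E2 \<tau> + \<tau> ^ 2 / (8 * p ^ 2)" "of_real kap = 6 / p"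
    using E2_inversion[OF assms] DG_inversion[OF assms] by (simp_all add: p_def kap_def)
  show ?thesis
    unfolding Psi_def e using p t
    by (simp add: divide_simps power_numeral_reduce) (simp add: algebra_simps)
qed

text \<open>The matrix acts on the row vector (u, v) from the right, as is checked on generators.
  The vector (0, 1) goes to (c, d), for nonzero c a multiple of (1, -C) with C = -d/c.\<close>

lemma Psi_transformation:
  assumes "a * d - b * c = 1" and \<tau>: "Im \<tau> > 0"
  shows "Psi u v ((of_int a * \<tau> + of_int b) / (of_int c * \<tau> + of_int d)) =
    (of_int c * \<tau> + of_int d) ^ 2 * Psi (u * of_int a + v * of_int c) (u * of_int b + v * of_int d) \<tau>"
  using assms(1)
proof (induction arbitrary: u v rule: SL2Z_induct)
  case one
  then show ?case by simp
next
  case (add a b c d)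
  show ?case
    unfolding moebius_steps[OF \<tau> add(1)] Psi_add_1 add(2) by (simp add: algebra_simps)
next
  case (sub a b c d)
  let ?z = "(of_int a * \<tau> + of_int b) / (of_int c * \<tau> + of_int d)"
  have "Psi u v (?z - 1) = Psi u (v - u) ?z"
    using Psi_add_1[of u "v - u" "?z - 1"] by simp
  then show ?case
    unfolding moebius_steps[OF \<tau> sub(1)] sub(2) by (simp add: algebra_simps)
next
  case (inv a b c d)
  let ?z = "(of_int a * \<tau> + of_int b) / (of_int c * \<tau> + of_int d)"
  have nz: "of_int c * \<tau> + of_int d \<noteq> 0"
    using \<tau> inv(1) by (intro moebius_denom_nonzero) auto
  have "Psi u v (- 1 / ?z) = ?z ^ 2 * Psi v (- u) ?z"
    by (rule Psi_inversion[OF moebius_Im_pos[OF \<tau> inv(1)]])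
  also have "\<dots> = (?z * (of_int c * \<tau> + of_int d)) ^ 2 *
      Psi (v * of_int a + - u * of_int c) (v * of_int b + - u * of_int d) \<tau>"
    by (simp only: inv(2) power_mult_distrib mult.assoc)
  also have "?z * (of_int c * \<tau> + of_int d) = of_int a * \<tau> + of_int b"
    using nz by simp
  finally show ?case
    by (simp only: moebius_steps[OF \<tau> inv(1)]) (simp add: algebra_simps)
qed

lemma deriv_eta1_eq_0_iff: "Im \<tau> > 0 \<Longrightarrow> deriv eta1 \<tau> = 0 \<longleftrightarrow> Psi 0 1 \<tau> = 0"
  by (simp add: deriv_eta1 Psi_def)

subsection \<open>Estimates near the cusp\<close>

text \<open>The bound keeps the factor |Im z|: near the imaginary axis the leading part in
  \<open>real_part_estimate\<close> is itself of size Re \<tau>, and an error of size |q| would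
  swamp it.\<close>

lemma abs_Im_power_le: "\<bar>Im (z ^ n)\<bar> \<le> real n * cmod z ^ (n - 1) * \<bar>Im z\<bar>"
proof (induction n)
  case (Suc n)
  show ?case
  proof (cases "n = 0")
    case False
    then have p: "cmod z ^ n = cmod z * cmod z ^ (n - 1)" by (simp flip: power_Suc)
    have "\<bar>Im (z ^ Suc n)\<bar> \<le> \<bar>Re z\<bar> * \<bar>Im (z ^ n)\<bar> + \<bar>Im z\<bar> * \<bar>Re (z ^ n)\<bar>"
      by (simp flip: abs_mult)
    also have "\<dots> \<le> cmod z * (real n * cmod z ^ (n - 1) * \<bar>Im z\<bar>) + \<bar>Im z\<bar> * cmod z ^ n"
      using abs_Re_le_cmod[of "z ^ n"]
      by (intro add_mono mult_mono Suc abs_Re_le_cmod mult_left_mono) (auto simp: norm_power)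
    also have "\<dots> = real (Suc n) * cmod z ^ n * \<bar>Im z\<bar>"
      by (simp add: p algebra_simps)
    finally show ?thesis by simp
  qed simp
qed simp

text \<open>The first term dominates. The coefficient bound n^3 and one more n from
  \<open>abs_Im_power_le\<close> give n^4, and 1 + n/2 <= (3/2)^n turns (n + 2)^4 into 16 (81/16)^n.
  For \<rho> = 0.0044 the geometric tail 16\<rho> / (1 - 81\<rho>/16) is about 0.072, below
  3/40.\<close>

lemma power_series_tail_estimates:
  fixes b :: "nat \<Rightarrow> real" and f z :: complex
  assumes f: "(\<lambda>n. of_real (b n) * z ^ n) sums f" and z: "cmod z \<le> 44 / 10000"
    and b: "b 0 = 0" "b 1 = 1" "\<And>n. 0 \<le> b n" "\<And>n. b n \<le> real n ^ 3"
  shows "cmod (f - z) \<le> 3 / 40 * cmod z" "\<bar>Im f - Im z\<bar> \<le> 3 / 40 * \<bar>Im z\<bar>"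
proof -
  define \<rho> :: real where "\<rho> = 44 / 10000"
  have tail: "(\<lambda>n. of_real (b (n + 2)) * z ^ (n + 2)) sums (f - z)"
    using sums_split_initial_segment[OF f, of 2] b by (simp add: numeral_2_eq_2)
  have key: "real (n + 2) ^ 4 * cmod z ^ (n + 1) \<le> 16 * \<rho> * (81 / 16 * \<rho>) ^ n" for n
  proof -
    have "1 + real n * (1/2) \<le> (1 + 1/2) ^ n"
      by (rule Bernoulli_inequality) simp
    then have "(1 + real n * (1/2)) ^ 4 \<le> ((1 + 1/2) ^ n) ^ 4"
      by (intro power_mono) auto
    also have "((1 + 1/2 :: real) ^ n) ^ 4 = ((1 + 1/2) ^ 4) ^ n"
      by (simp only: mult.commute flip: power_mult)
    also have "\<dots> = (81 / 16) ^ n" by (simp add: power_numeral_reduce)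
    finally have "16 * (1 + real n * (1/2)) ^ 4 \<le> 16 * (81 / 16) ^ n" by simp
    moreover have "16 * (1 + real n * (1/2)) ^ 4 = real (n + 2) ^ 4"
    proof -
      have "real (n + 2) = 2 * (1 + real n * (1/2))" by simp
      then show ?thesis by (simp only: power_mult_distrib) simp
    qed
    ultimately have 1: "real (n + 2) ^ 4 \<le> 16 * (81 / 16) ^ n" by simp
    have 2: "cmod z ^ (n + 1) \<le> \<rho> ^ (n + 1)"
      using z by (intro power_mono) (auto simp: \<rho>_def)
    have "real (n + 2) ^ 4 * cmod z ^ (n + 1) \<le> (16 * (81 / 16) ^ n) * \<rho> ^ (n + 1)"
      by (intro mult_mono 1 2) auto
    also have "\<dots> = 16 * \<rho> * (81 / 16 * \<rho>) ^ n"
      by (simp only: power_mult_distrib power_add) simp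
    finally show ?thesis .
  qed
  have geo: "(\<lambda>n. 16 * \<rho> * (81 / 16 * \<rho>) ^ n) sums (16 * \<rho> * (1 / (1 - 81 / 16 * \<rho>)))"
    by (intro sums_mult geometric_sums) (simp add: \<rho>_def)
  have gb: "16 * \<rho> * (1 / (1 - 81 / 16 * \<rho>)) \<le> 3 / 40"
    by (simp add: \<rho>_def)
  have bound: "norm S \<le> 3 / 40 * c" if g: "g sums S" and le: "\<And>n. norm (g n) \<le> (real (n + 2) ^ 4 * cmod z ^ (n + 1)) * c"
      and "c \<ge> 0" for g :: "nat \<Rightarrow> 'x::banach" and S c
  proof -
    have s: "(\<lambda>n. (16 * \<rho> * (81 / 16 * \<rho>) ^ n) * c) sums ((16 * \<rho> * (1 / (1 - 81 / 16 * \<rho>))) * c)"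
      by (rule sums_mult2[OF geo])
    have le': "norm (g n) \<le> (16 * \<rho> * (81 / 16 * \<rho>) ^ n) * c" for n
      using le[of n] mult_right_mono[OF key[of n] \<open>c \<ge> 0\<close>] by linarith
    have "norm S \<le> (16 * \<rho> * (1 / (1 - 81 / 16 * \<rho>))) * c"
      using norm_suminf_le[of g, OF le' sums_summable[OF s]]
      unfolding sums_unique[OF g, symmetric] sums_unique[OF s, symmetric] .
    also have "\<dots> \<le> 3 / 40 * c"
      using gb \<open>c \<ge> 0\<close> by (rule mult_right_mono)
    finally show ?thesis .
  qed
  have pw: "real (n + 2) ^ 3 \<le> real (n + 2) ^ 4" for n
    by (rule power_increasing) auto
  show "cmod (f - z) \<le> 3 / 40 * cmod z"
  proof (rule bound[OF tail])
    fix n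
    have "cmod (of_real (b (n + 2)) * z ^ (n + 2)) = b (n + 2) * (cmod z ^ (n + 1) * cmod z)"
      using b(3)[of "n + 2"] by (simp add: norm_mult norm_power)
    also have "\<dots> \<le> real (n + 2) ^ 4 * (cmod z ^ (n + 1) * cmod z)"
      by (intro mult_right_mono order_trans[OF b(4) pw]) auto
    finally show "cmod (of_real (b (n + 2)) * z ^ (n + 2)) \<le> real (n + 2) ^ 4 * cmod z ^ (n + 1) * cmod z"
      by (simp add: mult_ac)
  qed simp
  have "norm (Im (f - z)) \<le> 3 / 40 * \<bar>Im z\<bar>"
  proof (rule bound[OF sums_Im[OF tail]])
    fix n
    have "norm (Im (of_real (b (n + 2)) * z ^ (n + 2))) = b (n + 2) * \<bar>Im (z ^ (n + 2))\<bar>"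
      using b(3)[of "n + 2"] by (simp add: abs_mult)
    also have "\<dots> \<le> real (n + 2) ^ 3 * (real (n + 2) * cmod z ^ (n + 1) * \<bar>Im z\<bar>)"
      using abs_Im_power_le[of z "n + 2"] b(3,4)[of "n + 2"] by (intro mult_mono) auto
    also have "\<dots> = real (n + 2) ^ 4 * cmod z ^ (n + 1) * \<bar>Im z\<bar>"
    proof -
      have "X ^ 4 = X ^ 3 * X" for X :: real
        by (simp add: power_numeral_reduce)
      then show ?thesis by (simp only: mult.assoc)
    qed
    finally show "norm (Im (of_real (b (n + 2)) * z ^ (n + 2))) \<le> real (n + 2) ^ 4 * cmod z ^ (n + 1) * \<bar>Im z\<bar>" .
  qed simp
  then show "\<bar>Im f - Im z\<bar> \<le> 3 / 40 * \<bar>Im z\<bar>" by simp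
qed

lemma divisor_sum_1: "divisor_sum c 1 = c 1"
  by (simp add: divisor_sum_def)

lemma lambert_estimates:
  assumes "cmod z \<le> 44 / 10000"
  shows "\<bar>Im (lambert real z) - Im z\<bar> \<le> 3 / 40 * \<bar>Im z\<bar>" "cmod (lambert real z - z) \<le> 3 / 40 * cmod z"
    and "\<bar>Im (dlambert real z) - Im z\<bar> \<le> 3 / 40 * \<bar>Im z\<bar>" "cmod (dlambert real z - z) \<le> 3 / 40 * cmod z"
proof -
  have z1: "cmod z < 1" using assms by simp
  have ds: "0 \<le> divisor_sum real n" "divisor_sum real n \<le> real n ^ 2" for n
    using divisor_sum_bounds[of real 1 n] by (auto simp: power2_eq_square)
  have p: "real n ^ 2 \<le> real n ^ 3" for n
    by (cases "n = 0") (auto intro!: power_increasing)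
  have l: "(\<lambda>n. of_real (divisor_sum real n) * z ^ n) sums lambert real z"
    by (rule sig.lambert_sums[OF z1])
  have d: "(\<lambda>n. of_real (real n * divisor_sum real n) * z ^ n) sums dlambert real z"
    using sig.dlambert_sums[OF z1] by simp
  have d1: "divisor_sum real 1 = 1" using divisor_sum_1[of real] by simp
  show "\<bar>Im (lambert real z) - Im z\<bar> \<le> 3 / 40 * \<bar>Im z\<bar>" "cmod (lambert real z - z) \<le> 3 / 40 * cmod z"
    using power_series_tail_estimates[OF l assms] ds p d1 by (meson divisor_sum_0 order_trans)+
  have "real n * divisor_sum real n \<le> real n ^ 3" for n
    using mult_left_mono[OF ds(2)[of n], of "real n"] by (simp add: power3_eq_cube power2_eq_square)
  then show "\<bar>Im (dlambert real z) - Im z\<bar> \<le> 3 / 40 * \<bar>Im z\<bar>" "cmod (dlambert real z - z) \<le> 3 / 40 * cmod z"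
    using power_series_tail_estimates[OF d assms] ds d1 by auto
qed

section \<open>Numerical bounds for exponentials and for 6/pi\<close>

lemma exp_power_decreasing:
  fixes y y0 :: real
  assumes "y0 \<le> y" "y0 > 0" "real j \<le> 2 * pi * y0"
  shows "exp (- 2 * pi * y) * y ^ j \<le> exp (- 2 * pi * y0) * y0 ^ j"
proof -
  define t where "t = y / y0 - 1"
  have t: "t \<ge> 0" "y = y0 * (1 + t)" using assms by (simp_all add: t_def field_simps)
  have "(1 + t) ^ j \<le> exp t ^ j" using t by (intro power_mono) auto
  also have "\<dots> = exp (real j * t)" by (simp add: exp_of_nat_mult)
  also have "\<dots> \<le> exp (2 * pi * y0 * t)"
    using assms(3) t by (simp add: mult_right_mono)
  finally have "(1 + t) ^ j * exp (- (2 * pi * y0 * t)) \<le> 1"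
    by (simp add: exp_minus field_simps)
  then have "(exp (- 2 * pi * y0) * y0 ^ j) * ((1 + t) ^ j * exp (- (2 * pi * y0 * t))) \<le> (exp (- 2 * pi * y0) * y0 ^ j) * 1"
    using assms by (intro mult_left_mono) auto
  moreover have "- 2 * pi * y = - 2 * pi * y0 + - (2 * pi * y0 * t)"
    by (simp add: t(2) algebra_simps)
  then have "exp (- 2 * pi * y) = exp (- 2 * pi * y0) * exp (- (2 * pi * y0 * t))"
    by (simp only: exp_add)
  ultimately show ?thesis
    unfolding t(2)[symmetric] by (simp add: t(2) power_mult_distrib mult_ac)
qed

lemma e_lower: "exp 1 \<ge> (2718281 / 1000000 :: real)"
  using e_approx_32 by (simp add: abs_if split: if_splits)

text \<open>The heights lie just below sqrt(3/4), sqrt(55/64) and sqrt(15/16), which bound Im \<tau>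
  from below in the modular triangle when Re \<tau> is at most 1/2, 3/8 and 1/4. Each exponential is
  split into an integer power of e and a short Taylor polynomial.\<close>

lemma exp_numerals:
  "exp (- 2 * pi * (866/1000)) \<le> 438 / 100000"
  "exp (- 2 * pi * (927/1000)) \<le> 302 / 100000"
  "exp (- 2 * pi * (968/1000)) \<le> 230 / 100000"
proof -
  have pi: "pi \<ge> 3.141592" using pi_approx(1) by simp
  have *: "exp (- a) \<le> c" if "exp b \<ge> 1 / c" "b \<le> a" "c > 0" for a b c :: real
  proof -
    have "1 / c \<le> exp a" using that by (meson exp_le_cancel_iff order_trans)
    then show ?thesis using that by (simp add: exp_minus field_simps)
  qed
  have e5: "exp 5 \<ge> (2718281 / 1000000 :: real) ^ 5"
    using power_mono[OF e_lower, of 5] exp_of_nat_mult[of 5 "1::real"] by simp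
  have e6: "exp 6 \<ge> (2718281 / 1000000 :: real) ^ 6"
    using power_mono[OF e_lower, of 6] exp_of_nat_mult[of 6 "1::real"] by simp
  have "exp (5.4412 :: real) = exp 5 * exp 0.4412" by (simp flip: exp_add)
  also have "\<dots> \<ge> (2718281 / 1000000) ^ 5 * (1 + 0.4412 + 0.4412 ^ 2 / 2)"
    using e5 exp_lower_Taylor_quadratic[of "0.4412"] by (intro mult_mono) auto
  finally have 1: "exp (5.4412 :: real) \<ge> 1 / (438 / 100000)"
    by (rule order_trans[rotated]) (simp add: power_numeral_reduce)
  show "exp (- 2 * pi * (866/1000)) \<le> 438 / 100000"
    using *[OF 1, of "2 * pi * (866/1000)"] pi by simp
  have "exp (5.8245 :: real) = exp 6 * exp (- 0.1755)" by (simp flip: exp_add)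
  also have "\<dots> \<ge> (2718281 / 1000000) ^ 6 * (1 + - 0.1755)"
    using e6 exp_ge_add_one_self[of "- 0.1755"] by (intro mult_mono) auto
  finally have 2: "exp (5.8245 :: real) \<ge> 1 / (302 / 100000)"
    by (rule order_trans[rotated]) (simp add: power_numeral_reduce)
  show "exp (- 2 * pi * (927/1000)) \<le> 302 / 100000"
    using *[OF 2, of "2 * pi * (927/1000)"] pi by simp
  have "exp (6.082 :: real) = exp 6 * exp 0.082" by (simp flip: exp_add)
  also have "\<dots> \<ge> (2718281 / 1000000) ^ 6 * (1 + 0.082)"
    using e6 exp_ge_add_one_self[of "0.082"] by (intro mult_mono) auto
  finally have 3: "exp (6.082 :: real) \<ge> 1 / (230 / 100000)"
    by (rule order_trans[rotated]) (simp add: power_numeral_reduce)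
  show "exp (- 2 * pi * (968/1000)) \<le> 230 / 100000"
    using *[OF 3, of "2 * pi * (968/1000)"] pi by simp
qed

lemma exp_power_bounds:
  fixes y :: real
  shows "y \<ge> 866/1000 \<Longrightarrow> exp (- 2 * pi * y) \<le> 44 / 10000"
    and "y \<ge> 866/1000 \<Longrightarrow> exp (- 2 * pi * y) * y ^ 2 \<le> 33 / 10000"
    and "y \<ge> 866/1000 \<Longrightarrow> exp (- 2 * pi * y) * y ^ 4 \<le> 247 / 100000"
    and "y \<ge> 927/1000 \<Longrightarrow> exp (- 2 * pi * y) * y ^ 4 \<le> 225 / 100000"
    and "y \<ge> 968/1000 \<Longrightarrow> exp (- 2 * pi * y) * y ^ 4 \<le> 203 / 100000"
proof -
  have pi: "pi \<ge> 3" using pi_gt3 by simp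
  have *: "exp (- 2 * pi * y) * y ^ j \<le> r * y0 ^ j" if "y \<ge> y0" "y0 \<ge> 866/1000" "j \<le> 4" "exp (- 2 * pi * y0) \<le> r" for y0 r j
  proof -
    have "real j \<le> 2 * 3 * (866/1000)" using that(3) by simp
    also have "\<dots> \<le> 2 * pi * y0" using pi that(2) by (intro mult_mono) auto
    finally have "exp (- 2 * pi * y) * y ^ j \<le> exp (- 2 * pi * y0) * y0 ^ j"
      using that by (intro exp_power_decreasing) auto
    also have "\<dots> \<le> r * y0 ^ j" using that by (intro mult_right_mono) auto
    finally show ?thesis .
  qed
  show "exp (- 2 * pi * y) \<le> 44 / 10000" if "y \<ge> 866/1000"
    using *[OF that _ _ exp_numerals(1), of 0] by simp
  show "exp (- 2 * pi * y) * y ^ 2 \<le> 33 / 10000" if "y \<ge> 866/1000"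
    by (rule order_trans[OF *[OF that _ _ exp_numerals(1), of 2]]) (simp_all add: power_numeral_reduce)
  show "exp (- 2 * pi * y) * y ^ 4 \<le> 247 / 100000" if "y \<ge> 866/1000"
    by (rule order_trans[OF *[OF that _ _ exp_numerals(1), of 4]]) (simp_all add: power_numeral_reduce)
  show "exp (- 2 * pi * y) * y ^ 4 \<le> 225 / 100000" if "y \<ge> 927/1000"
    by (rule order_trans[OF *[OF that _ _ exp_numerals(2), of 4]]) (simp_all add: power_numeral_reduce)
  show "exp (- 2 * pi * y) * y ^ 4 \<le> 203 / 100000" if "y \<ge> 968/1000"
    by (rule order_trans[OF *[OF that _ _ exp_numerals(3), of 4]]) (simp_all add: power_numeral_reduce)
qed

lemma kap_bounds: "kap ^ 2 \<ge> 36475 / 10000" "kap \<ge> 19098 / 10000" "kap \<le> 19099 / 10000"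
proof -
  have "pi > 0" by simp
  show 1: "kap \<ge> 19098 / 10000" and "kap \<le> 19099 / 10000"
    using pi_approx \<open>pi > 0\<close> by (auto simp: kap_def field_simps)
  have "kap \<ge> 190985 / 100000"
    using pi_approx \<open>pi > 0\<close> by (simp add: kap_def field_simps)
  from power_mono[OF this, of 2] show "kap ^ 2 \<ge> 36475 / 10000"
    by (simp add: power2_eq_square)
qed

text \<open>The real part of \<open>Psi 1 0 \<tau> * cnj \<tau>\<close>, with the two \<open>q\<close>-series controlled by their first terms.\<close>
lemma real_part_estimate:
  fixes x y IA ID RD :: real
  defines "e \<equiv> exp (- 2 * pi * y)" and "s \<equiv> sin (2 * pi * x)" and "c \<equiv> cos (2 * pi * x)"
  assumes x: "0 < x" "x \<le> 1" and y: "0 < y" "3 / 4 \<le> y ^ 2" "1 - x ^ 2 \<le> y ^ 2" "1 - (1 - x) ^ 2 \<le> y ^ 2"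
    and IA: "\<bar>IA - e * s\<bar> \<le> 3 / 40 * \<bar>e * s\<bar>" and ID: "\<bar>ID - e * s\<bar> \<le> 3 / 40 * \<bar>e * s\<bar>"
    and RD: "\<bar>RD - e * c\<bar> \<le> 3 / 40 * e"
  shows "kap ^ 2 * x + (x ^ 2 + y ^ 2) * (48 * kap * IA + 288 * (x * RD - y * ID)) > 0"
proof -
  have e: "e > 0" by (simp add: e_def)
  have y0: "y \<ge> 866 / 1000"
    by (rule power2_le_imp_le) (use y in \<open>auto simp: power2_eq_square\<close>)
  have n2: "x ^ 2 + y ^ 2 > 0" using x by (simp add: add_pos_nonneg)
  \<comment> \<open>The common end of the three cases with x <= 1/2: the leading part kap^2 x has to
    beat the q-terms, which are at most x \<beta> w r, and 3.6475 is a lower bound for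
    kap^2.\<close>
  have fin: ?thesis
    if w: "48 * kap * IA + 288 * (x * RD - y * ID) \<ge> - (e * (x * (w * y ^ 2)))" and "w \<ge> 0"
      and b: "x ^ 2 + y ^ 2 \<le> \<beta> * y ^ 2" and ey: "e * y ^ 4 \<le> r" and lt: "\<beta> * w * r < 36475 / 10000" for w \<beta> r
  proof -
    have \<beta>: "\<beta> \<ge> 0"
      using b n2 y(1) by (smt (verit) mult_nonneg_nonneg mult_neg_pos zero_less_power)
    have "(x ^ 2 + y ^ 2) * (e * (x * (w * y ^ 2))) \<le> (\<beta> * y ^ 2) * (e * (x * (w * y ^ 2)))"
      using b e x \<open>w \<ge> 0\<close> by (intro mult_right_mono) auto
    also have "\<dots> = x * (\<beta> * w * (e * y ^ 4))"
      by (simp add: power_numeral_reduce)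
    also have "\<dots> \<le> x * (\<beta> * w * r)"
      using ey x \<beta> \<open>w \<ge> 0\<close> by (intro mult_left_mono) auto
    also have "\<dots> < x * kap ^ 2"
      using lt kap_bounds(1) x by (intro mult_strict_left_mono) auto
    finally have "(x ^ 2 + y ^ 2) * (e * (x * (w * y ^ 2))) < kap ^ 2 * x" by (simp add: mult.commute)
    moreover have "(x ^ 2 + y ^ 2) * (48 * kap * IA + 288 * (x * RD - y * ID)) \<ge> (x ^ 2 + y ^ 2) * (- (e * (x * (w * y ^ 2))))"
      using w n2 by (intro mult_left_mono) auto
    ultimately show ?thesis by simp
  qed
  have comb: "p + r \<le> t * X" if "p \<le> a * X" "r \<le> r'" "r' \<le> b * X" "0 \<le> X" "a + b \<le> t" for p r r' a b t X :: real
    using that mult_right_mono[OF that(5,4)] by (simp add: distrib_right)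
  show ?thesis
  proof (cases "x \<le> 1 / 2")
    case True
    have s0: "s \<ge> 0"
      unfolding s_def using True x by (intro sin_ge_zero) auto
    have es: "e * s \<ge> 0" using e s0 by simp
    have IA': "IA \<ge> 37 / 40 * (e * s)" and ID': "ID \<le> 43 / 40 * (e * s)"
      using IA ID es by (auto simp: abs_if split: if_splits)
    have RD': "RD \<ge> e * c - 3 / 40 * e" using RD by (auto simp: abs_if split: if_splits)
    have "48 * kap * IA \<ge> 48 * (19098 / 10000) * (37 / 40 * (e * s))"
      using IA' kap_bounds(2) es by (intro mult_mono) auto
    moreover have "288 * (y * ID) \<le> 288 * (y * (43 / 40 * (e * s)))"
      using ID' y(1) by (intro mult_left_mono) auto
    moreover have "288 * (x * RD) \<ge> 288 * (x * (e * c - 3 / 40 * e))"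
      using RD' x by (intro mult_left_mono) auto
    ultimately have "48 * kap * IA + 288 * (x * RD - y * ID) \<ge>
        48 * (19098 / 10000) * (37 / 40 * (e * s)) + 288 * (x * (e * c - 3 / 40 * e)) - 288 * (y * (43 / 40 * (e * s)))"
      by (simp only: right_diff_distrib)
    \<comment> \<open>309.6 = 288 * 43/40 and 84.79512 = 48 * 1.9098 * 37/40.\<close>
    also have "48 * (19098 / 10000) * (37 / 40 * (e * s)) + 288 * (x * (e * c - 3 / 40 * e)) - 288 * (y * (43 / 40 * (e * s)))
        = - (e * ((309.6 * y - 84.79512) * s + 288 * x * (3 / 40 - c)))"
      by (simp add: algebra_simps)
    finally have lower: "48 * kap * IA + 288 * (x * RD - y * ID) \<ge>
        - (e * ((309.6 * y - 84.79512) * s + 288 * x * (3 / 40 - c)))" .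
    have lower': "48 * kap * IA + 288 * (x * RD - y * ID) \<ge> - (e * (x * (w * y ^ 2)))"
      if "(309.6 * y - 84.79512) * s + 288 * x * (3 / 40 - c) \<le> x * (w * y ^ 2)" for w
      using lower mult_left_mono[OF that, of e] e by linarith
    have pos: "309.6 * y - 84.79512 \<ge> 0" using y0 by simp
    \<comment> \<open>The bound for sin(2 pi x) by a multiple of x is 2 pi x, then 1 <= 4x, then
      pi(1 - 2x). It weakens as x decreases, while the least height y grows and makes up for
      it.\<close>
    consider "x \<le> 1 / 4" | "1 / 4 \<le> x" "x \<le> 3 / 8" | "3 / 8 \<le> x" by linarith
    then show ?thesis
    proof cases
      case 1
      have x2: "x ^ 2 \<le> (1 / 4) ^ 2" using 1 x by (intro power_mono) auto
      then have y2: "y ^ 2 \<ge> 15 / 16" using y(3) by (simp add: power2_eq_square)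
      have y1: "y \<ge> 968 / 1000"
        by (rule power2_le_imp_le) (use y2 y(1) in \<open>auto simp: power2_eq_square\<close>)
      have c0: "c \<ge> 0"
      proof -
        have "2 * pi * x \<ge> 0" "pi > 0" using x by auto
        then have "- (pi / 2) \<le> 2 * pi * x" by linarith
        then show ?thesis unfolding c_def using 1 by (intro cos_ge_zero) auto
      qed
      have "s \<le> 2 * pi * x"
        unfolding s_def using x by (intro sin_x_le_x) simp
      also have "\<dots> \<le> 6.2832 * x"
        using pi_approx(2) x by (intro mult_right_mono) auto
      finally have sx: "s \<le> 6.2832 * x" .
      \<comment> \<open>y^2 lies above its tangent at the least height 0.968, which reduces the
        quadratic inequality to a linear one; the next two cases do the same at their own
        heights.\<close>
      have "309.6 * y - 84.79512 \<le> 230 * y ^ 2"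
        using zero_le_power2[of "y - 968 / 1000"] y1 unfolding power2_diff by (simp add: power2_eq_square)
      then have "(309.6 * y - 84.79512) * s \<le> (230 * y ^ 2) * (6.2832 * x)"
        using sx s0 by (intro mult_mono) auto
      also have "\<dots> = 1445.136 * (x * y ^ 2)" by simp
      finally have h1: "(309.6 * y - 84.79512) * s \<le> 1445.136 * (x * y ^ 2)" .
      have h2: "288 * x * (3 / 40 - c) \<le> 288 * x * (3 / 40)"
        using c0 x by (intro mult_left_mono) auto
      have h3: "288 * x * (3 / 40) \<le> 24 * (x * y ^ 2)"
        using mult_left_mono[OF y2, of "24 * x"] x by simp
      have "(309.6 * y - 84.79512) * s + 288 * x * (3 / 40 - c) \<le> 1470 * (x * y ^ 2)"
        by (rule comb[OF h1 h2 h3]) (use x in auto)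
      then have "(309.6 * y - 84.79512) * s + 288 * x * (3 / 40 - c) \<le> x * (1470 * y ^ 2)"
        by (simp only: mult.left_commute)
      from fin[OF lower'[OF this], of "16 / 15" "203 / 100000"] show ?thesis
        using exp_power_bounds(5)[OF y1] x2 y2 by (simp add: e_def power2_eq_square)
    next
      case 2
      have x2: "x ^ 2 \<le> (3 / 8) ^ 2" using 2 x by (intro power_mono) auto
      then have y2: "y ^ 2 \<ge> 55 / 64" using y(3) by (simp add: power2_eq_square)
      have y1: "y \<ge> 927 / 1000"
        by (rule power2_le_imp_le) (use y2 y(1) in \<open>auto simp: power2_eq_square\<close>)
      have c0: "c \<ge> - 1" by (simp add: c_def)
      have "s \<le> 1" by (simp add: s_def)
      then have sx: "s \<le> 4 * x" using 2 by simp
      have "309.6 * y - 84.79512 \<le> 236 * y ^ 2"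
        using zero_le_power2[of "y - 927 / 1000"] y1 unfolding power2_diff by (simp add: power2_eq_square)
      then have "(309.6 * y - 84.79512) * s \<le> (236 * y ^ 2) * (4 * x)"
        using sx s0 by (intro mult_mono) auto
      also have "\<dots> = 944 * (x * y ^ 2)" by simp
      finally have h1: "(309.6 * y - 84.79512) * s \<le> 944 * (x * y ^ 2)" .
      have h2: "288 * x * (3 / 40 - c) \<le> 288 * x * (43 / 40)"
        using c0 x by (intro mult_left_mono) auto
      have h3: "288 * x * (43 / 40) \<le> 361 * (x * y ^ 2)"
        using mult_left_mono[OF y2, of "361 * x"] x by simp
      have "(309.6 * y - 84.79512) * s + 288 * x * (3 / 40 - c) \<le> 1305 * (x * y ^ 2)"
        by (rule comb[OF h1 h2 h3]) (use x in auto)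
      then have "(309.6 * y - 84.79512) * s + 288 * x * (3 / 40 - c) \<le> x * (1305 * y ^ 2)"
        by (simp only: mult.left_commute)
      from fin[OF lower'[OF this], of "64 / 55" "225 / 100000"] show ?thesis
        using exp_power_bounds(4)[OF y1] x2 y2 by (simp add: e_def power2_eq_square)
    next
      case 3
      have x2: "x ^ 2 \<le> (1 / 2) ^ 2" using True x by (intro power_mono) auto
      have c0: "c \<ge> - 1" by (simp add: c_def)
      have "s = sin (pi - 2 * pi * x)" by (simp add: s_def sin_pi_minus)
      also have "\<dots> \<le> pi - 2 * pi * x"
        using True by (intro sin_x_le_x) simp
      also have "\<dots> = pi * (1 - 2 * x)" by (simp add: algebra_simps)
      also have "\<dots> \<le> 3.1416 * (1 / 4)"
        using pi_approx(2) 3 True by (intro mult_mono) auto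
      finally have sx: "s \<le> 2.0944 * x" using 3 by simp
      have "309.6 * y - 84.79512 \<le> 245 * y ^ 2"
        using zero_le_power2[of "y - 866 / 1000"] y0 unfolding power2_diff by (simp add: power2_eq_square)
      then have "(309.6 * y - 84.79512) * s \<le> (245 * y ^ 2) * (2.0944 * x)"
        using sx s0 by (intro mult_mono) auto
      also have "\<dots> = 513.128 * (x * y ^ 2)" by simp
      finally have h1: "(309.6 * y - 84.79512) * s \<le> 513.128 * (x * y ^ 2)" .
      have h2: "288 * x * (3 / 40 - c) \<le> 288 * x * (43 / 40)"
        using c0 x by (intro mult_left_mono) auto
      have h3: "288 * x * (43 / 40) \<le> 413 * (x * y ^ 2)"
        using mult_left_mono[OF y(2), of "413 * x"] x by simp
      have "(309.6 * y - 84.79512) * s + 288 * x * (3 / 40 - c) \<le> 927 * (x * y ^ 2)"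
        by (rule comb[OF h1 h2 h3]) (use x in auto)
      then have "(309.6 * y - 84.79512) * s + 288 * x * (3 / 40 - c) \<le> x * (927 * y ^ 2)"
        by (simp only: mult.left_commute)
      from fin[OF lower'[OF this], of "4 / 3" "247 / 100000"] show ?thesis
        using exp_power_bounds(3)[OF y0] x2 y(2) by (simp add: e_def power2_eq_square)
    qed
  next
    case False
    \<comment> \<open>Beyond 1/2 the sine is not positive, so the term with \<open>ID\<close> helps.
      As x itself is now at least 1/2, crude bounds suffice.\<close>
    have "sin (2 * pi * x) = - sin (2 * pi * (1 - x))"
    proof -
      have "2 * pi * x = 2 * pi - 2 * pi * (1 - x)" by (simp add: algebra_simps)
      then show ?thesis by (simp only: sin_2pi_minus)
    qed
    moreover have "sin (2 * pi * (1 - x)) \<ge> 0"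
      using False x by (intro sin_ge_zero) auto
    ultimately have s0: "s \<le> 0" by (simp add: s_def)
    then have es: "e * s \<le> 0" using e by (simp add: mult_nonneg_nonpos)
    have "- 1 \<le> s" by (simp add: s_def)
    then have es1: "- e \<le> e * s" using e mult_left_mono[of "- 1" s e] by simp
    have IA': "IA \<ge> - (43 / 40 * e)" and ID': "ID \<le> 0"
      using IA ID es es1 by (auto simp: abs_if split: if_splits)
    have "e * c \<ge> - e" using e mult_left_mono[of "- 1" c e] by (simp add: c_def)
    then have RD': "RD \<ge> - (43 / 40 * e)" using RD by (auto simp: abs_if split: if_splits)
    have kpos: "kap > 0" using kap_bounds(2) by linarith
    have "kap * - (43 / 40 * e) \<le> kap * IA"
      using IA' kpos by (intro mult_left_mono) auto
    moreover have "kap * (43 / 40 * e) \<le> 19099 / 10000 * (43 / 40 * e)"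
      using kap_bounds(3) e by (intro mult_right_mono) auto
    moreover have "e \<le> 2 * (e * x)" using False e mult_left_mono[of 1 "2 * x" e] by simp
    moreover have "- (4.11 * X) \<le> p" if "- m \<le> p" "m \<le> 19099 / 10000 * (43 / 40 * e)" "e \<le> 2 * X" for m p X
      using that e by simp
    ultimately have h1: "- (4.11 * (e * x)) \<le> kap * IA" by (simp only: mult_minus_right)
    have h2: "y * ID \<le> 0" using ID' y(1) by (simp add: mult_nonneg_nonpos)
    have "x * - (43 / 40 * e) \<le> x * RD"
      using RD' x by (intro mult_left_mono) auto
    then have h3: "- (43 / 40 * (e * x)) \<le> x * RD" by (simp add: mult.commute mult.left_commute)
    have "48 * p + 288 * (r - d) \<ge> - (507 * X)"
      if "- (4.11 * X) \<le> p" "d \<le> 0" "- (43 / 40 * X) \<le> r" "X \<ge> 0" for p r d X :: real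
      using that by simp
    from this[OF h1 h2 h3] have lower: "48 * kap * IA + 288 * (x * RD - y * ID) \<ge> - (507 * (e * x))"
      using e x by (simp add: mult.assoc)
    have "x * x \<le> 1 * x" using x by (intro mult_right_mono) auto
    then have "x ^ 2 \<le> y ^ 2" using y(4) by (simp add: power2_eq_square algebra_simps)
    then have "(x ^ 2 + y ^ 2) * (507 * (e * x)) \<le> (2 * y ^ 2) * (507 * (e * x))"
      using e x by (intro mult_right_mono) auto
    also have "\<dots> = x * (1014 * (e * y ^ 2))" by simp
    also have "\<dots> \<le> x * (1014 * (33 / 10000))"
      using exp_power_bounds(2)[OF y0] x by (intro mult_left_mono) (auto simp: e_def)
    also have "\<dots> < x * kap ^ 2"
      using kap_bounds(1) x by (intro mult_strict_left_mono) auto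
    finally have "(x ^ 2 + y ^ 2) * (507 * (e * x)) < kap ^ 2 * x" by (simp add: mult.commute)
    moreover have "(x ^ 2 + y ^ 2) * (48 * kap * IA + 288 * (x * RD - y * ID)) \<ge> (x ^ 2 + y ^ 2) * (- (507 * (e * x)))"
      using lower n2 by (intro mult_left_mono) auto
    ultimately show ?thesis by simp
  qed
qed

subsection \<open>The fundamental domain of \<open>\<Gamma>\<^sub>0(2)\<close>\<close>

lemma imaginary_axis_values:
  assumes "Re \<tau> = 0" "Im \<tau> > 0"
  obtains p \<delta> :: real where "E2 \<tau> = of_real p" "DG \<tau> = of_real \<delta>" "\<delta> > 0"
proof -
  define t where "t = exp (- 2 * pi * Im \<tau>)"
  have t: "0 < t" "t < 1" using assms by (auto simp: t_def)
  have "2 * of_real pi * \<i> * \<tau> = of_real (- 2 * pi * Im \<tau>)"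
    using assms by (simp add: complex_eq_iff)
  then have nome: "nome \<tau> = of_real t"
    by (simp only: nome_def t_def exp_of_real)
  have t1: "cmod (of_real t) < 1" using t by simp
  have real: "L = of_real (Re L)" if "(\<lambda>n. of_real (b n)) sums L" for b :: "nat \<Rightarrow> real" and L :: complex
  proof -
    have "(\<lambda>n. 0) sums Im L" using sums_Im[OF that] by simp
    then have "Im L = 0" using sums_unique2 sums_zero by blast
    then show ?thesis by (simp add: complex_eq_iff)
  qed
  have l: "(\<lambda>n. of_real (divisor_sum real n * t ^ n)) sums lambert real (of_real t)"
    using sig.lambert_sums[OF t1] by simp
  have d: "(\<lambda>n. of_real (real n * divisor_sum real n * t ^ n)) sums dlambert real (of_real t)"
    using sig.dlambert_sums[OF t1] by simp
  obtain rl rd where r: "lambert real (of_real t) = of_real rl" "dlambert real (of_real t) = of_real rd"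
    using real[OF l] real[OF d] by blast
  have s1: "(\<lambda>n. real n * divisor_sum real n * t ^ n) sums rd"
    using sums_Re[OF d] by (simp add: r)
  have s2: "(\<lambda>n. if n = 1 then t else 0) sums t"
    using sums_single[of 1 "\<lambda>_. t"] by simp
  \<comment> \<open>All terms are nonnegative, so the sum is at least its first term q > 0.\<close>
  have le: "(if n = 1 then t else 0) \<le> real n * divisor_sum real n * t ^ n" for n
    using sig.coeff_bounds(1)[of n] t divisor_sum_1[of real] by auto
  have "t \<le> rd" by (rule sums_le[OF le s2 s1])
  then show ?thesis
    using that[of "1 - 24 * rl" rd] t by (simp add: E2_def DG_def nome r)
qed

text \<open>u = 0 leaves \<open>DG\<close>; otherwise u = 1 by homogeneity. For w \<noteq> 0 the
  vanishing of the imaginary part expresses \<open>E2\<close> through \<open>DG\<close>, and the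
  real part becomes kap^2 + 288 \<delta> (w^2 + y^2) > 0. For w = 0 the imaginary part carries no
  information, and inversion leads back to \<open>DG\<close>.\<close>

lemma Psi_imaginary_axis:
  fixes u v :: real
  assumes "Re \<tau> = 0" "Im \<tau> > 0" "(u, v) \<noteq> (0, 0)"
  shows "Psi (of_real u) (of_real v) \<tau> \<noteq> 0"
proof -
  have D: "DG \<sigma> \<noteq> 0" if "Re \<sigma> = 0" "Im \<sigma> > 0" for \<sigma>
    using imaginary_axis_values[OF that] by (metis of_real_eq_0_iff less_irrefl)
  have base: "Psi 1 (of_real w) \<tau> \<noteq> 0" for w :: real
  proof (cases "w = 0")
    case True
    define \<sigma> where "\<sigma> = - 1 / \<tau>"
    have \<sigma>: "Im \<sigma> > 0" "Re \<sigma> = 0"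
      using assms Im_inversion_pos[of \<tau>] by (simp_all add: \<sigma>_def Re_divide)
    have "\<tau> = - 1 / \<sigma>" by (simp add: \<sigma>_def)
    then have "Psi 1 0 \<tau> = \<sigma> ^ 2 * Psi 0 (- 1) \<sigma>"
      using Psi_inversion[OF \<sigma>(1), of 1 0] by simp
    moreover have "\<sigma> \<noteq> 0" using \<sigma> by auto
    ultimately show ?thesis using D[OF \<sigma>(2,1)] True by (simp add: Psi_def)
  next
    case False
    obtain p \<delta> :: real where E: "E2 \<tau> = of_real p" "DG \<tau> = of_real \<delta>" "\<delta> > 0"
      using imaginary_axis_values[OF assms(1,2)] by blast
    define y where "y = Im \<tau>"
    have \<tau>: "\<tau> = Complex 0 y" using assms by (simp add: y_def complex_eq_iff)
    have s: "\<tau> + of_real w = Complex w y" by (simp add: \<tau> complex_eq_iff)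
    have Re: "Re (Psi 1 (of_real w) \<tau>) = kap ^ 2 - 2 * kap * p * y + 288 * \<delta> * (w ^ 2 - y ^ 2)"
      and Im: "Im (Psi 1 (of_real w) \<tau>) = 2 * w * (kap * p + 288 * \<delta> * y)"
      unfolding Psi_def E mult_1_left s
      by (simp_all add: Re_power2 Im_power2 power2_eq_square algebra_simps)
    show ?thesis
    proof
      assume 0: "Psi 1 (of_real w) \<tau> = 0"
      then have "2 * w * (kap * p + 288 * \<delta> * y) = 0" using Im by (metis zero_complex.sel(2))
      then have kp: "kap * p = - 288 * \<delta> * y" using False by simp
      have "kap ^ 2 - 2 * kap * p * y + 288 * \<delta> * (w ^ 2 - y ^ 2) = 0" using Re 0 by simp
      moreover have "2 * kap * p * y = 2 * (kap * p) * y" by simp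
      ultimately have "kap ^ 2 + 288 * \<delta> * (w ^ 2 + y ^ 2) = 0"
        unfolding kp by (simp add: algebra_simps power2_eq_square)
      moreover have "kap ^ 2 > 0" using kap_bounds(1) by linarith
      moreover have "288 * \<delta> * (w ^ 2 + y ^ 2) \<ge> 0" using E(3) by simp
      ultimately show False by linarith
    qed
  qed
  show ?thesis
  proof (cases "u = 0")
    case True
    then show ?thesis using D[OF assms(1,2)] assms(3) by (simp add: Psi_def)
  next
    case False
    then have "Psi (of_real u) (of_real v) \<tau> = of_real u ^ 2 * Psi 1 (of_real (v / u)) \<tau>"
      using Psi_scale[of "of_real u" 1 "of_real (v / u)" \<tau>] by simp
    then show ?thesis using base[of "v / u"] False by simp
  qed
qed

text \<open>The rotation of order 3 of the ideal triangle \<open>F\<^sub>0\<close>; it permutes the cusps \<open>0, 1, \<infinity>\<close>.\<close>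
definition rot :: "complex \<Rightarrow> complex" where
  "rot \<tau> = 1 / (1 - \<tau>)"

lemma mem_F0_iff: "\<tau> \<in> F0 \<longleftrightarrow> Im \<tau> > 0 \<and> 0 \<le> Re \<tau> \<and> Re \<tau> \<le> 1 \<and> Re \<tau> \<le> Re \<tau> ^ 2 + Im \<tau> ^ 2"
proof -
  have "cmod (\<tau> - 1/2) \<ge> 1/2 \<longleftrightarrow> (1/2) ^ 2 \<le> cmod (\<tau> - 1/2) ^ 2"
    by (metis abs_le_square_iff abs_norm_cancel abs_of_nonneg divide_nonneg_nonneg zero_le_numeral zero_le_one)
  also have "\<dots> \<longleftrightarrow> Re \<tau> \<le> Re \<tau> ^ 2 + Im \<tau> ^ 2"
    unfolding cmod_power2 by (simp add: power2_eq_square algebra_simps)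
  finally show ?thesis by (auto simp: F0_def upper_half_plane_def)
qed

lemma rot_Re_Im:
  "Re (rot \<tau>) = (1 - Re \<tau>) / cmod (1 - \<tau>) ^ 2" "Im (rot \<tau>) = Im \<tau> / cmod (1 - \<tau>) ^ 2"
  by (simp_all add: rot_def Re_divide Im_divide cmod_power2)

lemma rot_rot: "\<tau> \<noteq> 0 \<Longrightarrow> \<tau> \<noteq> 1 \<Longrightarrow> rot (rot \<tau>) = (\<tau> - 1) / \<tau>"
  by (simp add: rot_def divide_simps)

lemma rot_rot_rot: "Im \<tau> > 0 \<Longrightarrow> rot (rot (rot \<tau>)) = \<tau>"
proof -
  assume "Im \<tau> > 0"
  then have "\<tau> \<noteq> 0" "\<tau> \<noteq> 1" by auto
  then show ?thesis by (simp add: rot_rot) (simp add: rot_def divide_simps)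
qed

lemma rot_rot_Im:
  assumes "Im \<tau> > 0"
  shows "Im (rot (rot \<tau>)) = Im \<tau> / cmod \<tau> ^ 2" "Re (rot (rot \<tau>)) = 1 - Re \<tau> / cmod \<tau> ^ 2"
proof -
  have nz: "\<tau> \<noteq> 0" "\<tau> \<noteq> 1" using assms by auto
  have "rot (rot \<tau>) = 1 - 1 / \<tau>" using nz by (simp add: rot_rot diff_divide_distrib)
  then show "Im (rot (rot \<tau>)) = Im \<tau> / cmod \<tau> ^ 2" "Re (rot (rot \<tau>)) = 1 - Re \<tau> / cmod \<tau> ^ 2"
    by (simp_all add: Re_divide Im_divide cmod_power2)
qed

lemma rot_in_F0:
  assumes "\<tau> \<in> F0"
  shows "rot \<tau> \<in> F0"
proof -
  have t: "Im \<tau> > 0" "0 \<le> Re \<tau>" "Re \<tau> \<le> 1" "Re \<tau> \<le> Re \<tau> ^ 2 + Im \<tau> ^ 2"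
    using assms by (auto simp: mem_F0_iff)
  define N where "N = cmod (1 - \<tau>) ^ 2"
  have N: "N = (1 - Re \<tau>) ^ 2 + Im \<tau> ^ 2" by (simp add: N_def cmod_power2)
  have N0: "N > 0" using t by (simp add: N add_nonneg_pos)
  have "((1 - Re \<tau>) / N) ^ 2 + (Im \<tau> / N) ^ 2 = N / N ^ 2"
    by (simp add: power_divide N add_divide_distrib)
  also have "\<dots> = 1 / N" using N0 by (simp add: power2_eq_square)
  finally have e: "((1 - Re \<tau>) / N) ^ 2 + (Im \<tau> / N) ^ 2 = 1 / N" .
  show ?thesis
    unfolding mem_F0_iff rot_Re_Im N_def[symmetric] e
  proof (intro conjI)
    show "(1 - Re \<tau>) / N \<le> 1"
      using N0 t(4) by (simp add: N power2_eq_square algebra_simps)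
    show "(1 - Re \<tau>) / N \<le> 1 / N"
      using N0 t by (intro divide_right_mono) auto
  qed (use N0 t in auto)
qed

lemma modular_domain_subset_F0: "modular_domain \<subseteq> F0"
proof
  fix \<tau> assume \<tau>: "\<tau> \<in> modular_domain"
  then have "1 \<le> cmod \<tau> ^ 2" by (simp add: modular_domain_def)
  then show "\<tau> \<in> F0"
    using \<tau> unfolding mem_F0_iff by (auto simp: modular_domain_def cmod_power2)
qed

text \<open>Take the highest of the three rotates of \<tau>. The rotations divide the height of a
  point \<sigma> by |1 - \<sigma>|^2 and |\<sigma>|^2, so maximality means that both moduli are at
  least 1.\<close>

lemma F0_cases:
  assumes "\<tau> \<in> F0"
  obtains \<sigma> where "\<sigma> \<in> modular_domain" "\<tau> = \<sigma> \<or> \<tau> = rot \<sigma> \<or> \<tau> = rot (rot \<sigma>)"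
proof -
  have mem: "\<sigma> \<in> modular_domain" if "\<sigma> \<in> F0" "Im (rot \<sigma>) \<le> Im \<sigma>" "Im (rot (rot \<sigma>)) \<le> Im \<sigma>" for \<sigma>
  proof -
    have s: "Im \<sigma> > 0" "0 \<le> Re \<sigma>" "Re \<sigma> \<le> 1" using that(1) by (auto simp: mem_F0_iff)
    have *: "1 \<le> n" if "n \<ge> 0" "Im \<sigma> / n ^ 2 \<le> Im \<sigma>" "n \<noteq> 0" for n :: real
    proof -
      have "Im \<sigma> * 1 \<le> Im \<sigma> * n ^ 2" using that by (simp add: field_simps)
      then have "1 ^ 2 \<le> n ^ 2" using s by simp
      then show ?thesis using that(1) power2_le_imp_le by blast
    qed
    have "\<sigma> \<noteq> 0" "1 - \<sigma> \<noteq> 0" using s by auto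
    then have "1 \<le> cmod \<sigma>" "1 \<le> cmod (1 - \<sigma>)"
      using *[of "cmod \<sigma>"] *[of "cmod (1 - \<sigma>)"] that(2,3) rot_rot_Im[OF s(1)] by (auto simp: rot_Re_Im)
    then show ?thesis using s by (simp add: modular_domain_def norm_minus_commute)
  qed
  have F: "rot \<tau> \<in> F0" "rot (rot \<tau>) \<in> F0" using assms rot_in_F0 by auto
  have Im: "Im \<tau> > 0" using assms by (simp add: mem_F0_iff)
  note r3 = rot_rot_rot[OF Im]
  consider "Im (rot \<tau>) \<le> Im \<tau>" "Im (rot (rot \<tau>)) \<le> Im \<tau>"
    | "Im (rot (rot \<tau>)) \<le> Im (rot \<tau>)" "Im \<tau> \<le> Im (rot \<tau>)"
    | "Im \<tau> \<le> Im (rot (rot \<tau>))" "Im (rot \<tau>) \<le> Im (rot (rot \<tau>))"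
    by linarith
  then show ?thesis
  proof cases
    case 1
    then show ?thesis using that mem[OF assms] by blast
  next
    case 2
    then have "rot \<tau> \<in> modular_domain" using mem[OF F(1)] r3 by simp
    then show ?thesis using that[of "rot \<tau>"] r3 by simp
  next
    case 3
    then have "rot (rot \<tau>) \<in> modular_domain" using mem[OF F(2)] r3 by simp
    then show ?thesis using that[of "rot (rot \<tau>)"] r3 by simp
  qed
qed

lemma Psi_rot:
  assumes "Im \<tau> > 0"
  shows "Psi u v (rot \<tau>) = (1 - \<tau>) ^ 2 * Psi (- v) (u + v) \<tau>"
  using Psi_transformation[of 0 1 1 "- 1" \<tau> u v] assms by (simp add: rot_def)

lemma Psi_rot_eq_0_iff:
  assumes "Im \<tau> > 0"
  shows "Psi u v (rot \<tau>) = 0 \<longleftrightarrow> Psi (- v) (u + v) \<tau> = 0"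
proof -
  have "1 - \<tau> \<noteq> 0" using assms by auto
  then show ?thesis by (simp add: Psi_rot[OF assms])
qed

lemma Psi_minus: "Psi (- u) (- v) \<tau> = Psi u v \<tau>"
  using Psi_scale[of "- 1" u v \<tau>] by simp

section \<open>Nonvanishing of \<open>Psi 1 0\<close>, \<open>Psi 1 (- 1)\<close> and
  \<open>Psi 0 1\<close>\<close>

lemma nome_Re_Im:
  "Re (nome \<tau>) = exp (- 2 * pi * Im \<tau>) * cos (2 * pi * Re \<tau>)"
  "Im (nome \<tau>) = exp (- 2 * pi * Im \<tau>) * sin (2 * pi * Re \<tau>)"
  by (simp_all add: nome_def Re_exp Im_exp)

text \<open>Multiplication by \<open>cnj \<tau>\<close> makes the dominant term 2 i kap |\<tau>|^2
  purely imaginary; what is left of the real part is kap^2 Re \<tau> up to q-terms. On the imaginary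
  axis this real part vanishes, and \<open>Psi_imaginary_axis\<close> takes over.\<close>

lemma Psi_1_0_nonzero:
  assumes "\<tau> \<in> modular_domain"
  shows "Psi 1 0 \<tau> \<noteq> 0"
proof (cases "Re \<tau> = 0")
  case True
  then show ?thesis
    using Psi_imaginary_axis[of \<tau> 1 0] assms by (simp add: modular_domain_def)
next
  case False
  define x y where "x = Re \<tau>" and "y = Im \<tau>"
  have x: "0 < x" "x \<le> 1" using assms False by (auto simp: modular_domain_def x_def)
  note y = modular_domain_Im[OF assms, folded x_def y_def]
  have y0: "y \<ge> 866 / 1000"
    by (rule power2_le_imp_le) (use y in \<open>auto simp: power2_eq_square\<close>)
  have small: "cmod (nome \<tau>) \<le> 44 / 10000"
    using exp_power_bounds(1)[OF y0] by (simp add: norm_nome y_def)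
  define A D where "A = lambert real (nome \<tau>)" and "D = dlambert real (nome \<tau>)"
  have "0 < kap ^ 2 * x + (x ^ 2 + y ^ 2) * (48 * kap * Im A + 288 * (x * Re D - y * Im D))"
  proof (rule real_part_estimate[OF x y(2,1,3,4)])
    show "\<bar>Im A - exp (- 2 * pi * y) * sin (2 * pi * x)\<bar> \<le> 3 / 40 * \<bar>exp (- 2 * pi * y) * sin (2 * pi * x)\<bar>"
      "\<bar>Im D - exp (- 2 * pi * y) * sin (2 * pi * x)\<bar> \<le> 3 / 40 * \<bar>exp (- 2 * pi * y) * sin (2 * pi * x)\<bar>"
      using lambert_estimates(1,3)[OF small] by (simp_all add: A_def D_def nome_Re_Im x_def y_def)
    have "\<bar>Re D - Re (nome \<tau>)\<bar> \<le> cmod (D - nome \<tau>)"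
      using abs_Re_le_cmod[of "D - nome \<tau>"] by simp
    also have "\<dots> \<le> 3 / 40 * cmod (nome \<tau>)"
      using lambert_estimates(4)[OF small] by (simp add: D_def)
    finally show "\<bar>Re D - exp (- 2 * pi * y) * cos (2 * pi * x)\<bar> \<le> 3 / 40 * exp (- 2 * pi * y)"
      by (simp add: nome_Re_Im norm_nome x_def y_def)
  qed
  also have "\<dots> = Re (Psi 1 0 \<tau> * cnj \<tau>)"
  proof -
    have "Psi 1 0 \<tau> * cnj \<tau> = of_real (kap ^ 2) * cnj \<tau> + (\<tau> * cnj \<tau>) * (2 * \<i> * of_real kap * (1 - 24 * A) + 288 * D * \<tau>)"
      by (simp add: Psi_def E2_def DG_def A_def D_def algebra_simps power2_eq_square)
    also have "\<tau> * cnj \<tau> = of_real (x ^ 2 + y ^ 2)"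
      by (simp add: complex_mult_cnj x_def y_def)
    also have "Re (of_real (kap ^ 2) * cnj \<tau> + of_real (x ^ 2 + y ^ 2) * (2 * \<i> * of_real kap * (1 - 24 * A) + 288 * D * \<tau>)) =
        kap ^ 2 * x + (x ^ 2 + y ^ 2) * (48 * kap * Im A + 288 * (x * Re D - y * Im D))"
      unfolding plus_complex.sel Re_complex_of_real[symmetric] by (simp add: x_def y_def algebra_simps)
    finally show ?thesis by simp
  qed
  finally show ?thesis by auto
qed

text \<open>The reflection of \<open>F0\<close> in the line Re \<tau> = 1/2 exchanges the cusps 0
  and 1 and with them the parameters C = 0 and C = 1. The q-series have real coefficients, so it
  acts on values by conjugation.\<close>

lemma Psi_reflection:
  assumes "Im \<tau> > 0"
  shows "Psi 1 (- 1) (1 - cnj \<tau>) = cnj (Psi 1 0 \<tau>)"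
proof -
  have "nome (1 - cnj \<tau>) = nome (- cnj \<tau>)"
    using nome_add_1[of "- cnj \<tau>"] by (simp add: algebra_simps)
  also have "\<dots> = cnj (nome \<tau>)"
    by (simp add: nome_def exp_cnj)
  finally have nome: "nome (1 - cnj \<tau>) = cnj (nome \<tau>)" .
  have 1: "cmod (nome \<tau>) < 1" "cmod (cnj (nome \<tau>)) < 1"
    using norm_nome_less_1[OF assms] by simp_all
  have "(\<lambda>n. of_real (divisor_sum real n) * cnj (nome \<tau>) ^ n) sums cnj (lambert real (nome \<tau>))"
    using sig.lambert_sums[OF 1(1)] by (subst (asm) sums_cnj[symmetric]) simp
  then have A: "lambert real (cnj (nome \<tau>)) = cnj (lambert real (nome \<tau>))"
    using sig.lambert_sums[OF 1(2)] sums_unique2 by blast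
  have "(\<lambda>n. of_nat n * of_real (divisor_sum real n) * cnj (nome \<tau>) ^ n) sums cnj (dlambert real (nome \<tau>))"
    using sig.dlambert_sums[OF 1(1)] by (subst (asm) sums_cnj[symmetric]) simp
  then have D: "dlambert real (cnj (nome \<tau>)) = cnj (dlambert real (nome \<tau>))"
    using sig.dlambert_sums[OF 1(2)] sums_unique2 by blast
  show ?thesis
    by (simp add: Psi_def E2_def DG_def nome A D power2_eq_square)
qed

lemma Psi_1_minus_1_nonzero:
  assumes "\<tau> \<in> modular_domain"
  shows "Psi 1 (- 1) \<tau> \<noteq> 0"
proof -
  have "1 - cnj \<tau> \<in> modular_domain"
  proof -
    have "cmod (1 - cnj \<tau>) = cmod (\<tau> - 1)"
      by (metis complex_cnj_diff complex_cnj_one complex_mod_cnj norm_minus_commute)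
    then show ?thesis using assms by (auto simp: modular_domain_def)
  qed
  then have "Psi 1 0 (1 - cnj \<tau>) \<noteq> 0" "Im (1 - cnj \<tau>) > 0"
    using Psi_1_0_nonzero by (auto simp: modular_domain_def)
  then show ?thesis
    using Psi_reflection[of "1 - cnj \<tau>"] by simp
qed

lemma nome_small:
  assumes "Im \<tau> \<ge> 866 / 1000"
  shows "cmod (nome \<tau>) \<le> 44 / 10000"
  using exp_power_bounds(1)[OF assms] by (simp add: norm_nome)

lemma DG_nonzero_on_modular_domain:
  assumes "\<tau> \<in> modular_domain"
  shows "DG \<tau> \<noteq> 0"
proof
  assume "DG \<tau> = 0"
  have "Im \<tau> \<ge> 866 / 1000"
    by (rule power2_le_imp_le) (use modular_domain_Im[OF assms] in \<open>auto simp: power2_eq_square\<close>)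
  from lambert_estimates(4)[OF nome_small[OF this]] \<open>DG \<tau> = 0\<close>
  have "cmod (nome \<tau>) \<le> 3 / 40 * cmod (nome \<tau>)" by (simp add: DG_def)
  moreover have "cmod (nome \<tau>) > 0" by (simp add: nome_nonzero)
  ultimately show False by linarith
qed

lemma Psi_0_1: "Psi 0 1 \<tau> = 288 * DG \<tau>"
  by (simp add: Psi_def)

lemma modular_domain_Im_pos: "\<tau> \<in> modular_domain \<Longrightarrow> Im \<tau> > 0"
  by (simp add: modular_domain_def)

lemma F0_Im_pos: "\<tau> \<in> F0 \<Longrightarrow> Im \<tau> > 0"
  by (simp add: mem_F0_iff)

lemma rot_Im_pos: "Im \<tau> > 0 \<Longrightarrow> Im (rot \<tau>) > 0"
  by (auto simp: rot_Re_Im intro!: divide_pos_pos)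

text \<open>The rotations take (u, v) = (0, 1) to (-1, 1) and (-1, 0), so on the two lower pieces of
  \<open>F0\<close> the claim is the nonvanishing of \<open>Psi 1 (- 1)\<close> and
  \<open>Psi 1 0\<close> on the modular triangle.\<close>

lemma DG_nonzero_on_F0:
  assumes "\<tau> \<in> F0"
  shows "DG \<tau> \<noteq> 0"
proof -
  obtain \<sigma> where \<sigma>: "\<sigma> \<in> modular_domain" "\<tau> = \<sigma> \<or> \<tau> = rot \<sigma> \<or> \<tau> = rot (rot \<sigma>)"
    using F0_cases[OF assms] by blast
  note s = modular_domain_Im_pos[OF \<sigma>(1)]
  have "Psi 0 1 \<tau> \<noteq> 0"
    using \<sigma>(2)
  proof (elim disjE)
    assume "\<tau> = \<sigma>"
    then show ?thesis using DG_nonzero_on_modular_domain[OF \<sigma>(1)] by (simp add: Psi_0_1)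
  next
    assume "\<tau> = rot \<sigma>"
    then show ?thesis
      using Psi_1_minus_1_nonzero[OF \<sigma>(1)] Psi_minus[of 1 "- 1" \<sigma>] by (simp add: Psi_rot_eq_0_iff[OF s])
  next
    assume "\<tau> = rot (rot \<sigma>)"
    then show ?thesis
      using Psi_1_0_nonzero[OF \<sigma>(1)] Psi_minus[of 1 0 \<sigma>]
      by (simp add: Psi_rot_eq_0_iff[OF s] Psi_rot_eq_0_iff[OF rot_Im_pos[OF s]])
  qed
  then show ?thesis by (simp add: Psi_0_1)
qed

text \<open>The other two sides are carried to the imaginary axis by the translation and the
  rotation, and real (u, v) stay real and nonzero.\<close>

lemma Psi_nonzero_on_boundary:
  fixes u v :: real
  assumes "\<tau> \<in> F0" "(u, v) \<noteq> (0, 0)" and b: "Re \<tau> = 0 \<or> Re \<tau> = 1 \<or> Re \<tau> = Re \<tau> ^ 2 + Im \<tau> ^ 2"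
  shows "Psi (of_real u) (of_real v) \<tau> \<noteq> 0"
  using b
proof (elim disjE)
  assume "Re \<tau> = 0"
  then show ?thesis using Psi_imaginary_axis[of \<tau> u v] F0_Im_pos assms by blast
next
  assume "Re \<tau> = 1"
  then have "Psi (of_real u) (of_real (u + v)) (\<tau> - 1) \<noteq> 0"
    by (intro Psi_imaginary_axis) (use F0_Im_pos assms in auto)
  then show ?thesis
    using Psi_add_1[of "of_real u" "of_real v" "\<tau> - 1"] by simp
next
  assume c: "Re \<tau> = Re \<tau> ^ 2 + Im \<tau> ^ 2"
  note t = F0_Im_pos[OF assms(1)]
  define \<sigma> where "\<sigma> = rot (rot \<tau>)"
  have \<sigma>: "Im \<sigma> > 0" "\<tau> = rot \<sigma>"
    using rot_rot_rot[OF t] t by (auto simp: \<sigma>_def rot_Im_pos)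
  have "cmod \<tau> ^ 2 \<noteq> 0" using t by auto
  then have "Re \<sigma> = 0"
    using rot_rot_Im(2)[OF t] c by (simp add: \<sigma>_def cmod_power2)
  then have "Psi (of_real (- v)) (of_real (u + v)) \<sigma> \<noteq> 0"
    by (intro Psi_imaginary_axis) (use \<sigma> assms(2) in auto)
  then show ?thesis
    unfolding \<sigma>(2) by (simp add: Psi_rot_eq_0_iff[OF \<sigma>(1)])
qed

section \<open>Keeping zeros away from the cusps\<close>

lemma E2_DG_estimates:
  assumes "Im \<tau> \<ge> 1"
  shows "cmod (E2 \<tau> - 1) \<le> 12 / 100" "cmod (DG \<tau> - nome \<tau>) \<le> 3 / 40 * cmod (nome \<tau>)"
proof -
  have small: "cmod (nome \<tau>) \<le> 44 / 10000"
    using assms by (intro nome_small) simp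
  have "cmod (lambert real (nome \<tau>)) \<le> cmod (lambert real (nome \<tau>) - nome \<tau>) + cmod (nome \<tau>)"
    using norm_triangle_ineq[of "lambert real (nome \<tau>) - nome \<tau>" "nome \<tau>"] by simp
  then show "cmod (E2 \<tau> - 1) \<le> 12 / 100"
    using lambert_estimates(2)[OF small] small by (simp add: E2_def norm_mult)
  show "cmod (DG \<tau> - nome \<tau>) \<le> 3 / 40 * cmod (nome \<tau>)"
    using lambert_estimates(4)[OF small] by (simp add: DG_def)
qed

lemma exp_le_inverse_square:
  fixes y :: real
  assumes "y > 0"
  shows "exp (- 2 * pi * y) \<le> 1 / y ^ 2"
proof -
  have "2 * y \<le> 2 * pi * y" using pi_gt3 assms by (intro mult_right_mono) auto
  then have "exp (2 * y) \<le> exp (2 * pi * y)" by simp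
  moreover have "1 + 2 * y + (2 * y) ^ 2 / 2 \<le> exp (2 * y)"
    using assms by (intro exp_lower_Taylor_quadratic) auto
  moreover have "(2 * y) ^ 2 / 2 = 2 * y ^ 2" by (simp add: power2_eq_square)
  ultimately have "y ^ 2 \<le> exp (2 * pi * y)"
    using assms zero_le_power2[of y] by linarith
  then have "1 / exp (2 * pi * y) \<le> 1 / y ^ 2"
    using assms by (intro divide_left_mono) auto
  then show ?thesis by (simp add: exp_minus inverse_eq_divide)
qed

text \<open>High up, the term linear in s = \<tau> + v dominates: kap^2 is constant, and
  \<open>DG\<close> decays faster than s^2 grows. The factor 310 rounds up 288 * 43/40, so that the
  quadratic term is at most |s|.\<close>

lemma Psi_nonzero_near_cusp:
  fixes v B :: real
  assumes "\<bar>v\<bar> \<le> B" "0 \<le> Re \<tau>" "Re \<tau> \<le> 1" and Y: "Im \<tau> \<ge> 310 * (2 + B)"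
  shows "Psi 1 (of_real v) \<tau> \<noteq> 0"
proof
  assume 0: "Psi 1 (of_real v) \<tau> = 0"
  define y where "y = Im \<tau>"
  define s where "s = \<tau> + of_real v"
  have B: "B \<ge> 0" using assms(1) by linarith
  have y: "y \<ge> 310 * (2 + B)" "y \<ge> 4" "y \<ge> 1" using Y B by (auto simp: y_def)
  have "y = Im s" by (simp add: s_def y_def)
  then have ys: "y \<le> cmod s" using abs_Im_le_cmod[of s] by linarith
  have "cmod s \<le> \<bar>Re s\<bar> + \<bar>Im s\<bar>" by (rule cmod_le)
  also have "\<dots> \<le> (1 + B) + y" using assms y by (auto simp: s_def y_def)
  also have "\<dots> \<le> (2 + B) * y"
    using mult_left_mono[OF y(3), of "1 + B"] B by (simp add: algebra_simps)
  finally have s_le: "cmod s \<le> (2 + B) * y" .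
  have s0: "cmod s > 0" using ys y by linarith
  have est: "cmod (E2 \<tau> - 1) \<le> 12 / 100" "cmod (DG \<tau> - nome \<tau>) \<le> 3 / 40 * cmod (nome \<tau>)"
    using E2_DG_estimates[of \<tau>] y by (auto simp: y_def)
  have E: "88 / 100 \<le> cmod (E2 \<tau>)"
    using norm_triangle_ineq2[of 1 "1 - E2 \<tau>"] est(1) by (simp add: norm_minus_commute)
  have D: "cmod (DG \<tau>) \<le> 43 / 40 * (1 / y ^ 2)"
  proof -
    have "cmod (DG \<tau>) \<le> cmod (DG \<tau> - nome \<tau>) + cmod (nome \<tau>)"
      using norm_triangle_ineq[of "DG \<tau> - nome \<tau>" "nome \<tau>"] by simp
    also have "\<dots> \<le> 43 / 40 * cmod (nome \<tau>)" using est(2) by simp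
    also have "cmod (nome \<tau>) \<le> 1 / y ^ 2"
      using exp_le_inverse_square[of y] y by (simp add: norm_nome y_def)
    finally show ?thesis by simp
  qed
  have "2 * \<i> * of_real kap * s * E2 \<tau> = - (of_real kap ^ 2 + 288 * DG \<tau> * s ^ 2)"
    using 0 unfolding Psi_def s_def by (simp add: eq_neg_iff_add_eq_0 algebra_simps)
  then have "cmod (2 * \<i> * of_real kap * s * E2 \<tau>) = cmod (of_real kap ^ 2 + 288 * DG \<tau> * s ^ 2)"
    by (metis norm_minus_cancel)
  also have "\<dots> \<le> kap ^ 2 + 288 * cmod (DG \<tau>) * cmod s ^ 2"
    using norm_triangle_ineq[of "of_real kap ^ 2" "288 * DG \<tau> * s ^ 2"] by (simp add: norm_mult norm_power)
  finally have "2 * kap * cmod s * cmod (E2 \<tau>) \<le> kap ^ 2 + 288 * cmod (DG \<tau>) * cmod s ^ 2"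
    using kap_bounds(2) by (simp add: norm_mult)
  moreover have "2 * kap * cmod s * (88 / 100) \<le> 2 * kap * cmod s * cmod (E2 \<tau>)"
    using E kap_bounds(2) by (intro mult_left_mono) auto
  moreover have "2 * (19098 / 10000) * cmod s * (88 / 100) \<le> 2 * kap * cmod s * (88 / 100)"
    using kap_bounds(2) by (intro mult_right_mono) auto
  moreover have "kap ^ 2 \<le> cmod s"
  proof -
    have "kap ^ 2 \<le> (19099 / 10000) ^ 2" using kap_bounds by (intro power_mono) auto
    then show ?thesis using ys y(2) by (simp add: power2_eq_square)
  qed
  moreover have "288 * cmod (DG \<tau>) * cmod s ^ 2 \<le> cmod s"
  proof -
    have "288 * cmod (DG \<tau>) * cmod s \<le> 288 * (43 / 40 * (1 / y ^ 2)) * ((2 + B) * y)"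
      using D s_le y B by (intro mult_mono) auto
    also have "\<dots> = 309.6 * (2 + B) / y"
      using y by (simp add: power2_eq_square)
    also have "\<dots> \<le> 1"
      using y B by (simp add: divide_le_eq)
    finally have "288 * cmod (DG \<tau>) * cmod s * cmod s \<le> 1 * cmod s"
      by (rule mult_right_mono) simp
    then show ?thesis by (simp add: power2_eq_square)
  qed
  ultimately show False using s0 by linarith
qed

text \<open>A low point of \<open>F0\<close> is close to 0 or 1. For Re \<tau> <= 1/2 the circle
  condition gives |\<tau>|^2 <= 2 (Im \<tau>)^2, so the rotate that sends 0 to infinity has height
  at least 1 / (2 Im \<tau>); the other half is similar with 1 - \<tau>.\<close>

lemma F0_near_real_axis:
  assumes "\<tau> \<in> F0" "Y > 0" "Im \<tau> \<le> 1 / (2 * Y)"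
  shows "Im (rot \<tau>) \<ge> Y \<or> Im (rot (rot \<tau>)) \<ge> Y"
proof -
  have t: "Im \<tau> > 0" "0 \<le> Re \<tau>" "Re \<tau> \<le> 1" "Re \<tau> \<le> Re \<tau> ^ 2 + Im \<tau> ^ 2"
    using assms by (auto simp: mem_F0_iff)
  have *: "Y \<le> Im \<tau> / n" if "n \<le> 2 * Im \<tau> ^ 2" "n > 0" for n
  proof -
    have "Y * n \<le> Y * (2 * Im \<tau> ^ 2)" using that assms by (intro mult_left_mono) auto
    also have "\<dots> = (Im \<tau> * (2 * Y)) * Im \<tau>" by (simp add: power2_eq_square)
    also have "\<dots> \<le> 1 * Im \<tau>"
      using assms t by (intro mult_right_mono) (simp_all add: field_simps)
    finally show ?thesis using that by (simp add: field_simps)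
  qed
  show ?thesis
  proof (cases "Re \<tau> \<le> 1 / 2")
    case True
    have "Re \<tau> * Re \<tau> \<le> 1 / 2 * Re \<tau>" using True t by (intro mult_right_mono) auto
    then have "cmod \<tau> ^ 2 \<le> 2 * Im \<tau> ^ 2"
      unfolding cmod_power2 using t(4) by (simp add: power2_eq_square)
    moreover have "cmod \<tau> ^ 2 > 0" using t by auto
    ultimately show ?thesis using * rot_rot_Im[OF t(1)] by simp
  next
    case False
    have "(1 - Re \<tau>) * (1 - Re \<tau>) \<le> 1 / 2 * (1 - Re \<tau>)" using False t by (intro mult_right_mono) auto
    then have "cmod (1 - \<tau>) ^ 2 \<le> 2 * Im \<tau> ^ 2"
      unfolding cmod_power2 using t(4) by (simp add: power2_eq_square algebra_simps)
    moreover have "cmod (1 - \<tau>) ^ 2 > 0" using t by auto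
    ultimately show ?thesis using * by (simp add: rot_Re_Im)
  qed
qed

text \<open>On the parameter the rotation acts by C to 1 - 1/C, which permutes the ranges C > 1, 0 <
  C < 1 and C < 0 cyclically.\<close>

lemma Psi_rot_real_zero_iff:
  fixes C :: real
  assumes "Im \<tau> > 0" "C \<noteq> 0"
  shows "Psi 1 (- of_real C) (rot \<tau>) = 0 \<longleftrightarrow> Psi 1 (- of_real (1 - 1 / C)) \<tau> = 0"
proof -
  have "Psi (of_real C) (1 - of_real C) \<tau> = of_real C ^ 2 * Psi 1 (- of_real (1 - 1 / C)) \<tau>"
  proof -
    have "of_real C * - of_real (1 - 1 / C) = (1 - of_real C :: complex)"
      using assms(2) by (simp add: right_diff_distrib)
    then show ?thesis
      using Psi_scale[of "of_real C" 1 "- of_real (1 - 1 / C)" \<tau>] by simp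
  qed
  then show ?thesis
    using assms by (simp add: Psi_rot_eq_0_iff)
qed

text \<open>When the cusps 0 and 1 are rotated to infinity, the parameters become 1 - 1/C and -1/(C
  - 1). Both stay bounded for all C >= c, which is how c > 1 enters; uniformity up to infinity is
  what \<open>zero_Im_large\<close> builds on.\<close>

lemma zero_Im_lower_bound:
  fixes c :: real
  assumes "c > 1"
  obtains \<delta> where "\<delta> > 0" "\<And>C \<tau>. C \<ge> c \<Longrightarrow> \<tau> \<in> F0 \<Longrightarrow> Psi 1 (- of_real C) \<tau> = 0 \<Longrightarrow> Im \<tau> > \<delta>"
proof
  define B where "B = max 1 (1 / (c - 1))"
  define Y where "Y = 310 * (2 + B)"
  have B: "B \<ge> 1" "B \<ge> 1 / (c - 1)" by (auto simp: B_def)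
  have Y: "Y > 0" using B by (simp add: Y_def)
  show "1 / (2 * Y) > 0" using Y by simp
  fix C \<tau> assume C: "C \<ge> c" and \<tau>: "\<tau> \<in> F0" and 0: "Psi 1 (- of_real C) \<tau> = 0"
  have C0: "C \<noteq> 0" "1 - 1 / C \<noteq> 0" "C > 1" using C assms by (auto simp: field_simps)
  note t = F0_Im_pos[OF \<tau>]
  have F: "rot \<tau> \<in> F0" "rot (rot \<tau>) \<in> F0" using \<tau> rot_in_F0 by auto
  have r3: "rot (rot (rot \<tau>)) = \<tau>" by (rule rot_rot_rot[OF t])
  have 1: "Psi 1 (- of_real (1 - 1 / C)) (rot (rot \<tau>)) = 0"
    using Psi_rot_real_zero_iff[OF F0_Im_pos[OF F(2)] C0(1)] r3 0 by simp
  have 2: "Psi 1 (- of_real (1 - 1 / (1 - 1 / C))) (rot \<tau>) = 0"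
    using Psi_rot_real_zero_iff[OF F0_Im_pos[OF F(1)] C0(2)] 1 by simp
  have "0 < 1 / C" "1 / C \<le> 1" using C0 by auto
  then have b1: "\<bar>- (1 - 1 / C)\<bar> \<le> B" using B(1) by linarith
  have "- (1 - 1 / (1 - 1 / C)) = 1 / (C - 1)" using C0 by (simp add: field_simps)
  moreover have "1 / (C - 1) \<le> 1 / (c - 1)" using C assms by (intro divide_left_mono) auto
  ultimately have b2: "\<bar>- (1 - 1 / (1 - 1 / C))\<bar> \<le> B" using B(2) C0 by simp
  have "Im (rot (rot \<tau>)) < Y" "Im (rot \<tau>) < Y"
    using Psi_nonzero_near_cusp[OF b1, of "rot (rot \<tau>)"] Psi_nonzero_near_cusp[OF b2, of "rot \<tau>"] 1 2 F
    unfolding Y_def mem_F0_iff of_real_minus by (auto simp: not_le[symmetric])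
  then show "Im \<tau> > 1 / (2 * Y)"
    using F0_near_real_axis[OF \<tau> Y] by linarith
qed

subsection \<open>Existence and uniqueness of the zero\<close>

abbreviation UHP :: "complex set" where "UHP \<equiv> {\<tau>. Im \<tau> > 0}"

lemma connected_UHP: "connected UHP"
  by (intro convex_connected convex_halfspace_Im_gt)

lemma holomorphic_nome [holomorphic_intros]: "nome holomorphic_on A"
  unfolding nome_def[abs_def] by (intro holomorphic_intros)

lemma holomorphic_E2: "E2 holomorphic_on UHP"
  using E2_has_derivative
  by (auto simp: holomorphic_on_def field_differentiable_def intro: has_field_derivative_at_within)

lemma holomorphic_DG: "DG holomorphic_on UHP"
proof -
  have "dlambert real \<circ> nome holomorphic_on UHP"
    by (rule holomorphic_on_compose_gen[OF holomorphic_nome sig.holomorphic_dlambert])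
       (auto simp: norm_nome_less_1)
  then show ?thesis by (simp add: DG_def[abs_def] o_def)
qed

lemmas continuous_E2 = holomorphic_on_imp_continuous_on[OF holomorphic_E2]
lemmas continuous_DG = holomorphic_on_imp_continuous_on[OF holomorphic_DG]
lemmas continuous_nome = holomorphic_on_imp_continuous_on[OF holomorphic_nome[of UHP]]

lemma holomorphic_Psi: "Psi u v holomorphic_on UHP"
  unfolding Psi_def[abs_def] by (intro holomorphic_intros holomorphic_E2 holomorphic_DG)

lemma continuous_snd_comp:
  assumes "continuous_on UHP g"
  shows "continuous_on (T \<times> UHP) (\<lambda>p. g (snd p))"
  by (rule continuous_on_compose2[OF assms]) (auto intro: continuous_intros)

lemma compact_F0_truncated:
  assumes "\<delta> > 0"
  shows "compact {\<tau> \<in> F0. \<delta> \<le> Im \<tau> \<and> Im \<tau> \<le> Y}" (is "compact ?K")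
proof -
  have "?K = {\<tau>. \<delta> \<le> Im \<tau>} \<inter> {\<tau>. Im \<tau> \<le> Y} \<inter> {\<tau>. 0 \<le> Re \<tau>} \<inter> {\<tau>. Re \<tau> \<le> 1} \<inter> {\<tau>. Re \<tau> \<le> Re \<tau> ^ 2 + Im \<tau> ^ 2}"
    using assms by (auto simp: mem_F0_iff)
  then have "closed ?K"
    by (auto intro!: closed_Int closed_Collect_le continuous_intros)
  moreover have "?K \<subseteq> cball 0 (1 + \<bar>Y\<bar>)"
  proof
    fix \<tau> assume "\<tau> \<in> ?K"
    then have "\<bar>Re \<tau>\<bar> \<le> 1" "\<bar>Im \<tau>\<bar> \<le> \<bar>Y\<bar>" using assms by (auto simp: mem_F0_iff)
    then show "\<tau> \<in> cball 0 (1 + \<bar>Y\<bar>)"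
      using cmod_le[of \<tau>] by simp
  qed
  ultimately show ?thesis
    by (meson bounded_cball bounded_subset compact_eq_bounded_closed)
qed

text \<open>On a compact truncation |DG| is bounded below and |E2| above, so for large C the term
  quadratic in \<tau> - C outweighs the others. Zeros below the truncation are excluded uniformly in
  C.\<close>

lemma zero_Im_large:
  fixes Y :: real
  obtains C1 where "C1 > 1" "\<And>C \<tau>. C \<ge> C1 \<Longrightarrow> \<tau> \<in> F0 \<Longrightarrow> Psi 1 (- of_real C) \<tau> = 0 \<Longrightarrow> Im \<tau> > Y"
proof -
  have "(2::real) > 1" by simp
  then obtain \<delta> where \<delta>: "\<delta> > 0" "\<And>C \<tau>. C \<ge> 2 \<Longrightarrow> \<tau> \<in> F0 \<Longrightarrow> Psi 1 (- of_real C) \<tau> = 0 \<Longrightarrow> Im \<tau> > \<delta>"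
    using zero_Im_lower_bound by blast
  define K where "K = {\<tau> \<in> F0. \<delta> \<le> Im \<tau> \<and> Im \<tau> \<le> Y}"
  have K: "compact K" "K \<subseteq> UHP"
    using compact_F0_truncated[OF \<delta>(1)] by (auto simp: K_def mem_F0_iff)
  show ?thesis
  proof (cases "K = {}")
    case True
    show ?thesis
    proof (rule that[of 2])
      fix C \<tau> assume "C \<ge> 2" "\<tau> \<in> F0" "Psi 1 (- of_real C) \<tau> = 0"
      then have "Im \<tau> > \<delta>" "\<tau> \<in> F0" using \<delta> by auto
      then show "Im \<tau> > Y" using True unfolding K_def by fastforce
    qed simp
  next
    case False
    have "continuous_on K (\<lambda>\<tau>. cmod (DG \<tau>))"
      by (intro continuous_intros continuous_on_subset[OF continuous_DG K(2)])
    then obtain \<tau>1 where \<tau>1: "\<tau>1 \<in> K" "\<And>\<tau>. \<tau> \<in> K \<Longrightarrow> cmod (DG \<tau>1) \<le> cmod (DG \<tau>)"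
      using continuous_attains_inf[OF K(1) False] by blast
    have "continuous_on K (\<lambda>\<tau>. cmod (E2 \<tau>))"
      by (intro continuous_intros continuous_on_subset[OF continuous_E2 K(2)])
    then obtain \<tau>2 where \<tau>2: "\<tau>2 \<in> K" "\<And>\<tau>. \<tau> \<in> K \<Longrightarrow> cmod (E2 \<tau>) \<le> cmod (E2 \<tau>2)"
      using continuous_attains_sup[OF K(1) False] by blast
    define m M where "m = cmod (DG \<tau>1)" and "M = cmod (E2 \<tau>2)"
    have m: "m > 0" using DG_nonzero_on_F0[of \<tau>1] \<tau>1(1) by (simp add: m_def K_def)
    have M: "M \<ge> 0" by (simp add: M_def)
    have k: "kap > 0" using kap_bounds(2) by linarith
    \<comment> \<open>A zero in \<open>K\<close> forces |s| <= L, whereas C >= 3 + L gives |s| >= 2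
      + L.\<close>
    define L where "L = (kap ^ 2 + 2 * kap * M) / (288 * m)"
    have L: "L \<ge> 0" using m M k by (simp add: L_def)
    show ?thesis
    proof (rule that[of "3 + L"])
      show "3 + L > 1" using L by simp
      fix C \<tau> assume C: "C \<ge> 3 + L" and \<tau>: "\<tau> \<in> F0" and 0: "Psi 1 (- of_real C) \<tau> = 0"
      show "Im \<tau> > Y"
      proof (rule ccontr)
        assume "\<not> Im \<tau> > Y"
        moreover have "Im \<tau> > \<delta>" by (rule \<delta>(2)[of C]) (use C L \<tau> 0 in auto)
        ultimately have K\<tau>: "\<tau> \<in> K" using \<tau> by (simp add: K_def)
        define s where "s = \<tau> - of_real C"
        have "Re s \<le> - (2 + L)" using \<tau> C by (simp add: s_def mem_F0_iff)
        then have s: "cmod s \<ge> 2 + L" using abs_Re_le_cmod[of s] by linarith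
        have "288 * DG \<tau> * s ^ 2 = - (of_real kap ^ 2 + 2 * \<i> * of_real kap * s * E2 \<tau>)"
          using 0 unfolding Psi_def s_def by (simp add: eq_neg_iff_add_eq_0 algebra_simps)
        then have "cmod (288 * DG \<tau> * s ^ 2) = cmod (of_real kap ^ 2 + 2 * \<i> * of_real kap * s * E2 \<tau>)"
          by (metis norm_minus_cancel)
        also have "\<dots> \<le> kap ^ 2 + 2 * kap * cmod s * cmod (E2 \<tau>)"
          using norm_triangle_ineq[of "of_real kap ^ 2" "2 * \<i> * of_real kap * s * E2 \<tau>"] k
          by (simp add: norm_mult norm_power)
        also have "\<dots> \<le> kap ^ 2 * cmod s + 2 * kap * cmod s * M"
        proof (intro add_mono mult_left_mono)
          show "kap ^ 2 \<le> kap ^ 2 * cmod s"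
            using s L mult_left_mono[of 1 "cmod s" "kap ^ 2"] by simp
        qed (use \<tau>2(2)[OF K\<tau>] k in \<open>auto simp: M_def\<close>)
        also have "\<dots> = (kap ^ 2 + 2 * kap * M) * cmod s" by (simp add: algebra_simps)
        finally have "(288 * cmod (DG \<tau>) * cmod s) * cmod s \<le> (kap ^ 2 + 2 * kap * M) * cmod s"
          by (simp add: norm_mult norm_power power2_eq_square mult_ac)
        then have "288 * cmod (DG \<tau>) * cmod s \<le> kap ^ 2 + 2 * kap * M"
          using s L by (subst (asm) mult_le_cancel_right_pos) auto
        moreover have "288 * m * cmod s \<le> 288 * cmod (DG \<tau>) * cmod s"
          using \<tau>1(2)[OF K\<tau>] by (intro mult_right_mono mult_left_mono) (auto simp: m_def)
        ultimately have "288 * m * cmod s \<le> kap ^ 2 + 2 * kap * M" by linarith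
        then have "cmod s \<le> L" using m by (simp add: L_def field_simps)
        then show False using s by linarith
      qed
    qed
  qed
qed

text \<open>The linear homotopy from \<open>Psi 1 (- C)\<close> (at \<open>t = 1\<close>) to its leading part for large \<open>C\<close> (at \<open>t = 0\<close>).\<close>
definition strip_homotopy :: "real \<Rightarrow> real \<Rightarrow> complex \<Rightarrow> complex" where
  "strip_homotopy C t \<tau> = 288 * (nome \<tau> + of_real t * (DG \<tau> - nome \<tau>)) * (of_real C - of_real t * \<tau>) ^ 2
     - 2 * \<i> * of_real kap * (of_real C - of_real t * \<tau>) * (1 + of_real t * (E2 \<tau> - 1)) + of_real t * of_real kap ^ 2"

lemma strip_homotopy_1: "strip_homotopy C 1 = Psi 1 (- of_real C)"
  by (rule ext) (simp add: strip_homotopy_def Psi_def algebra_simps power2_eq_square)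

text \<open>Division by 2 kap Z, with Z = C - t\<tau>, turns the equation into G = i(1 + \<nu>),
  where G is close to (144/kap) q Z and |\<nu>| <= 0.13. This fails on the vertical sides by the
  argument of G, on the bottom because |q Z| is too large and at the top because it is too small.
  The 101 in the bound on C makes |Z| >= 100, hence the last part of \<nu> at most 1/100.\<close>

lemma strip_homotopy_zero:
  assumes C: "C \<ge> 101 + exp (2 * pi)" and t: "0 \<le> t" "t \<le> 1"
    and \<tau>: "0 \<le> Re \<tau>" "Re \<tau> \<le> 1" "1 \<le> Im \<tau>" and 0: "strip_homotopy C t \<tau> = 0"
  shows "0 < Re \<tau>" "Re \<tau> < 1" "1 < Im \<tau>" "Im \<tau> < 100 * (C + 2)"
proof -
  define Z q w \<epsilon> where "Z = of_real C - of_real t * \<tau>" and "q = nome \<tau>"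
    and "w = of_real t * (DG \<tau> - nome \<tau>)" and "\<epsilon> = of_real t * (E2 \<tau> - 1)"
  define e where "e = exp (- 2 * pi * Im \<tau>)"
  have qe: "cmod q = e" by (simp add: q_def e_def norm_nome)
  have e0: "e > 0" by (simp add: e_def)
  have k: "kap > 0" using kap_bounds(2) by linarith
  have C1: "C \<ge> 101" using C exp_gt_zero[of "2 * pi"] by linarith
  have tx: "t * Re \<tau> \<le> 1" using t \<tau> by (simp add: mult_le_one)
  have ReZ: "Re Z \<ge> C - 1" using tx by (simp add: Z_def)
  then have Zge: "cmod Z \<ge> C - 1" using complex_Re_le_cmod[of Z] by linarith
  then have Z0: "Z \<noteq> 0" "cmod Z > 0" using C1 by auto
  have ImZ: "Im Z \<le> 0" using t \<tau> by (simp add: Z_def)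
  have w: "cmod w \<le> 3 / 40 * e"
  proof -
    have "cmod w = t * cmod (DG \<tau> - nome \<tau>)" using t by (simp add: w_def norm_mult)
    also have "\<dots> \<le> 1 * cmod (DG \<tau> - nome \<tau>)" using t by (intro mult_right_mono) auto
    also have "\<dots> \<le> 3 / 40 * e" using E2_DG_estimates(2)[OF \<tau>(3)] qe by (simp add: q_def)
    finally show ?thesis .
  qed
  have \<epsilon>: "cmod \<epsilon> \<le> 12 / 100"
  proof -
    have "cmod \<epsilon> = t * cmod (E2 \<tau> - 1)" using t by (simp add: \<epsilon>_def norm_mult)
    also have "\<dots> \<le> 1 * cmod (E2 \<tau> - 1)" using t by (intro mult_right_mono) auto
    finally show ?thesis using E2_DG_estimates(1)[OF \<tau>(3)] by simp
  qed
  define \<nu> where "\<nu> = \<epsilon> + \<i> * of_real t * of_real kap / (2 * Z)"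
  have \<nu>: "cmod \<nu> \<le> 13 / 100"
  proof -
    have "cmod (\<i> * of_real t * of_real kap / (2 * Z)) = t * kap / (2 * cmod Z)"
      using t k by (simp add: norm_mult norm_divide)
    also have "\<dots> \<le> 1 * 2 / (2 * 100)"
      using t k kap_bounds(3) Zge C1 by (intro frac_le mult_mono) auto
    finally have "cmod (\<i> * of_real t * of_real kap / (2 * Z)) \<le> 1 / 100" by simp
    then show ?thesis
      unfolding \<nu>_def using \<epsilon> norm_triangle_ineq[of \<epsilon> "\<i> * of_real t * of_real kap / (2 * Z)"] by linarith
  qed
  define G where "G = of_real (144 / kap) * ((q + w) * Z)"
  have "288 * (q + w) * Z ^ 2 - 2 * \<i> * of_real kap * Z * (1 + \<epsilon>) + of_real t * of_real kap ^ 2 = 0"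
    using 0 by (simp add: strip_homotopy_def Z_def q_def w_def \<epsilon>_def)
  moreover have "288 * (q + w) * Z ^ 2 - 2 * \<i> * of_real kap * Z * (1 + \<epsilon>) + of_real t * of_real kap ^ 2
      = 2 * of_real kap * Z * (G - \<i> * (1 + \<nu>))"
    using k Z0 by (simp add: G_def \<nu>_def field_simps power2_eq_square)
  ultimately have G: "G = \<i> * (1 + \<nu>)" using k Z0 by simp
  have ImG: "Im G \<ge> 87 / 100"
    using \<nu> abs_Re_le_cmod[of \<nu>] by (simp add: G)
  have G_le: "cmod G \<le> 113 / 100" and G_ge: "cmod G \<ge> 87 / 100"
    using \<nu> norm_triangle_ineq[of 1 \<nu>] ImG abs_Im_le_cmod[of G] by (auto simp: G norm_mult)
  define p where "p = 144 / kap * (e * cmod Z)"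
  have p0: "p \<ge> 0" using k e0 by (simp add: p_def)
  have normG: "cmod G = 144 / kap * (cmod (q + w) * cmod Z)"
    using k by (simp add: G_def norm_mult norm_divide)
  have "cmod (q + w) \<ge> 37 / 40 * e"
    using norm_triangle_ineq2[of q "- w"] w qe by simp
  then have "144 / kap * ((37 / 40 * e) * cmod Z) \<le> cmod G"
    unfolding normG using k by (intro mult_left_mono mult_right_mono) auto
  moreover have "144 / kap * ((37 / 40 * e) * cmod Z) = 37 / 40 * p" by (simp add: p_def)
  ultimately have p_le: "p \<le> 123 / 100" using G_le by linarith
  have "cmod (q + w) \<le> 43 / 40 * e"
    using norm_triangle_ineq[of q w] w qe by simp
  then have "cmod G \<le> 144 / kap * ((43 / 40 * e) * cmod Z)"
    unfolding normG using k by (intro mult_left_mono mult_right_mono) auto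
  moreover have "144 / kap * ((43 / 40 * e) * cmod Z) = 43 / 40 * p" by (simp add: p_def)
  ultimately have p_ge: "p \<ge> 80 / 100" using G_ge by linarith
  \<comment> \<open>On the vertical sides q is positive and Im Z <= 0, so only the small error
    \<open>w\<close> could make Im G positive.\<close>
  have not_edge: False if "q = of_real e"
  proof -
    have "Im G = 144 / kap * (e * Im Z + Im (w * Z))"
      by (simp add: G_def that algebra_simps add_divide_distrib)
    also have "\<dots> \<le> 144 / kap * (0 + 3 / 40 * e * cmod Z)"
    proof (intro mult_left_mono add_mono)
      show "e * Im Z \<le> 0" using e0 ImZ by (simp add: mult_nonneg_nonpos)
      have "Im (w * Z) \<le> cmod (w * Z)" using abs_Im_le_cmod[of "w * Z"] by linarith
      also have "\<dots> \<le> 3 / 40 * e * cmod Z"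
        using w by (simp only: norm_mult) (rule mult_right_mono, auto)
      finally show "Im (w * Z) \<le> 3 / 40 * e * cmod Z" .
    qed (use k in simp)
    also have "\<dots> = 3 / 40 * p" by (simp add: p_def)
    finally show False using ImG p_le by linarith
  qed
  have "Re \<tau> \<noteq> 0" "Re \<tau> \<noteq> 1"
    using not_edge by (auto simp: q_def e_def complex_eq_iff nome_Re_Im)
  then show "0 < Re \<tau>" "Re \<tau> < 1" using \<tau> by auto
  have k1: "144 / kap \<ge> 75" "144 / kap \<le> 76"
    using kap_bounds k by (auto simp: field_simps)
  \<comment> \<open>The summand exp(2 pi) in the bound on C serves here: |Z| compensates |q| =
    exp(-2 pi).\<close>
  have "Im \<tau> \<noteq> 1"
  proof
    assume "Im \<tau> = 1"
    then have "e = exp (- (2 * pi))" by (simp add: e_def)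
    moreover have "cmod Z \<ge> exp (2 * pi)" using Zge C by linarith
    ultimately have "e * cmod Z \<ge> exp (- (2 * pi)) * exp (2 * pi)"
      by (simp add: mult_left_mono)
    then have "e * cmod Z \<ge> 1" by (simp add: exp_minus)
    then have "75 * 1 \<le> p" unfolding p_def using k1 k by (intro mult_mono) auto
    then show False using p_le by simp
  qed
  then show "1 < Im \<tau>" using \<tau> by simp
  show "Im \<tau> < 100 * (C + 2)"
  proof (rule ccontr)
    assume "\<not> Im \<tau> < 100 * (C + 2)"
    then have y: "Im \<tau> \<ge> 100 * (C + 2)" by simp
    define y where "y = Im \<tau>"
    have y1: "y \<ge> 1" using \<tau> by (simp add: y_def)
    have "cmod Z \<le> cmod (of_real C) + cmod (of_real t * \<tau>)"
      unfolding Z_def by (rule norm_triangle_ineq4)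
    also have "\<dots> \<le> C + (1 + y)"
    proof (intro add_mono)
      have "cmod (of_real t * \<tau>) \<le> 1 * cmod \<tau>"
        unfolding norm_mult using t by (intro mult_right_mono) auto
      also have "\<dots> \<le> 1 + y" using cmod_le[of \<tau>] \<tau> by (simp add: y_def)
      finally show "cmod (of_real t * \<tau>) \<le> 1 + y" .
    qed (use C1 in auto)
    also have "\<dots> \<le> (C + 2) * y"
      using mult_left_mono[OF y1, of "C + 1"] C1 by (simp add: algebra_simps)
    finally have Zle: "cmod Z \<le> (C + 2) * y" .
    have "e * cmod Z \<le> (1 / y ^ 2) * ((C + 2) * y)"
      using exp_le_inverse_square[of y] y1 Zle e0 by (intro mult_mono) (auto simp: e_def y_def)
    also have "\<dots> = (C + 2) / y" using y1 by (simp add: power2_eq_square)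
    also have "\<dots> \<le> 1 / 100" using y y1 by (simp add: y_def field_simps)
    finally have "p \<le> 76 * (1 / 100)"
      unfolding p_def using k1 e0 k by (intro mult_mono) auto
    then show False using p_ge by simp
  qed
qed

lemma nome_has_derivative: "(nome has_field_derivative 2 * of_real pi * \<i> * nome \<tau>) (at \<tau>)"
  unfolding nome_def[abs_def] by (auto intro!: derivative_eq_intros)

lemma nome_eq_imp:
  assumes "nome \<tau> = nome \<sigma>"
  obtains n :: int where "\<tau> = \<sigma> + of_int n"
proof -
  obtain n :: int where "2 * of_real pi * \<i> * \<tau> = 2 * of_real pi * \<i> * \<sigma> + of_real (real_of_int (2 * n) * pi) * \<i>"
    using assms unfolding nome_def exp_eq by blast
  then have "2 * of_real pi * \<i> * \<tau> = 2 * of_real pi * \<i> * (\<sigma> + of_int n)"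
    by (simp add: algebra_simps)
  then have "\<tau> = \<sigma> + of_int n" by simp
  then show ?thesis using that by blast
qed

text \<open>At t = 0 the equation is q = i kap / (144 C). Real part 1/4 gives q the direction of i,
  and the modulus determines the height \<open>y0\<close>; all other solutions differ by integers
  and leave the strip.\<close>

lemma strip_homotopy_0_unique:
  assumes C: "C \<ge> 101 + exp (2 * pi)"
  shows "unique_simple_zero (strip_homotopy C 0) {\<tau>. 0 \<le> Re \<tau> \<and> Re \<tau> \<le> 1 \<and> 1 \<le> Im \<tau> \<and> Im \<tau> \<le> 100 * (C + 2)}"
    (is "unique_simple_zero _ ?S")
proof -
  have C1: "C \<ge> 101" "C \<ge> exp (2 * pi)" using C exp_gt_zero[of "2 * pi"] by linarith+
  have k: "kap > 0" using kap_bounds(2) by linarith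
  have f: "strip_homotopy C 0 \<tau> = 288 * of_real C ^ 2 * nome \<tau> - 2 * \<i> * of_real kap * of_real C" for \<tau>
    by (simp add: strip_homotopy_def)
  define y0 where "y0 = ln (144 * C / kap) / (2 * pi)"
  define \<tau>0 where "\<tau>0 = Complex (1 / 4) y0"
  have u: "144 * C / kap > 0" using C1 k by simp
  have "exp (- 2 * pi * y0) = kap / (144 * C)"
    using u by (simp add: y0_def exp_minus inverse_eq_divide)
  then have n0: "nome \<tau>0 = \<i> * of_real (kap / (144 * C))"
    by (simp add: complex_eq_iff nome_Re_Im \<tau>0_def)
  have zero_iff: "strip_homotopy C 0 \<tau> = 0 \<longleftrightarrow> nome \<tau> = nome \<tau>0" for \<tau>
  proof -
    have "288 * of_real C ^ 2 * nome \<tau>0 = 2 * \<i> * of_real kap * of_real C"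
      using C1 by (simp add: n0 power2_eq_square field_simps)
    then have "strip_homotopy C 0 \<tau> = 288 * of_real C ^ 2 * (nome \<tau> - nome \<tau>0)"
      by (simp add: f right_diff_distrib)
    then show ?thesis using C1 by simp
  qed
  have "y0 \<ge> 1"
  proof -
    have "kap * exp (2 * pi) \<le> 2 * C" using kap_bounds(3) C1 k by (intro mult_mono) auto
    then have "exp (2 * pi) \<le> 144 * C / kap" using k C1 by (simp add: field_simps)
    then have "2 * pi \<le> ln (144 * C / kap)" using u by (subst ln_ge_iff) auto
    then show ?thesis by (simp add: y0_def field_simps)
  qed
  \<comment> \<open>The crude ln x <= x suffices, because 144 C / kap = 12 C * 2 pi.\<close>
  moreover have "y0 \<le> 100 * (C + 2)"
  proof -
    have "ln (144 * C / kap) \<le> 144 * C / kap" using ln_bound[OF u] by simp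
    also have "\<dots> = (12 * C) * (2 * pi)" by (simp add: kap_def)
    finally have "y0 \<le> 12 * C" by (simp add: y0_def divide_le_eq)
    then show ?thesis using C1 by simp
  qed
  ultimately have mem: "\<tau>0 \<in> ?S" by (simp add: \<tau>0_def)
  have "{\<tau> \<in> ?S. strip_homotopy C 0 \<tau> = 0} = {\<tau>0}"
  proof (intro equalityI subsetI)
    fix \<tau> assume "\<tau> \<in> {\<tau> \<in> ?S. strip_homotopy C 0 \<tau> = 0}"
    then have \<tau>: "0 \<le> Re \<tau>" "Re \<tau> \<le> 1" "nome \<tau> = nome \<tau>0" by (auto simp: zero_iff)
    obtain n :: int where n: "\<tau> = \<tau>0 + of_int n" using nome_eq_imp[OF \<tau>(3)] by blast
    then have "0 \<le> 1 / 4 + real_of_int n" "1 / 4 + real_of_int n \<le> 1"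
      using \<tau> by (auto simp: \<tau>0_def)
    then have "n = 0" by linarith
    then show "\<tau> \<in> {\<tau>0}" using n by simp
  qed (use mem zero_iff in auto)
  moreover have "zorder (strip_homotopy C 0) \<tau>0 = 1"
  proof (rule zorder_zero_eqI[of _ UNIV])
    show "strip_homotopy C 0 holomorphic_on UNIV"
      unfolding f[abs_def] by (intro holomorphic_intros)
    have "(strip_homotopy C 0 has_field_derivative 288 * of_real C ^ 2 * (2 * of_real pi * \<i> * nome \<tau>0)) (at \<tau>0)"
      unfolding f[abs_def] by (auto intro!: derivative_eq_intros nome_has_derivative)
    then have "deriv (strip_homotopy C 0) \<tau>0 = 288 * of_real C ^ 2 * (2 * of_real pi * \<i> * nome \<tau>0)"
      by (rule DERIV_imp_deriv)
    then show "(deriv ^^ nat 1) (strip_homotopy C 0) \<tau>0 \<noteq> 0"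
      using C1 nome_nonzero by simp
    show "(deriv ^^ i) (strip_homotopy C 0) \<tau>0 = 0" if "i < nat 1" for i
      using that zero_iff[of \<tau>0] by simp
  qed auto
  ultimately show ?thesis unfolding unique_simple_zero_def by blast
qed

lemma unique_zero_in_strip:
  assumes C: "C \<ge> 101 + exp (2 * pi)"
  shows "unique_simple_zero (Psi 1 (- of_real C)) {\<tau>. 0 \<le> Re \<tau> \<and> Re \<tau> \<le> 1 \<and> 1 \<le> Im \<tau> \<and> Im \<tau> \<le> 100 * (C + 2)}"
    (is "unique_simple_zero _ ?S")
proof -
  define V where "V = {\<tau>. 0 < Re \<tau> \<and> Re \<tau> < 1 \<and> 1 < Im \<tau> \<and> Im \<tau> < 100 * (C + 2)}"
  have C1: "C \<ge> 101" using C exp_gt_zero[of "2 * pi"] by linarith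
  have "unique_simple_zero (strip_homotopy C 1) ?S \<longleftrightarrow> unique_simple_zero (strip_homotopy C 0) ?S"
  proof (rule unique_simple_zero_continuation[of UHP 0 1 "strip_homotopy C" ?S V])
    show "open UHP" by (rule open_upper_half_plane)
    show "connected UHP" by (rule connected_UHP)
    show "strip_homotopy C t holomorphic_on UHP" for t
      unfolding strip_homotopy_def[abs_def] by (intro holomorphic_intros holomorphic_E2 holomorphic_DG)
    have "continuous_on ({0..1} \<times> UHP) (\<lambda>p. strip_homotopy C (fst p) (snd p))"
      unfolding strip_homotopy_def
      by (intro continuous_intros continuous_snd_comp continuous_E2 continuous_DG continuous_nome)
    then show "continuous_on ({0..1} \<times> UHP) (\<lambda>(t, z). strip_homotopy C t z)"
      by (simp add: case_prod_unfold)
    have S: "?S = {\<tau>. 0 \<le> Re \<tau>} \<inter> {\<tau>. Re \<tau> \<le> 1} \<inter> {\<tau>. 1 \<le> Im \<tau>} \<inter> {\<tau>. Im \<tau> \<le> 100 * (C + 2)}" by auto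
    have "?S \<subseteq> cball 0 (1 + 100 * (C + 2))"
    proof
      fix \<tau> assume "\<tau> \<in> ?S"
      then show "\<tau> \<in> cball 0 (1 + 100 * (C + 2))" using cmod_le[of \<tau>] by simp
    qed
    moreover have "closed ?S"
      unfolding S by (intro closed_Int closed_Collect_le continuous_intros)
    ultimately show "compact ?S"
      by (meson bounded_cball bounded_subset compact_eq_bounded_closed)
    have "V = {\<tau>. 0 < Re \<tau>} \<inter> {\<tau>. Re \<tau> < 1} \<inter> {\<tau>. 1 < Im \<tau>} \<inter> {\<tau>. Im \<tau> < 100 * (C + 2)}"
      by (auto simp: V_def)
    then show "open V"
      by (auto intro!: open_Int open_Collect_less continuous_intros)
    show "?S \<subseteq> UHP" "V \<subseteq> ?S" by (auto simp: V_def)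
    have "\<i> \<in> ?S - V" using C1 by (simp add: V_def)
    then show "?S - V \<noteq> {}" by blast
    show "strip_homotopy C t z \<noteq> 0" if "t \<in> {0..1}" "z \<in> ?S - V" for t z
      using strip_homotopy_zero[OF C, of t z] that by (auto simp: V_def)
  qed auto
  then show ?thesis
    using strip_homotopy_0_unique[OF C] by (simp add: strip_homotopy_1)
qed

text \<open>One truncation \<open>S\<close> serves the whole interval from c to C: its bottom comes
  from \<open>zero_Im_lower_bound\<close>, its top from \<open>Psi_nonzero_near_cusp\<close>, its
  sides from \<open>Psi_nonzero_on_boundary\<close>. So the zeros remain in the open set
  \<open>V\<close>, and the count at C passes to c.\<close>

lemma unique_zero_gt_1:
  fixes c :: real
  assumes "c > 1"
  shows "\<exists>!\<tau>. \<tau> \<in> F0 \<and> Psi 1 (- of_real c) \<tau> = 0"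
proof -
  obtain C1 where C1: "C1 > 1" "\<And>C \<tau>. C \<ge> C1 \<Longrightarrow> \<tau> \<in> F0 \<Longrightarrow> Psi 1 (- of_real C) \<tau> = 0 \<Longrightarrow> Im \<tau> > 1"
    using zero_Im_large[of 1] by blast
  define C where "C = max c (max C1 (101 + exp (2 * pi)))"
  have C: "C \<ge> c" "C \<ge> C1" "C \<ge> 101 + exp (2 * pi)" by (auto simp: C_def)
  obtain \<delta>0 where \<delta>0: "\<delta>0 > 0" "\<And>C \<tau>. C \<ge> c \<Longrightarrow> \<tau> \<in> F0 \<Longrightarrow> Psi 1 (- of_real C) \<tau> = 0 \<Longrightarrow> Im \<tau> > \<delta>0"
    using zero_Im_lower_bound[OF assms] by blast
  define \<delta> where "\<delta> = min \<delta>0 1"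
  have \<delta>: "\<delta> > 0" "\<delta> \<le> 1" "\<delta> \<le> \<delta>0" using \<delta>0(1) by (auto simp: \<delta>_def)
  define Y where "Y = 310 * (2 + C)"
  have Y: "Y \<ge> 100 * (C + 2)" "Y \<ge> 620" using C(1) assms by (auto simp: Y_def)
  define S where "S = {\<tau> \<in> F0. \<delta> \<le> Im \<tau> \<and> Im \<tau> \<le> Y}"
  define V where "V = {\<tau>. 0 < Re \<tau> \<and> Re \<tau> < 1 \<and> Re \<tau> < Re \<tau> ^ 2 + Im \<tau> ^ 2 \<and> \<delta> < Im \<tau> \<and> Im \<tau> < Y}"
  have loc: "\<delta> < Im \<tau>" "Im \<tau> < Y" "\<tau> \<in> S" "\<tau> \<in> V"
    if "C' \<in> {c..C}" "\<tau> \<in> F0" "Psi 1 (- of_real C') \<tau> = 0" for C' \<tau>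
  proof -
    have "Im \<tau> > \<delta>0" by (rule \<delta>0(2)[of C']) (use that in auto)
    then show 1: "\<delta> < Im \<tau>" using \<delta> by simp
    have "\<bar>- C'\<bar> \<le> C" using that(1) assms by simp
    from Psi_nonzero_near_cusp[OF this, of \<tau>] show 2: "Im \<tau> < Y"
      using that(2,3) by (force simp: Y_def mem_F0_iff)
    show "\<tau> \<in> S" using 1 2 that(2) by (simp add: S_def)
    have "Psi (of_real 1) (of_real (- C')) \<tau> = 0" using that(3) by simp
    then have "\<not> (Re \<tau> = 0 \<or> Re \<tau> = 1 \<or> Re \<tau> = Re \<tau> ^ 2 + Im \<tau> ^ 2)"
      using Psi_nonzero_on_boundary[OF that(2), of 1 "- C'"] by auto
    then show "\<tau> \<in> V" using 1 2 that(2) by (auto simp: V_def mem_F0_iff)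
  qed
  have "unique_simple_zero (Psi 1 (- of_real C)) {\<tau>. 0 \<le> Re \<tau> \<and> Re \<tau> \<le> 1 \<and> 1 \<le> Im \<tau> \<and> Im \<tau> \<le> 100 * (C + 2)}"
    (is "unique_simple_zero _ ?R")
    by (rule unique_zero_in_strip[OF C(3)])
  \<comment> \<open>The rectangle and the truncated triangle differ as sets but contain the same
    zeros: at this C every zero in \<open>F0\<close> lies above height 1, where \<open>F0\<close> is
    the full strip.\<close>
  moreover have "{\<tau> \<in> ?R. Psi 1 (- of_real C) \<tau> = 0} = {\<tau> \<in> S. Psi 1 (- of_real C) \<tau> = 0}"
  proof (intro equalityI subsetI)
    fix \<tau> assume "\<tau> \<in> {\<tau> \<in> ?R. Psi 1 (- of_real C) \<tau> = 0}"
    then have \<tau>: "0 \<le> Re \<tau>" "Re \<tau> \<le> 1" "1 \<le> Im \<tau>" "Im \<tau> \<le> 100 * (C + 2)" "Psi 1 (- of_real C) \<tau> = 0" by auto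
    have "1 ^ 2 \<le> Im \<tau> ^ 2" using \<tau>(3) by (intro power_mono) auto
    then have "Re \<tau> \<le> Re \<tau> ^ 2 + Im \<tau> ^ 2"
      using \<tau>(2) zero_le_power2[of "Re \<tau>"] unfolding power_one by linarith
    then show "\<tau> \<in> {\<tau> \<in> S. Psi 1 (- of_real C) \<tau> = 0}"
      using \<tau> \<delta> Y by (auto simp: S_def mem_F0_iff)
  next
    fix \<tau> assume "\<tau> \<in> {\<tau> \<in> S. Psi 1 (- of_real C) \<tau> = 0}"
    then have \<tau>: "\<tau> \<in> F0" "Psi 1 (- of_real C) \<tau> = 0" by (auto simp: S_def)
    have "1 < Im \<tau>" by (rule C1(2)[OF C(2) \<tau>])
    moreover have "Im \<tau> < 100 * (C + 2)"
      using strip_homotopy_zero(4)[OF C(3), of 1 \<tau>] \<tau> \<open>1 < Im \<tau>\<close> by (simp add: strip_homotopy_1 mem_F0_iff)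
    ultimately show "\<tau> \<in> {\<tau> \<in> ?R. Psi 1 (- of_real C) \<tau> = 0}"
      using \<tau> by (auto simp: mem_F0_iff)
  qed
  ultimately have uC: "unique_simple_zero (Psi 1 (- of_real C)) S"
    by (simp only: unique_simple_zero_def)
  have "unique_simple_zero (Psi 1 (- of_real c)) S \<longleftrightarrow> unique_simple_zero (Psi 1 (- of_real C)) S"
  proof (rule unique_simple_zero_continuation[of UHP c C "\<lambda>C. Psi 1 (- of_real C)" S V])
    show "open UHP" by (rule open_upper_half_plane)
    show "connected UHP" by (rule connected_UHP)
    show "Psi 1 (- of_real t) holomorphic_on UHP" for t by (rule holomorphic_Psi)
    have "continuous_on ({c..C} \<times> UHP) (\<lambda>p. Psi 1 (- of_real (fst p)) (snd p))"
      unfolding Psi_def by (intro continuous_intros continuous_snd_comp continuous_E2 continuous_DG)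
    then show "continuous_on ({c..C} \<times> UHP) (\<lambda>(t, z). Psi 1 (- of_real t) z)"
      by (simp add: case_prod_unfold)
    show "compact S" unfolding S_def by (rule compact_F0_truncated[OF \<delta>(1)])
    show "S \<subseteq> UHP" by (auto simp: S_def mem_F0_iff)
    have "V = {\<tau>. 0 < Re \<tau>} \<inter> {\<tau>. Re \<tau> < 1} \<inter> {\<tau>. Re \<tau> < Re \<tau> ^ 2 + Im \<tau> ^ 2} \<inter> {\<tau>. \<delta> < Im \<tau>} \<inter> {\<tau>. Im \<tau> < Y}"
      by (auto simp: V_def)
    then show "open V"
      by (auto intro!: open_Int open_Collect_less continuous_intros)
    show "V \<subseteq> S" using \<delta> by (auto simp: V_def S_def mem_F0_iff)
    have "\<i> \<in> S - V" using \<delta> Y by (simp add: S_def V_def mem_F0_iff)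
    then show "S - V \<noteq> {}" by blast
    show "Psi 1 (- of_real t) z \<noteq> 0" if "t \<in> {c..C}" "z \<in> S - V" for t z
      using loc(4)[OF that(1), of z] that(2) by (auto simp: S_def)
  qed (use C in auto)
  then have "unique_simple_zero (Psi 1 (- of_real c)) S" using uC by simp
  then obtain \<tau> where \<tau>: "{w \<in> S. Psi 1 (- of_real c) w = 0} = {\<tau>}"
    unfolding unique_simple_zero_def by blast
  have "w \<in> F0 \<and> Psi 1 (- of_real c) w = 0 \<longleftrightarrow> w \<in> {w \<in> S. Psi 1 (- of_real c) w = 0}" for w
    using loc(3)[of c w] C(1) by (auto simp: S_def)
  then show ?thesis unfolding \<tau> by auto
qed

lemma unique_zero_rot:
  fixes C :: real
  assumes "C \<noteq> 0" and u: "\<exists>!\<tau>. \<tau> \<in> F0 \<and> Psi 1 (- of_real (1 - 1 / C)) \<tau> = 0"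
  shows "\<exists>!\<tau>. \<tau> \<in> F0 \<and> Psi 1 (- of_real C) \<tau> = 0"
proof -
  obtain \<sigma> where \<sigma>: "\<sigma> \<in> F0" "Psi 1 (- of_real (1 - 1 / C)) \<sigma> = 0"
    and uniq: "\<And>\<sigma>'. \<sigma>' \<in> F0 \<Longrightarrow> Psi 1 (- of_real (1 - 1 / C)) \<sigma>' = 0 \<Longrightarrow> \<sigma>' = \<sigma>"
    using u by (elim ex1E conjE) blast
  show ?thesis
  proof (rule ex1I[of _ "rot \<sigma>"])
    show "rot \<sigma> \<in> F0 \<and> Psi 1 (- of_real C) (rot \<sigma>) = 0"
      using \<sigma> rot_in_F0[OF \<sigma>(1)] Psi_rot_real_zero_iff[OF F0_Im_pos[OF \<sigma>(1)] assms(1)] by simp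
    fix \<tau> assume \<tau>: "\<tau> \<in> F0 \<and> Psi 1 (- of_real C) \<tau> = 0"
    define \<sigma>' where "\<sigma>' = rot (rot \<tau>)"
    have F: "\<sigma>' \<in> F0" and r: "rot \<sigma>' = \<tau>"
      using \<tau> rot_in_F0 rot_rot_rot[OF F0_Im_pos] by (auto simp: \<sigma>'_def)
    have "Psi 1 (- of_real (1 - 1 / C)) \<sigma>' = 0"
      using Psi_rot_real_zero_iff[OF F0_Im_pos[OF F] assms(1)] \<tau> r by simp
    then show "\<tau> = rot \<sigma>" using uniq[OF F] r by simp
  qed
qed

text \<open>One rotation leads from C < 0 to C > 1, and one from 0 < C < 1 to C < 0.\<close>

lemma unique_zero:
  fixes C :: real
  assumes "C \<noteq> 0" "C \<noteq> 1"
  shows "\<exists>!\<tau>. \<tau> \<in> F0 \<and> Psi 1 (- of_real C) \<tau> = 0"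
proof -
  have neg: "\<exists>!\<tau>. \<tau> \<in> F0 \<and> Psi 1 (- of_real C) \<tau> = 0" if "C < 0" for C :: real
    by (rule unique_zero_rot[OF _ unique_zero_gt_1]) (use that in auto)
  consider "C > 1" | "C < 0" | "0 < C" "C < 1" using assms by linarith
  then show ?thesis
  proof cases
    case 3
    then have "1 - 1 / C < 0" by (simp add: field_simps)
    then show ?thesis using unique_zero_rot[OF assms(1)] neg by blast
  qed (use neg unique_zero_gt_1 in blast)+
qed

section \<open>Transfer to the zeros of eta1'\<close>

lemma f_C_eq_0_iff: "Im \<tau> > 0 \<Longrightarrow> f_C C \<tau> = 0 \<longleftrightarrow> Psi 1 (- of_real C) \<tau> = 0"
  by (simp add: f_C_eq_Psi)

lemma tau_zero_iff:
  assumes "C \<noteq> 0" "C \<noteq> 1" "\<tau> \<in> F0"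
  shows "Psi 1 (- of_real C) \<tau> = 0 \<longleftrightarrow> \<tau> = tau_zero C"
    and "tau_zero C \<in> F0"
proof -
  have eq: "\<tau> \<in> F0 \<and> f_C C \<tau> = 0 \<longleftrightarrow> \<tau> \<in> F0 \<and> Psi 1 (- of_real C) \<tau> = 0" for \<tau>
    using f_C_eq_0_iff F0_Im_pos by blast
  have ex1: "\<exists>!\<tau>. \<tau> \<in> F0 \<and> Psi 1 (- of_real C) \<tau> = 0"
    by (rule unique_zero[OF assms(1,2)])
  from theI'[OF this] have "tau_zero C \<in> F0 \<and> Psi 1 (- of_real C) (tau_zero C) = 0"
    unfolding tau_zero_def eq .
  then show "tau_zero C \<in> F0" "Psi 1 (- of_real C) \<tau> = 0 \<longleftrightarrow> \<tau> = tau_zero C"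
    using ex1 assms(3) by blast+
qed

lemma Psi_0_1_moebius_eq_0_iff:
  assumes "a * d - b * c = 1" "Im \<tau> > 0"
  shows "Psi 0 1 ((of_int a * \<tau> + of_int b) / (of_int c * \<tau> + of_int d)) = 0 \<longleftrightarrow> Psi (of_int c) (of_int d) \<tau> = 0"
proof -
  have "of_int c * \<tau> + of_int d \<noteq> 0"
    using assms by (intro moebius_denom_nonzero) auto
  then show ?thesis using Psi_transformation[OF assms, of 0 1] by simp
qed

text \<open>The level 2 enters here: c even forces d odd, so -d/c is neither 0 nor 1, the two
  excluded parameters of \<open>tau_zero\<close>.\<close>

lemma Psi_of_int_eq_0_iff:
  assumes "a * d - b * c = 1" "even c" "c \<noteq> 0" "\<tau> \<in> F0"
  shows "Psi (of_int c) (of_int d) \<tau> = 0 \<longleftrightarrow> \<tau> = tau_zero (- of_int d / of_int c)"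
    and "tau_zero (- of_int d / of_int c) \<in> F0"
proof -
  define C :: real where "C = - of_int d / of_int c"
  have "odd d"
  proof
    assume "even d"
    then have "even (a * d - b * c)" using assms(2) by simp
    then show False using assms(1) by simp
  qed
  then have "d \<noteq> 0" "d \<noteq> - c" using assms(2) by auto
  then have C: "C \<noteq> 0" "C \<noteq> 1"
    using assms(3) by (auto simp: C_def divide_eq_eq simp flip: of_int_minus)
  have "- of_real C = (of_int d / of_int c :: complex)" by (simp add: C_def)
  then have "Psi (of_int c) (of_int d) \<tau> = of_int c ^ 2 * Psi 1 (- of_real C) \<tau>"
    using Psi_scale[of "of_int c" 1 "of_int d / of_int c" \<tau>] assms(3) by simp
  then show "Psi (of_int c) (of_int d) \<tau> = 0 \<longleftrightarrow> \<tau> = tau_zero (- of_int d / of_int c)"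
    and "tau_zero (- of_int d / of_int c) \<in> F0"
    using tau_zero_iff[OF C assms(4)] assms(3) by (simp_all add: C_def)
qed

lemma deriv_eta1_moebius_eq_0_iff:
  assumes "a * d - b * c = 1" "even c" "c \<noteq> 0" "\<tau> \<in> F0"
  shows "deriv eta1 ((of_int a * \<tau> + of_int b) / (of_int c * \<tau> + of_int d)) = 0
     \<longleftrightarrow> \<tau> = tau_zero (- of_int d / of_int c)"
  using deriv_eta1_eq_0_iff[OF moebius_Im_pos[OF F0_Im_pos[OF assms(4)] assms(1)]]
    Psi_0_1_moebius_eq_0_iff[OF assms(1) F0_Im_pos[OF assms(4)]] Psi_of_int_eq_0_iff(1)[OF assms] by simp

text \<open>After reduction to the modular triangle, one of the three rotations is split off,
  according to which of c, c + d and d is even; these parities distinguish the three cosets of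
  \<open>Gamma0_2\<close>.\<close>

lemma Gamma0_2_cover:
  assumes "Im \<tau> > 0"
  obtains a b c d :: int and \<xi> where "a * d - b * c = 1" "even c" "\<xi> \<in> F0"
    "\<tau> = (of_int a * \<xi> + of_int b) / (of_int c * \<xi> + of_int d)"
proof -
  obtain a0 b0 c0 d0 :: int where det0: "a0 * d0 - b0 * c0 = 1"
    and mem: "(of_int a0 * \<tau> + of_int b0) / (of_int c0 * \<tau> + of_int d0) \<in> modular_domain"
    by (rule modular_reduction[OF assms])
  define \<sigma> where "\<sigma> = (of_int a0 * \<tau> + of_int b0) / (of_int c0 * \<tau> + of_int d0)"
  define a b c d where "a = d0" and "b = - b0" and "c = - c0" and "d = a0"
  have det: "a * d - b * c = 1" using det0 by (simp add: a_def b_def c_def d_def algebra_simps)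
  have s: "\<sigma> \<in> modular_domain" "Im \<sigma> > 0"
    using mem modular_domain_Im_pos by (auto simp: \<sigma>_def)
  have nz0: "of_int c0 * \<tau> + of_int d0 \<noteq> 0"
    using assms det0 by (intro moebius_denom_nonzero) auto
  have nz: "of_int c * \<sigma> + of_int d \<noteq> 0"
    using s(2) det by (intro moebius_denom_nonzero) auto
  have \<tau>: "\<tau> = (of_int a * \<sigma> + of_int b) / (of_int c * \<sigma> + of_int d)"
  proof -
    have detc: "of_int a0 * of_int d0 - of_int b0 * of_int c0 = (1 :: complex)"
      using det0 by (metis of_int_1 of_int_diff of_int_mult)
    have "\<sigma> * (of_int c0 * \<tau> + of_int d0) = of_int a0 * \<tau> + of_int b0"
      using nz0 by (simp add: \<sigma>_def)
    then have "of_int a * \<sigma> + of_int b = \<tau> * (of_int c * \<sigma> + of_int d)"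
      by (simp add: a_def b_def c_def d_def algebra_simps)
    then show ?thesis using nz by (simp add: eq_divide_eq)
  qed
  have F: "\<sigma> \<in> F0" "rot \<sigma> \<in> F0" "rot (rot \<sigma>) \<in> F0"
    using s(1) modular_domain_subset_F0 rot_in_F0 by auto
  have nz1: "\<sigma> \<noteq> 0" "\<sigma> \<noteq> 1" "1 - \<sigma> \<noteq> 0" using s(2) by auto
  have scale: "X / Y = (X * u) / (Y * u)" if "u \<noteq> 0" for X Y u :: complex
    using that by simp
  consider "even c" | "even (c + d)" | "even d" by auto
  then show ?thesis
  proof cases
    case 1
    then show ?thesis using that det F(1) \<tau> by blast
  next
    case 2
    have gen: "(A * rot \<sigma> + B) * (1 - \<sigma>) = A + B * (1 - \<sigma>)" for A B
    proof -
      have "rot \<sigma> * (1 - \<sigma>) = 1" using nz1 by (simp add: rot_def)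
      then show ?thesis by (simp only: distrib_right mult.assoc) simp
    qed
    have "(of_int (a + b) * rot \<sigma> + of_int (- a)) / (of_int (c + d) * rot \<sigma> + of_int (- c)) =
        ((of_int (a + b) * rot \<sigma> + of_int (- a)) * (1 - \<sigma>)) / ((of_int (c + d) * rot \<sigma> + of_int (- c)) * (1 - \<sigma>))"
      by (rule scale) (use nz1 in simp)
    also have "(of_int (a + b) * rot \<sigma> + of_int (- a)) * (1 - \<sigma>) = of_int a * \<sigma> + of_int b"
      unfolding gen by (simp add: algebra_simps)
    also have "(of_int (c + d) * rot \<sigma> + of_int (- c)) * (1 - \<sigma>) = of_int c * \<sigma> + of_int d"
      unfolding gen by (simp add: algebra_simps)
    finally show ?thesis
      using that[of "a + b" "- c" "- a" "c + d" "rot \<sigma>"] 2 det F(2) \<tau> by (simp add: algebra_simps)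
  next
    case 3
    have gen: "(A * rot (rot \<sigma>) + B) * \<sigma> = A * (\<sigma> - 1) + B * \<sigma>" for A B
    proof -
      have "rot (rot \<sigma>) * \<sigma> = \<sigma> - 1" using nz1 rot_rot[OF nz1(1,2)] by simp
      then show ?thesis by (simp only: distrib_right mult.assoc)
    qed
    have "(of_int (- b) * rot (rot \<sigma>) + of_int (a + b)) / (of_int (- d) * rot (rot \<sigma>) + of_int (c + d)) =
        ((of_int (- b) * rot (rot \<sigma>) + of_int (a + b)) * \<sigma>) / ((of_int (- d) * rot (rot \<sigma>) + of_int (c + d)) * \<sigma>)"
      by (rule scale) (use nz1 in simp)
    also have "(of_int (- b) * rot (rot \<sigma>) + of_int (a + b)) * \<sigma> = of_int a * \<sigma> + of_int b"
      unfolding gen by (simp add: algebra_simps)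
    also have "(of_int (- d) * rot (rot \<sigma>) + of_int (c + d)) * \<sigma> = of_int c * \<sigma> + of_int d"
      unfolding gen by (simp add: algebra_simps)
    finally show ?thesis
      using that[of "- b" "c + d" "a + b" "- d" "rot (rot \<sigma>)"] 3 det F(3) \<tau> by (simp add: algebra_simps)
  qed
qed

lemma deriv_eta1_nonzero_translate:
  fixes m :: int
  assumes "\<tau> \<in> F0"
  shows "deriv eta1 (\<tau> + of_int m) \<noteq> 0"
proof -
  have "Psi 0 1 (\<tau> + of_int m) \<noteq> 0"
    using Psi_0_1_moebius_eq_0_iff[of 1 1 m 0 \<tau>] F0_Im_pos[OF assms] DG_nonzero_on_F0[OF assms] by (simp add: Psi_0_1)
  then show ?thesis
    using deriv_eta1_eq_0_iff[of "\<tau> + of_int m"] F0_Im_pos[OF assms] by simp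
qed

lemma moebius_act_eq:
  fixes \<gamma> :: "int^2^2"
  shows "moebius_act \<gamma> \<tau> = (of_int (\<gamma>$1$1) * \<tau> + of_int (\<gamma>$1$2)) / (of_int (\<gamma>$2$1) * \<tau> + of_int (\<gamma>$2$2))"
  by (simp add: moebius_act_def moebius_def)

lemma mem_Gamma0_2_iff:
  fixes \<gamma> :: "int^2^2"
  shows "\<gamma> \<in> Gamma0_2 \<longleftrightarrow> \<gamma>$1$1 * \<gamma>$2$2 - \<gamma>$1$2 * \<gamma>$2$1 = 1 \<and> even (\<gamma>$2$1)"
  by (simp add: Gamma0_2_def det_2)

text \<open>1/2 is the height of the top of the circle that bounds \<open>F0\<close>, so from there
  on only the real part has to be adjusted.\<close>

lemma translate_into_F0:
  assumes "Im \<tau> \<ge> 1 / 2"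
  shows "\<tau> - of_int \<lfloor>Re \<tau>\<rfloor> \<in> F0"
proof -
  define x where "x = Re \<tau> - of_int \<lfloor>Re \<tau>\<rfloor>"
  have x: "0 \<le> x" "x \<le> 1" unfolding x_def by linarith+
  have "(1 / 2) ^ 2 \<le> Im \<tau> ^ 2" using assms by (intro power_mono) auto
  moreover have "0 \<le> (x - 1 / 2) ^ 2" by simp
  ultimately have "x \<le> x ^ 2 + Im \<tau> ^ 2" by (simp add: power2_eq_square algebra_simps)
  then show ?thesis using x assms by (simp add: mem_F0_iff x_def)
qed

theorem theorem4p1:
  shows "(\<forall>m::int. \<forall>\<tau>\<in>(\<lambda>\<tau>. \<tau> + of_int m) ` F0. deriv eta1 \<tau> \<noteq> 0)
    \<and> (\<forall>\<tau>. Im \<tau> \<ge> 1/2 \<longrightarrow> deriv eta1 \<tau> \<noteq> 0)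
    \<and> (\<forall>\<gamma>\<in>Gamma0_2. \<gamma>$2$1 \<noteq> 0 \<longrightarrow>
         {\<tau> \<in> moebius_act \<gamma> ` F0. deriv eta1 \<tau> = 0}
           = {moebius_act \<gamma> (tau_zero (- of_int (\<gamma>$2$2) / of_int (\<gamma>$2$1)))})
    \<and> Theta = {\<tau> \<in> upper_half_plane. deriv eta1 \<tau> = 0}"
proof (intro conjI allI impI ballI)
  fix m :: int and \<tau> assume "\<tau> \<in> (\<lambda>\<tau>. \<tau> + of_int m) ` F0"
  then show "deriv eta1 \<tau> \<noteq> 0" using deriv_eta1_nonzero_translate by blast
next
  fix \<tau> :: complex assume "Im \<tau> \<ge> 1/2"
  then show "deriv eta1 \<tau> \<noteq> 0"
    using deriv_eta1_nonzero_translate[OF translate_into_F0, of \<tau> "\<lfloor>Re \<tau>\<rfloor>"] by simp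
next
  fix \<gamma> :: "int^2^2" assume \<gamma>: "\<gamma> \<in> Gamma0_2" "\<gamma>$2$1 \<noteq> 0"
  note g = \<gamma>(1)[unfolded mem_Gamma0_2_iff]
  have iff: "deriv eta1 (moebius_act \<gamma> \<tau>) = 0 \<longleftrightarrow> \<tau> = tau_zero (- of_int (\<gamma>$2$2) / of_int (\<gamma>$2$1))"
    if "\<tau> \<in> F0" for \<tau>
    unfolding moebius_act_eq using deriv_eta1_moebius_eq_0_iff[OF _ _ \<gamma>(2) that] g by blast
  have mem: "tau_zero (- of_int (\<gamma>$2$2) / of_int (\<gamma>$2$1)) \<in> F0" if "\<tau> \<in> F0" for \<tau>
    using Psi_of_int_eq_0_iff(2)[OF _ _ \<gamma>(2) that] g by blast
  \<comment> \<open>A point of \<open>F0\<close> to instantiate the premise of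
    \<open>mem\<close>.\<close>
  have "\<i> \<in> F0" by (simp add: mem_F0_iff)
  then show "{\<tau> \<in> moebius_act \<gamma> ` F0. deriv eta1 \<tau> = 0}
           = {moebius_act \<gamma> (tau_zero (- of_int (\<gamma>$2$2) / of_int (\<gamma>$2$1)))}"
    using iff mem by auto
next
  have iF: "\<i> \<in> F0" by (simp add: mem_F0_iff)
  show "Theta = {\<tau> \<in> upper_half_plane. deriv eta1 \<tau> = 0}"
  proof (intro equalityI subsetI)
    fix \<tau> assume "\<tau> \<in> Theta"
    then obtain \<gamma> :: "int^2^2" where \<gamma>: "\<gamma> \<in> Gamma0_2" "\<gamma>$2$1 \<noteq> 0"
      and \<tau>: "\<tau> = moebius_act \<gamma> (tau_zero (- of_int (\<gamma>$2$2) / of_int (\<gamma>$2$1)))"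
      unfolding Theta_def by blast
    from \<gamma>(1) have g: "\<gamma>$1$1 * \<gamma>$2$2 - \<gamma>$1$2 * \<gamma>$2$1 = 1" "even (\<gamma>$2$1)"
      by (auto simp: mem_Gamma0_2_iff)
    note t = Psi_of_int_eq_0_iff(2)[OF g \<gamma>(2) iF]
    show "\<tau> \<in> {\<tau> \<in> upper_half_plane. deriv eta1 \<tau> = 0}"
      unfolding \<tau> moebius_act_eq
      using moebius_Im_pos[OF F0_Im_pos[OF t] g(1)] deriv_eta1_moebius_eq_0_iff[OF g \<gamma>(2) t]
      by (simp add: upper_half_plane_def)
  next
    fix \<tau> assume "\<tau> \<in> {\<tau> \<in> upper_half_plane. deriv eta1 \<tau> = 0}"
    then have Im: "Im \<tau> > 0" and 0: "deriv eta1 \<tau> = 0" by (auto simp: upper_half_plane_def)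
    obtain a b c d :: int and \<xi> where abcd: "a * d - b * c = 1" "even c" and \<xi>: "\<xi> \<in> F0"
      and \<tau>: "\<tau> = (of_int a * \<xi> + of_int b) / (of_int c * \<xi> + of_int d)"
      by (rule Gamma0_2_cover[OF Im])
    \<comment> \<open>For c = 0 the matrix is a translation up to sign, and \<open>DG\<close> has no
      zero in \<open>F0\<close>.\<close>
    have "c \<noteq> 0"
    proof
      assume "c = 0"
      then have "d \<noteq> 0" using abcd by auto
      have "Psi 0 1 \<tau> = 0" using deriv_eta1_eq_0_iff[OF Im] 0 by simp
      then have "Psi (of_int c) (of_int d) \<xi> = 0"
        unfolding \<tau> using Psi_0_1_moebius_eq_0_iff[OF abcd(1) F0_Im_pos[OF \<xi>]] by simp
      then show False
        using \<open>c = 0\<close> \<open>d \<noteq> 0\<close> DG_nonzero_on_F0[OF \<xi>] by (simp add: Psi_def)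
    qed
    define \<gamma> :: "int^2^2" where "\<gamma> = vector [vector [a, b], vector [c, d]]"
    have ent: "\<gamma>$1$1 = a" "\<gamma>$1$2 = b" "\<gamma>$2$1 = c" "\<gamma>$2$2 = d"
      by (simp_all add: \<gamma>_def vector_2)
    have "\<xi> = tau_zero (- of_int d / of_int c)"
      using deriv_eta1_moebius_eq_0_iff[OF abcd \<open>c \<noteq> 0\<close> \<xi>] 0 \<tau> by simp
    then have "\<tau> = moebius_act \<gamma> (tau_zero (- of_int (\<gamma>$2$2) / of_int (\<gamma>$2$1)))"
      using \<tau> by (simp add: moebius_act_eq ent)
    moreover have "\<gamma> \<in> Gamma0_2" "\<gamma>$2$1 \<noteq> 0"
      using abcd \<open>c \<noteq> 0\<close> by (simp_all add: mem_Gamma0_2_iff ent)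
    ultimately show "\<tau> \<in> Theta" unfolding Theta_def by blast
  qed
qed

end
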